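(* Let $(M^n,g)$ be a complete, properly immersed hypersurface translating soliton in $\mathbb{R}^{n+1}$, with mean curvature $H$ and second fundamental form $A$. Suppose that for some real constant $a>0$, $$a(a-1)-a^2H^2+|A|^2\le 0\quad\text{on } M.$$ Then $M$ is stable, in the sense that for every $f\in C_0^2(M)$, $$\int_M\big(-\Delta f+\nabla_{W^T}f-|A|^2f\big)\,f\,\exp(-S(X))\,dv_g\ \ge\ 0.$$
   Context: Let $W\in\mathbb{R}^{n+1}$ be a fixed unit vector. For an immersed hypersurface $M^n\subset\mathbb{R}^{n+1}$ with induced metric $g$, unit normal $\nu$ and local orthonormal tangent frame $\{e_i\}$, the second fundamental form is $A=(h_{ij})$ with $h_{ij}=\langle D_{e_i}\nu,e_j\rangle$ ($D$ the directional derivative of $\mathbb{R}^{n+1}$), and $H=\sum_j h_{jj}$; the mean curvature vector is $\vec H=-H\nu$. $M$ is a translating soliton (with respect to $W$) if $H=\langle\nu,W\rangle$ on $M$. $X$ is the position vector, $S(X)=\langle X,W\rangle$, $W^T$ is the tangential part of $W$ along $M$, $\Delta$ and $\nabla$ are the Laplacian and the Levi-Civita connection of $(M,g)$, and $dv_g$ is the Riemannian volume measure. $C_0^2(M)$ denotes compactly supported $C^2$ functions on $M$. *)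

theory Defs
  imports "HOL-Analysis.Analysis"
begin

section \<open>Differentiability classes on open subsets of Euclidean space\<close>

primrec Ck_on :: "nat \<Rightarrow> 'a::euclidean_space set \<Rightarrow> ('a \<Rightarrow> 'b::real_normed_vector) \<Rightarrow> bool" where
  "Ck_on 0 S f \<longleftrightarrow> continuous_on S f"
| "Ck_on (Suc k) S f \<longleftrightarrow>
     (\<forall>x\<in>S. f differentiable (at x)) \<and>
     (\<forall>v. Ck_on k S (\<lambda>x. frechet_derivative f (at x) v))"

definition smooth_on :: "'a::euclidean_space set \<Rightarrow> ('a \<Rightarrow> 'b::real_normed_vector) \<Rightarrow> bool" where
  "smooth_on S f \<longleftrightarrow> (\<forall>k. Ck_on k S f)"

definition pd :: "'n::finite \<Rightarrow> (real^'n \<Rightarrow> 'b::real_normed_vector) \<Rightarrow> real^'n \<Rightarrow> 'b" where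
  "pd i f y = frechet_derivative f (at y) (axis i 1)"


section \<open>Manifolds and immersions\<close>

text \<open>
  The underlying space of the manifold is a whole type with a Hausdorff, second countable
  topology. A patch (V, psi) is an inverse chart: psi maps the open
  set V of R^n homeomorphically onto an open set of the manifold.
\<close>

type_synonym ('n, 'm) patch = "(real^'n) set \<times> (real^'n \<Rightarrow> 'm)"

definition smooth_atlas ::
    "('n::finite, 'm::{t2_space, second_countable_topology}) patch set \<Rightarrow> bool" where
  "smooth_atlas \<A> \<longleftrightarrow>
     (\<forall>(V, \<psi>)\<in>\<A>. open V \<and> open (\<psi> ` V) \<and> (\<exists>\<phi>. homeomorphism V (\<psi> ` V) \<psi> \<phi>)) \<and>
     (\<Union>(V, \<psi>)\<in>\<A>. \<psi> ` V) = UNIV \<and>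
     (\<forall>(V, \<psi>)\<in>\<A>. \<forall>(V', \<psi>')\<in>\<A>.
        smooth_on (V \<inter> \<psi> -` (\<psi>' ` V')) (inv_into V' \<psi>' \<circ> \<psi>))"

definition Ck_fun :: "nat \<Rightarrow> ('n::finite, 'm) patch set \<Rightarrow> ('m \<Rightarrow> 'b::real_normed_vector) \<Rightarrow> bool" where
  "Ck_fun k \<A> f \<longleftrightarrow> (\<forall>(V, \<psi>)\<in>\<A>. Ck_on k V (f \<circ> \<psi>))"

definition compactly_supported :: "('m::topological_space \<Rightarrow> real) \<Rightarrow> bool" where
  "compactly_supported f \<longleftrightarrow> compact (closure {p. f p \<noteq> 0})"

definition smooth_immersion :: "('n::finite, 'm) patch set \<Rightarrow> ('m \<Rightarrow> real^'k) \<Rightarrow> bool" where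
  "smooth_immersion \<A> X \<longleftrightarrow>
     (\<forall>(V, \<psi>)\<in>\<A>. smooth_on V (X \<circ> \<psi>) \<and>
        (\<forall>y\<in>V. inj (frechet_derivative (X \<circ> \<psi>) (at y))))"

text \<open>
  One patch is fixed around each point p. A tangent vector at p is represented by its vector of
  components in that patch, so the tangent space at p is real^'n, and mdiff \<A> F p is the
  differential of F at p. All quantities defined below are independent of the choice of patch.
\<close>

definition patch_at :: "('n::finite, 'm) patch set \<Rightarrow> 'm \<Rightarrow> ('n, 'm) patch" where
  "patch_at \<A> p = (SOME c. c \<in> \<A> \<and> p \<in> snd c ` fst c)"

definition coords_at :: "('n::finite, 'm) patch set \<Rightarrow> 'm \<Rightarrow> real^'n" where
  "coords_at \<A> p = inv_into (fst (patch_at \<A> p)) (snd (patch_at \<A> p)) p"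

definition mdiff ::
    "('n::finite, 'm) patch set \<Rightarrow> ('m \<Rightarrow> 'b::real_normed_vector) \<Rightarrow> 'm \<Rightarrow> real^'n \<Rightarrow> 'b" where
  "mdiff \<A> F p = frechet_derivative (F \<circ> snd (patch_at \<A> p)) (at (coords_at \<A> p))"


section \<open>The induced metric\<close>

definition induced_metric ::
    "('n::finite, 'm) patch set \<Rightarrow> ('m \<Rightarrow> real^'k) \<Rightarrow> 'm \<Rightarrow> real^'n \<Rightarrow> real^'n \<Rightarrow> real" where
  "induced_metric \<A> X p v w = mdiff \<A> X p v \<bullet> mdiff \<A> X p w"

definition metric_matrix ::
    "('m \<Rightarrow> real^'k) \<Rightarrow> (real^'n \<Rightarrow> 'm) \<Rightarrow> real^'n \<Rightarrow> real^'n^'n::finite" where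
  "metric_matrix X \<psi> y = (\<chi> i j. pd i (X \<circ> \<psi>) y \<bullet> pd j (X \<circ> \<psi>) y)"

definition riemannian_volume ::
    "('n::finite, 'm::topological_space) patch set \<Rightarrow> ('m \<Rightarrow> real^'k) \<Rightarrow> 'm measure" where
  "riemannian_volume \<A> X = (THE \<mu>. sets \<mu> = sets borel \<and>
     (\<forall>(V, \<psi>)\<in>\<A>. \<forall>B\<in>sets borel. B \<subseteq> \<psi> ` V \<longrightarrow>
        emeasure \<mu> B =
          (\<integral>\<^sup>+y. ennreal (sqrt (det (metric_matrix X \<psi> y))) * indicator (V \<inter> \<psi> -` B) y \<partial>lborel)))"

definition piecewise_C1_curve ::
    "('n::finite, 'm::topological_space) patch set \<Rightarrow> (real \<Rightarrow> 'm) \<Rightarrow> bool" where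
  "piecewise_C1_curve \<A> c \<longleftrightarrow> path c \<and>
     (\<exists>T. finite T \<and> (\<forall>(V, \<psi>)\<in>\<A>.
        (inv_into V \<psi> \<circ> c) C1_differentiable_on ({0<..<1} \<inter> c -` (\<psi> ` V) - T)))"

text \<open>
  For the induced metric, the length of the velocity of c is the Euclidean norm of the velocity
  of X \<circ> c. Velocities may be unbounded near the exceptional points, hence the
  Lebesgue integral in ennreal, which assigns infinite length to nonrectifiable curves.
\<close>

definition curve_length :: "('m \<Rightarrow> real^'k) \<Rightarrow> (real \<Rightarrow> 'm) \<Rightarrow> ennreal" where
  "curve_length X c =
     (\<integral>\<^sup>+t. ennreal (norm (vector_derivative (X \<circ> c) (at t))) * indicator {0..1} t \<partial>lborel)"

definition riemannian_dist ::
    "('n::finite, 'm::topological_space) patch set \<Rightarrow> ('m \<Rightarrow> real^'k) \<Rightarrow> 'm \<Rightarrow> 'm \<Rightarrow> ennreal" where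
  "riemannian_dist \<A> X p q =
     (INF c \<in> {c. piecewise_C1_curve \<A> c \<and> pathstart c = p \<and> pathfinish c = q}. curve_length X c)"

definition riemannian_complete ::
    "('n::finite, 'm::topological_space) patch set \<Rightarrow> ('m \<Rightarrow> real^'k) \<Rightarrow> bool" where
  "riemannian_complete \<A> X \<longleftrightarrow>
     (\<forall>s :: nat \<Rightarrow> 'm.
        (\<forall>e>0. \<exists>N. \<forall>i\<ge>N. \<forall>j\<ge>N. riemannian_dist \<A> X (s i) (s j) < ennreal e) \<longrightarrow>
        (\<exists>p. (\<lambda>i. riemannian_dist \<A> X (s i) p) \<longlonglongrightarrow> 0))"

text \<open>
  In a patch, Delta f = (1/sqrt G) sum_i d_i (sqrt G sum_j g^{ij} d_j f), where G = det (g_ij).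
\<close>

definition patch_laplacian ::
    "('m \<Rightarrow> real^'k) \<Rightarrow> (real^'n::finite \<Rightarrow> 'm) \<Rightarrow> ('m \<Rightarrow> real) \<Rightarrow> real^'n \<Rightarrow> real" where
  "patch_laplacian X \<psi> f y =
     (\<Sum>i\<in>UNIV. pd i (\<lambda>z. sqrt (det (metric_matrix X \<psi> z)) *
        (\<Sum>j\<in>UNIV. matrix_inv (metric_matrix X \<psi> z) $ i $ j * pd j (f \<circ> \<psi>) z)) y)
     / sqrt (det (metric_matrix X \<psi> y))"

definition laplacian ::
    "('n::finite, 'm) patch set \<Rightarrow> ('m \<Rightarrow> real^'k) \<Rightarrow> ('m \<Rightarrow> real) \<Rightarrow> 'm \<Rightarrow> real" where
  "laplacian \<A> X f p = patch_laplacian X (snd (patch_at \<A> p)) f (coords_at \<A> p)"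

definition tangential_part ::
    "('n::finite, 'm) patch set \<Rightarrow> ('m \<Rightarrow> real^'k) \<Rightarrow> real^'k \<Rightarrow> 'm \<Rightarrow> real^'n" where
  "tangential_part \<A> X W p =
     (THE v. \<forall>w. (W - mdiff \<A> X p v) \<bullet> mdiff \<A> X p w = 0)"


section \<open>Extrinsic curvature\<close>

text \<open>
  A unit normal field is only required near the point in question, so the hypersurface need not be
  orientable. Only continuity is demanded: a continuous unit normal field along a smooth
  hypersurface immersion is automatically smooth.
\<close>

definition unit_normal_near ::
    "('n::finite, 'm::topological_space) patch set \<Rightarrow> ('m \<Rightarrow> real^'k) \<Rightarrow> 'm \<Rightarrow> ('m \<Rightarrow> real^'k) \<Rightarrow> bool" where
  "unit_normal_near \<A> X p \<nu> \<longleftrightarrow>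
     (\<exists>U. open U \<and> p \<in> U \<and> continuous_on U \<nu> \<and>
        (\<forall>q\<in>U. norm (\<nu> q) = 1 \<and> (\<forall>v. \<nu> q \<bullet> mdiff \<A> X q v = 0)))"

definition sff ::
    "('n::finite, 'm) patch set \<Rightarrow> ('m \<Rightarrow> real^'k) \<Rightarrow> ('m \<Rightarrow> real^'k) \<Rightarrow> 'm \<Rightarrow> real^'n \<Rightarrow> real^'n \<Rightarrow> real" where
  "sff \<A> X \<nu> p v w = mdiff \<A> \<nu> p v \<bullet> mdiff \<A> X p w"

definition orthonormal_frame ::
    "('n::finite, 'm) patch set \<Rightarrow> ('m \<Rightarrow> real^'k) \<Rightarrow> 'm \<Rightarrow> ('n \<Rightarrow> real^'n) \<Rightarrow> bool" where
  "orthonormal_frame \<A> X p e \<longleftrightarrow>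
     (\<forall>i j. induced_metric \<A> X p (e i) (e j) = (if i = j then 1 else 0))"

definition frame_at :: "('n::finite, 'm) patch set \<Rightarrow> ('m \<Rightarrow> real^'k) \<Rightarrow> 'm \<Rightarrow> 'n \<Rightarrow> real^'n" where
  "frame_at \<A> X p = (SOME e. orthonormal_frame \<A> X p e)"

definition mean_curvature_wrt ::
    "('n::finite, 'm) patch set \<Rightarrow> ('m \<Rightarrow> real^'k) \<Rightarrow> ('m \<Rightarrow> real^'k) \<Rightarrow> 'm \<Rightarrow> real" where
  "mean_curvature_wrt \<A> X \<nu> p =
     (\<Sum>j\<in>UNIV. sff \<A> X \<nu> p (frame_at \<A> X p j) (frame_at \<A> X p j))"

definition sff_norm_sq_wrt ::
    "('n::finite, 'm) patch set \<Rightarrow> ('m \<Rightarrow> real^'k) \<Rightarrow> ('m \<Rightarrow> real^'k) \<Rightarrow> 'm \<Rightarrow> real" where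
  "sff_norm_sq_wrt \<A> X \<nu> p =
     (\<Sum>i\<in>UNIV. \<Sum>j\<in>UNIV. (sff \<A> X \<nu> p (frame_at \<A> X p i) (frame_at \<A> X p j))\<^sup>2)"

text \<open>
  The sign of H and of h_ij depends on the unit normal, but H^2 and |A|^2 do not, so for these any
  local unit normal may be selected. The soliton equation is likewise invariant under
  changing the sign of the normal, and is required for every local unit normal.
\<close>

definition some_normal ::
    "('n::finite, 'm::topological_space) patch set \<Rightarrow> ('m \<Rightarrow> real^'k) \<Rightarrow> 'm \<Rightarrow> 'm \<Rightarrow> real^'k" where
  "some_normal \<A> X p = (SOME \<nu>. unit_normal_near \<A> X p \<nu>)"

definition mean_curvature_sq ::
    "('n::finite, 'm::topological_space) patch set \<Rightarrow> ('m \<Rightarrow> real^'k) \<Rightarrow> 'm \<Rightarrow> real" where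
  "mean_curvature_sq \<A> X p = (mean_curvature_wrt \<A> X (some_normal \<A> X p) p)\<^sup>2"

definition sff_norm_sq ::
    "('n::finite, 'm::topological_space) patch set \<Rightarrow> ('m \<Rightarrow> real^'k) \<Rightarrow> 'm \<Rightarrow> real" where
  "sff_norm_sq \<A> X p = sff_norm_sq_wrt \<A> X (some_normal \<A> X p) p"

definition translating_soliton ::
    "('n::finite, 'm::topological_space) patch set \<Rightarrow> ('m \<Rightarrow> real^'k) \<Rightarrow> real^'k \<Rightarrow> bool" where
  "translating_soliton \<A> X W \<longleftrightarrow>
     (\<forall>p \<nu>. unit_normal_near \<A> X p \<nu> \<longrightarrow> mean_curvature_wrt \<A> X \<nu> p = \<nu> p \<bullet> W)"

end

theory Submission
  imports Defs
begin

text \<open>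
  Write S for the height function p \<mapsto> X p \<bullet> W. On a translator Delta S = - H^2 and
  |grad S|^2 = 1 - H^2, so the function u = exp (a S) satisfies
  Delta u - <grad S, grad u> + |A|^2 u = (a (a - 1) - a^2 H^2 + |A|^2) u \<le> 0, and a positive
  supersolution of the stability operator forces stability. Substituting log u = a S directly,
  the stability integrand equals, up to a nonnegative term,
  the divergence of the compactly supported field exp (-S) (a f^2 grad S - f grad f): the
  difference is exp (-S) (|grad f - a f grad S|^2 - (a (a - 1) - a^2 H^2 + |A|^2) f^2).
\<close>

section \<open>Continuously differentiable functions\<close>

text \<open>The pointwise identity is short; the weight of the proof lies in integrating a
  divergence over the manifold. \<open>laplacian\<close>, \<open>mdiff\<close> and
  \<open>frame_at\<close> refer to a patch selected separately at every point, and the volume is a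
  definite description. Integration in one patch therefore requires that the coordinate Laplacian
  does not depend on the patch, that exactly one Borel measure has the prescribed patch densities,
  and that integrals against it become Lebesgue integrals with weight \<open>sqrt (det g)\<close>.
  Splitting the field into pieces \<open>u grad v\<close> fits the available regularity: Laplacians
  are taken only of \<open>f\<close> and of the height, both C^2, while the multipliers
  \<open>exp (-S) f^2\<close> and \<open>exp (-S) f\<close> are differentiated once. Cut-off
  functions of class C^1 then suffice for localisation, and the quotient
  \<open>f / exp (a S)\<close> never has to be formed. The soliton equation enters pointwise:
  \<open>H^2\<close> and \<open>- Delta S\<close> are both equal to
  \<open><\<nu>, W>^2 = 1 - |grad S|^2\<close>, after which the normal disappears from the
  computation.\<close>

abbreviation D :: "('a::real_normed_vector \<Rightarrow> 'b::real_normed_vector) \<Rightarrow> 'a \<Rightarrow> 'a \<Rightarrow> 'b" where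
  "D f x \<equiv> frechet_derivative f (at x)"

lemma D_eqI: "(f has_derivative f') (at x) \<Longrightarrow> D f x = f'"
  by (metis frechet_derivative_at)

lemma has_D: "f differentiable (at x) \<Longrightarrow> (f has_derivative D f x) (at x)"
  by (simp add: frechet_derivative_works)

lemma D_cong_open:
  assumes "open S" "x \<in> S" "\<And>y. y \<in> S \<Longrightarrow> f y = g y"
  shows "D f x = D g x"
proof -
  have "(f has_derivative f') (at x) \<longleftrightarrow> (g has_derivative f') (at x)" for f'
    using has_derivative_transform_within_open[of f f' x UNIV S g]
          has_derivative_transform_within_open[of g f' x UNIV S f] assms by auto
  then show ?thesis by (simp add: frechet_derivative_def)
qed

lemma differentiable_cong_open:
  assumes "open S" "x \<in> S" "\<And>y. y \<in> S \<Longrightarrow> f y = g y"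
  shows "f differentiable (at x) \<longleftrightarrow> g differentiable (at x)"
  using has_derivative_transform_within_open[of f _ x UNIV S g]
          has_derivative_transform_within_open[of g _ x UNIV S f] assms
  unfolding differentiable_def by metis

text \<open>Continuity is asked for each fixed direction, not for the derivative as an
  operator-valued map, so that the notion matches \<open>Ck_on 1\<close>. In finite dimension
  nothing is lost: a basis expansion recovers joint continuity.\<close>

definition C1_on :: "'a::euclidean_space set \<Rightarrow> ('a \<Rightarrow> 'b::real_normed_vector) \<Rightarrow> bool" where
  "C1_on S f \<longleftrightarrow> (\<forall>x\<in>S. f differentiable (at x)) \<and> (\<forall>v. continuous_on S (\<lambda>x. D f x v))"

lemma Ck_on_1: "Ck_on 1 S f \<longleftrightarrow> C1_on S f"
  by (simp add: C1_on_def)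

definition C2_on :: "'a::euclidean_space set \<Rightarrow> ('a \<Rightarrow> 'b::real_normed_vector) \<Rightarrow> bool" where
  "C2_on S f \<longleftrightarrow> C1_on S f \<and> (\<forall>v. C1_on S (\<lambda>x. D f x v))"

lemma C1_on_has: "C1_on S f \<Longrightarrow> x \<in> S \<Longrightarrow> (f has_derivative D f x) (at x)"
  by (simp add: C1_on_def has_D)

lemma C1_on_differentiable: "C1_on S f \<Longrightarrow> x \<in> S \<Longrightarrow> f differentiable (at x)"
  by (simp add: C1_on_def)

lemma C1_onI:
  assumes "\<And>x. x \<in> S \<Longrightarrow> (f has_derivative f' x) (at x)" "\<And>v. continuous_on S (\<lambda>x. f' x v)"
  shows "C1_on S f"
proof -
  have "D f x v = f' x v" if "x \<in> S" for x v using assms(1)[OF that] by (simp add: D_eqI)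
  then show ?thesis using assms unfolding C1_on_def differentiable_def
    by (auto cong: continuous_on_cong)
qed

lemma C1_on_continuous: "C1_on S f \<Longrightarrow> continuous_on S f"
  by (meson C1_on_differentiable continuous_at_imp_continuous_on differentiable_imp_continuous_within)

lemma C1_on_D: "C1_on S f \<Longrightarrow> continuous_on S (\<lambda>x. D f x v)"
  by (simp add: C1_on_def)

lemma C1_on_subset: "C1_on S f \<Longrightarrow> T \<subseteq> S \<Longrightarrow> C1_on T f"
  unfolding C1_on_def by (meson continuous_on_subset subsetD)

lemma C1_on_open_Un: "C1_on S f \<Longrightarrow> C1_on T f \<Longrightarrow> open S \<Longrightarrow> open T \<Longrightarrow> C1_on (S \<union> T) f"
  unfolding C1_on_def by (auto intro: continuous_on_open_Un)

lemma C1_on_cong: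
  assumes "open S" "\<And>x. x \<in> S \<Longrightarrow> f x = g x"
  shows "C1_on S f \<longleftrightarrow> C1_on S g"
proof -
  have "D f x = D g x" "f differentiable (at x) \<longleftrightarrow> g differentiable (at x)" if "x \<in> S" for x
    using D_cong_open[OF assms(1) that] differentiable_cong_open[OF assms(1) that] assms(2) by auto
  then show ?thesis unfolding C1_on_def by (simp cong: continuous_on_cong)
qed

lemma D_linear: "f differentiable (at x) \<Longrightarrow> linear (D f x)"
  by (simp add: linear_frechet_derivative)

lemma D_expand:
  fixes f :: "'a::euclidean_space \<Rightarrow> 'b::real_normed_vector"
  assumes "f differentiable (at x)"
  shows "D f x v = (\<Sum>b\<in>Basis. (v \<bullet> b) *\<^sub>R D f x b)"
proof -
  have "D f x v = D f x (\<Sum>b\<in>Basis. (v \<bullet> b) *\<^sub>R b)" by (simp add: euclidean_representation)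
  also have "\<dots> = (\<Sum>b\<in>Basis. (v \<bullet> b) *\<^sub>R D f x b)"
    using D_linear[OF assms] by (simp add: linear_sum linear_cmul)
  finally show ?thesis .
qed

text \<open>Expanding the direction in \<open>Basis\<close> leaves finitely many fixed directions,
  each continuous by assumption. The chain rule needs this form, because there base point and
  direction move together.\<close>

lemma continuous_on_D:
  assumes "C1_on T f" "continuous_on S g" "g ` S \<subseteq> T" "continuous_on S w"
  shows "continuous_on S (\<lambda>x. D f (g x) (w x))"
proof -
  have "continuous_on S (\<lambda>x. D f (g x) b)" for b
    using continuous_on_compose2[OF C1_on_D[OF assms(1)] assms(2,3)] .
  then have "continuous_on S (\<lambda>x. \<Sum>b\<in>Basis. (w x \<bullet> b) *\<^sub>R D f (g x) b)"
    by (intro continuous_intros assms)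
  moreover have "D f (g x) (w x) = (\<Sum>b\<in>Basis. (w x \<bullet> b) *\<^sub>R D f (g x) b)" if "x \<in> S" for x
    by (rule D_expand) (use C1_on_differentiable[OF assms(1)] that assms(3) in auto)
  ultimately show ?thesis by (simp cong: continuous_on_cong)
qed

lemma C1_on_compose:
  assumes "C1_on T f" "C1_on S g" "g ` S \<subseteq> T"
  shows "C1_on S (\<lambda>x. f (g x))"
proof (rule C1_onI)
  show "((\<lambda>x. f (g x)) has_derivative (\<lambda>v. D f (g x) (D g x v))) (at x)" if "x \<in> S" for x
    using has_derivative_compose[OF C1_on_has[OF assms(2) that] C1_on_has[OF assms(1)]] that assms(3)
    by auto
  show "continuous_on S (\<lambda>x. D f (g x) (D g x v))" for v
    by (rule continuous_on_D[OF assms(1) _ assms(3)]) (use assms in \<open>auto intro: C1_on_continuous C1_on_D\<close>)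
qed

lemma D_compose:
  assumes "f differentiable (at (g x))" "g differentiable (at x)"
  shows "D (\<lambda>x. f (g x)) x v = D f (g x) (D g x v)"
  using has_derivative_compose[OF has_D[OF assms(2)] has_D[OF assms(1)]] by (simp add: D_eqI)

lemma C1_on_const [simp]: "C1_on S (\<lambda>x. c)"
  by (rule C1_onI[where f' = "\<lambda>_ _. 0"]) auto

lemma C1_on_bounded_linear:
  assumes "bounded_linear h" "C1_on S f" shows "C1_on S (\<lambda>x. h (f x))"
  by (rule C1_onI[where f' = "\<lambda>x v. h (D f x v)"], erule bounded_linear.has_derivative[OF assms(1) C1_on_has[OF assms(2)]])
    (rule bounded_linear.continuous_on[OF assms(1) C1_on_D[OF assms(2)]])

lemma C1_on_bilinear:
  assumes "bounded_bilinear b" "C1_on S f" "C1_on S g" shows "C1_on S (\<lambda>x. b (f x) (g x))"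
proof (rule C1_onI)
  show "((\<lambda>x. b (f x) (g x)) has_derivative (\<lambda>v. b (f x) (D g x v) + b (D f x v) (g x))) (at x)" if "x \<in> S" for x
    by (rule bounded_bilinear.FDERIV[OF assms(1) C1_on_has[OF assms(2) that] C1_on_has[OF assms(3) that]])
  show "continuous_on S (\<lambda>x. b (f x) (D g x v) + b (D f x v) (g x))" for v
    by (intro bounded_bilinear.continuous_on[OF assms(1)] continuous_on_add C1_on_D assms(2,3) C1_on_continuous)
qed

lemmas C1_on_mult = C1_on_bilinear[OF bounded_bilinear_mult]
lemmas C1_on_scaleR = C1_on_bilinear[OF bounded_bilinear_scaleR]
lemmas C1_on_inner = C1_on_bilinear[OF bounded_bilinear_inner]

lemma C1_on_add: "C1_on S f \<Longrightarrow> C1_on S g \<Longrightarrow> C1_on S (\<lambda>x. f x + g x)"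
  by (rule C1_onI[OF has_derivative_add[OF C1_on_has C1_on_has]]) (auto intro: continuous_on_add C1_on_D)

lemma C1_on_minus: "C1_on S f \<Longrightarrow> C1_on S g \<Longrightarrow> C1_on S (\<lambda>x. f x - g x)"
  by (rule C1_onI[OF has_derivative_diff[OF C1_on_has C1_on_has]]) (auto intro: continuous_on_diff C1_on_D)

lemma C1_on_id: "C1_on S (\<lambda>x. x)"
  by (rule C1_onI[where f' = "\<lambda>_ v. v"]) auto

lemma C1_on_sum: "(\<And>i. i \<in> I \<Longrightarrow> C1_on S (f i)) \<Longrightarrow> C1_on S (\<lambda>x. \<Sum>i\<in>I. f i x)"
  by (induction I rule: infinite_finite_induct) (auto intro: C1_on_add)

lemma C1_on_prod: 
  fixes f :: "'i \<Rightarrow> 'a::euclidean_space \<Rightarrow> real"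
  shows "(\<And>i. i \<in> I \<Longrightarrow> C1_on S (f i)) \<Longrightarrow> C1_on S (\<lambda>x. \<Prod>i\<in>I. f i x)"
  by (induction I rule: infinite_finite_induct) (auto intro: C1_on_mult)

lemma C1_on_real_fun:
  fixes h :: "real \<Rightarrow> real"
  assumes "\<And>t. t \<in> T \<Longrightarrow> (h has_real_derivative h' t) (at t)" "continuous_on T h'"
    "C1_on S f" "f ` S \<subseteq> T"
  shows "C1_on S (\<lambda>x. h (f x))"
proof (rule C1_on_compose[OF _ assms(3,4)])
  show "C1_on T h"
    by (rule C1_onI[where f' = "\<lambda>t v. h' t * v"])
      (use assms(1,2) in \<open>auto simp: has_field_derivative_def intro: continuous_intros\<close>)
qed

lemma C1_on_inverse:
  fixes f :: "'a::euclidean_space \<Rightarrow> real"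
  assumes "C1_on S f" "\<And>x. x \<in> S \<Longrightarrow> f x \<noteq> 0" 
  shows "C1_on S (\<lambda>x. inverse (f x))"
  by (rule C1_on_real_fun[of "-{0}" inverse "\<lambda>x. - (inverse x ^ 2)"])
    (use assms DERIV_inverse[where 'a=real] in \<open>auto intro!: continuous_intros simp: numeral_2_eq_2\<close>)

lemma C1_on_divide:
  fixes f :: "'a::euclidean_space \<Rightarrow> real"
  assumes "C1_on S f" "C1_on S g" "\<And>x. x \<in> S \<Longrightarrow> g x \<noteq> 0" 
  shows "C1_on S (\<lambda>x. f x / g x)"
  unfolding divide_inverse by (intro C1_on_mult C1_on_inverse assms)

lemma C1_on_sqrt:
  assumes "C1_on S f" "\<And>x. x \<in> S \<Longrightarrow> f x > 0" 
  shows "C1_on S (\<lambda>x. sqrt (f x))"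
  by (rule C1_on_real_fun[of "{0<..}" sqrt "\<lambda>x. inverse (sqrt x) / 2"])
    (use assms in \<open>auto intro!: DERIV_real_sqrt continuous_intros\<close>)

lemma C1_on_exp:
  fixes f :: "'a::euclidean_space \<Rightarrow> real"
  assumes "C1_on S f" shows "C1_on S (\<lambda>x. exp (f x))"
  by (rule C1_on_real_fun[of UNIV exp exp])
    (use assms in \<open>auto intro!: DERIV_exp continuous_intros\<close>)

section \<open>Symmetry of second derivatives\<close>

text \<open>Two applications of the mean value theorem: along \<open>v\<close> to the difference of
  \<open>f\<close> on the two sides of the parallelogram, then along \<open>w\<close> to
  \<open>D f _ v\<close>. The bound on \<open>z\<close> confines it to any prescribed ball once
  \<open>s\<close> is small.\<close>

lemma mixed_difference_quotient:
  fixes f :: "'a::euclidean_space \<Rightarrow> real"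
  assumes f: "\<And>z. z \<in> ball x e \<Longrightarrow> f differentiable (at z)"
    "\<And>z. z \<in> ball x e \<Longrightarrow> (\<lambda>z. D f z v) differentiable (at z)"
    and s: "s > 0" "s * (norm v + norm w) < e"
  shows "\<exists>z. norm (z - x) \<le> s * (norm v + norm w) \<and>
    f (x + s *\<^sub>R v + s *\<^sub>R w) - f (x + s *\<^sub>R v) - f (x + s *\<^sub>R w) + f x = s\<^sup>2 * D (\<lambda>z. D f z v) z w"
proof -
  have nrm: "norm (r *\<^sub>R v + q *\<^sub>R w) \<le> s * (norm v + norm w)" if "0 \<le> r" "r \<le> s" "0 \<le> q" "q \<le> s" for r q
  proof -
    have "norm (r *\<^sub>R v + q *\<^sub>R w) \<le> r * norm v + q * norm w"
      using norm_triangle_ineq[of "r *\<^sub>R v" "q *\<^sub>R w"] that by simp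
    also have "\<dots> \<le> s * norm v + s * norm w" using that by (intro add_mono mult_right_mono) auto
    finally show ?thesis by (simp add: distrib_left)
  qed
  have inb: "x + r *\<^sub>R v + q *\<^sub>R w \<in> ball x e" if "0 \<le> r" "r \<le> s" "0 \<le> q" "q \<le> s" for r q
  proof -
    have "dist x (x + (r *\<^sub>R v + q *\<^sub>R w)) = norm (r *\<^sub>R v + q *\<^sub>R w)"
      unfolding dist_norm by (metis add_diff_cancel_left' norm_minus_commute)
    then show ?thesis using nrm[OF that] s(2) by (simp add: add.assoc)
  qed
  define g where "g = (\<lambda>r. f (x + r *\<^sub>R v + s *\<^sub>R w) - f (x + r *\<^sub>R v))"
  have g: "DERIV g r :> D f (x + r *\<^sub>R v + s *\<^sub>R w) v - D f (x + r *\<^sub>R v) v" if "0 \<le> r" "r \<le> s" for r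
  proof -
    have 1: "(f has_derivative D f (x + r *\<^sub>R v + s *\<^sub>R w)) (at (x + r *\<^sub>R v + s *\<^sub>R w))"
      using has_D[OF f(1)[OF inb[OF that, of s]]] s by auto
    have 2: "(f has_derivative D f (x + r *\<^sub>R v)) (at (x + r *\<^sub>R v))"
      using has_D[OF f(1)[OF inb[OF that, of 0]]] s by auto
    have "(g has_derivative (\<lambda>t. D f (x + r *\<^sub>R v + s *\<^sub>R w) (t *\<^sub>R v) - D f (x + r *\<^sub>R v) (t *\<^sub>R v))) (at r)"
      unfolding g_def
      by (intro has_derivative_diff has_derivative_compose[where f="\<lambda>r. x + r *\<^sub>R v + s *\<^sub>R w", OF _ 1] has_derivative_compose[where f="\<lambda>r. x + r *\<^sub>R v", OF _ 2])
        (auto intro!: derivative_eq_intros)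
    then show ?thesis unfolding has_field_derivative_def
      by (rule has_derivative_eq_rhs) (use 1 2 in \<open>auto simp: fun_eq_iff linear_cmul has_derivative_linear algebra_simps\<close>)
  qed
  from MVT2[OF s(1) g] obtain r where r: "0 < r" "r < s"
    "g s - g 0 = (s - 0) * (D f (x + r *\<^sub>R v + s *\<^sub>R w) v - D f (x + r *\<^sub>R v) v)" by auto
  define h where "h = (\<lambda>q. D f (x + r *\<^sub>R v + q *\<^sub>R w) v)"
  have h: "DERIV h q :> D (\<lambda>z. D f z v) (x + r *\<^sub>R v + q *\<^sub>R w) w" if "0 \<le> q" "q \<le> s" for q
  proof -
    have 1: "((\<lambda>z. D f z v) has_derivative D (\<lambda>z. D f z v) (x + r *\<^sub>R v + q *\<^sub>R w)) (at (x + r *\<^sub>R v + q *\<^sub>R w))"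
      using has_D[OF f(2)[OF inb[OF _ _ that, of r]]] r by auto
    have "(h has_derivative (\<lambda>t. D (\<lambda>z. D f z v) (x + r *\<^sub>R v + q *\<^sub>R w) (t *\<^sub>R w))) (at q)"
      unfolding h_def
      by (rule has_derivative_compose[where f="\<lambda>q. x + r *\<^sub>R v + q *\<^sub>R w", OF _ 1]) (auto intro!: derivative_eq_intros)
    then show ?thesis unfolding has_field_derivative_def
      by (rule has_derivative_eq_rhs) (use 1 in \<open>auto simp: fun_eq_iff linear_cmul has_derivative_linear algebra_simps\<close>)
  qed
  from MVT2[OF s(1) h] obtain q where q: "0 < q" "q < s"
    "h s - h 0 = (s - 0) * D (\<lambda>z. D f z v) (x + r *\<^sub>R v + q *\<^sub>R w) w" by auto
  show ?thesis
  proof (intro exI conjI)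
    show "norm (x + r *\<^sub>R v + q *\<^sub>R w - x) \<le> s * (norm v + norm w)"
      using nrm[of r q] r q by (simp add: add.assoc)
    show "f (x + s *\<^sub>R v + s *\<^sub>R w) - f (x + s *\<^sub>R v) - f (x + s *\<^sub>R w) + f x
        = s\<^sup>2 * D (\<lambda>z. D f z v) (x + r *\<^sub>R v + q *\<^sub>R w) w"
      using r(3) q(3) unfolding g_def h_def by (simp add: power2_eq_square)
  qed
qed

text \<open>The second difference is symmetric in \<open>v\<close> and \<open>w\<close>, so the two
  mixed derivatives agree at a pair of points arbitrarily close to \<open>x\<close>. Continuity then
  excludes different values at \<open>x\<close>.\<close>

lemma second_derivative_symmetric_real:
  fixes f :: "'a::euclidean_space \<Rightarrow> real"
  assumes S: "open S" "x \<in> S" and f: "C2_on S f"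
  shows "D (\<lambda>z. D f z v) x w = D (\<lambda>z. D f z w) x v"
proof (rule ccontr)
  define P where "P = (\<lambda>z. D (\<lambda>z. D f z v) z w)"
  define Q where "Q = (\<lambda>z. D (\<lambda>z. D f z w) z v)"
  assume "\<not> ?thesis"
  then have ne: "P x \<noteq> Q x" by (simp add: P_def Q_def)
  \<comment> \<open>Half the gap: values within \<open>d\<close> of \<open>P x\<close> and within
    \<open>d\<close> of \<open>Q x\<close> cannot coincide.\<close>
  define d where "d = dist (P x) (Q x) / 2"
  have d: "d > 0" using ne by (simp add: d_def)
  have "isCont P x" "isCont Q x"
    using f S unfolding P_def Q_def C2_on_def C1_on_def by (auto simp: continuous_on_eq_continuous_at)
  then obtain e1 e2 where e1: "e1 > 0" "\<And>z. dist z x < e1 \<Longrightarrow> dist (P z) (P x) < d"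
    and e2: "e2 > 0" "\<And>z. dist z x < e2 \<Longrightarrow> dist (Q z) (Q x) < d"
    using d unfolding continuous_at_eps_delta by metis
  obtain e3 where e3: "e3 > 0" "ball x e3 \<subseteq> S" using S openE by blast
  define e where "e = Min {e1, e2, e3}"
  have e: "e > 0" "e \<le> e1" "e \<le> e2" "e \<le> e3" using e1 e2 e3 by (auto simp: e_def)
  \<comment> \<open>The summand 1 keeps the denominator positive when \<open>v\<close> and
    \<open>w\<close> vanish and makes the bound by \<open>e\<close> strict.\<close>
  define s where "s = e / (norm v + norm w + 1)"
  have s: "s > 0" using e by (simp add: s_def add_nonneg_pos)
  have "s * (norm v + norm w) < s * (norm v + norm w + 1)" using s by simp
  also have "\<dots> = e" by (simp add: s_def) (smt (verit) norm_ge_zero)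
  finally have s2: "s * (norm v + norm w) < e" .
  have df: "f differentiable (at z)" "(\<lambda>z. D f z v) differentiable (at z)" "(\<lambda>z. D f z w) differentiable (at z)"
    if "z \<in> ball x e" for z
  proof -
    have "z \<in> S" using that e e3 by auto
    then show "f differentiable (at z)" "(\<lambda>z. D f z v) differentiable (at z)" "(\<lambda>z. D f z w) differentiable (at z)"
      using f by (auto simp: C2_on_def C1_on_def)
  qed
  from mixed_difference_quotient[OF df(1,2) s s2] obtain z1 where z1:
    "norm (z1 - x) \<le> s * (norm v + norm w)"
    "f (x + s *\<^sub>R v + s *\<^sub>R w) - f (x + s *\<^sub>R v) - f (x + s *\<^sub>R w) + f x = s\<^sup>2 * P z1"
    unfolding P_def by blast
  have s3: "s * (norm w + norm v) < e" using s2 by (simp add: add.commute)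
  from mixed_difference_quotient[OF df(1,3) s s3] obtain z2 where z2:
    "norm (z2 - x) \<le> s * (norm v + norm w)"
    "f (x + s *\<^sub>R w + s *\<^sub>R v) - f (x + s *\<^sub>R w) - f (x + s *\<^sub>R v) + f x = s\<^sup>2 * Q z2"
    unfolding Q_def by (auto simp: add.commute[of "norm w"])
  have "P z1 = Q z2" using z1(2) z2(2) s by (simp add: algebra_simps)
  moreover have "dist (P z1) (P x) < d" using z1 s2 e by (intro e1) (simp add: dist_norm)
  moreover have "dist (Q z2) (Q x) < d" using z2 s2 e by (intro e2) (simp add: dist_norm)
  ultimately show False unfolding d_def dist_real_def by (smt (verit) field_sum_of_halves)
qed

lemma D_inner_const:
  assumes "f differentiable (at x)"
  shows "D (\<lambda>x. f x \<bullet> b) x v = D f x v \<bullet> b"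
  using D_eqI[OF has_derivative_inner_left[OF has_D[OF assms]]] by metis

lemma C1_on_inner_const: "C1_on S f \<Longrightarrow> C1_on S (\<lambda>x. f x \<bullet> b)"
  by (rule C1_on_bounded_linear[OF bounded_linear_inner_left])

lemma C2_on_inner_const:
  assumes "open S" "C2_on S f" shows "C2_on S (\<lambda>x. f x \<bullet> b)"
proof -
  have "C1_on S (\<lambda>x. D (\<lambda>x. f x \<bullet> b) x v)" for v
  proof (subst C1_on_cong[OF assms(1)])
    show "D (\<lambda>x. f x \<bullet> b) x v = D f x v \<bullet> b" if "x \<in> S" for x
      using assms that by (intro D_inner_const) (auto simp: C2_on_def C1_on_def)
    show "C1_on S (\<lambda>x. D f x v \<bullet> b)" using assms by (auto simp: C2_on_def intro: C1_on_inner_const)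
  qed
  then show ?thesis using assms by (auto simp: C2_on_def intro: C1_on_inner_const)
qed

lemma D2_inner_const:
  assumes "open S" "C2_on S f" "x \<in> S"
  shows "D (\<lambda>x. D (\<lambda>x. f x \<bullet> b) x v) x w = D (\<lambda>x. D f x v) x w \<bullet> b"
proof -
  have "D (\<lambda>x. D (\<lambda>x. f x \<bullet> b) x v) x = D (\<lambda>x. D f x v \<bullet> b) x"
    by (rule D_cong_open[OF assms(1,3)]) (use assms in \<open>auto simp: C2_on_def C1_on_def D_inner_const\<close>)
  then show ?thesis using assms by (simp add: D_inner_const C2_on_def C1_on_def)
qed

lemma second_derivative_symmetric:
  fixes f :: "'a::euclidean_space \<Rightarrow> 'b::euclidean_space"
  assumes S: "open S" "x \<in> S" and f: "C2_on S f"
  shows "D (\<lambda>z. D f z v) x w = D (\<lambda>z. D f z w) x v"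
proof (rule euclidean_eqI)
  fix b :: 'b
  show "D (\<lambda>z. D f z v) x w \<bullet> b = D (\<lambda>z. D f z w) x v \<bullet> b"
    unfolding D2_inner_const[OF S(1) f S(2), symmetric]
    by (rule second_derivative_symmetric_real[OF S C2_on_inner_const[OF S(1) f]])
qed

text \<open>The integral of F (x + r v) does not depend on r; differentiate under the integral at r = 0.\<close>

lemma integral_D_eq_0:
  fixes F :: "'a::euclidean_space \<Rightarrow> real"
  assumes F: "C1_on UNIV F" and K: "compact K" "\<And>x. x \<notin> K \<Longrightarrow> F x = 0"
  shows "integrable lborel (\<lambda>x. D F x v)" "(LINT x|lborel. D F x v) = 0"
proof -
  have D0: "D F x v = 0" if "x \<notin> K" for x v
  proof -
    have "D F x = D (\<lambda>_. 0) x" by (rule D_cong_open[of "-K"]) (use K that compact_imp_closed in auto)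
    then show ?thesis by simp
  qed
  have cD: "continuous_on UNIV (\<lambda>x. D F x w)" for w using F by (simp add: C1_on_D)
  have int: "integrable lborel g" if "continuous_on UNIV g" "\<And>x. x \<notin> K \<Longrightarrow> g x = 0" for g :: "'a \<Rightarrow> real"
  proof -
    have "integrable lborel (\<lambda>x. indicator K x *\<^sub>R g x)"
      by (rule borel_integrable_compact[OF K(1)]) (use that continuous_on_subset in blast)
    moreover have "(\<lambda>x. indicator K x *\<^sub>R g x) = g" using that by (auto simp: fun_eq_iff indicator_def)
    ultimately show ?thesis by simp
  qed
  show "integrable lborel (\<lambda>x. D F x v)" by (rule int) (use cD D0 in auto)
  have intF: "integrable lborel F" by (rule int) (use K F C1_on_continuous in auto)
  obtain B where B: "\<And>x. norm (D F x v) \<le> B" "B \<ge> 0"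
  proof -
    have "compact ((\<lambda>x. D F x v) ` K)" by (rule compact_continuous_image) (use cD continuous_on_subset K in blast)+
    then obtain b where "\<And>x. x \<in> K \<Longrightarrow> norm (D F x v) \<le> b" using compact_imp_bounded[of "(\<lambda>x. D F x v) ` K"] unfolding bounded_iff by auto
    \<comment> \<open>The maximum with 0 covers the points outside \<open>K\<close>, where the
      derivative vanishes, and makes the bound nonnegative.\<close>
    then have "norm (D F x v) \<le> max b 0" for x using D0[of x v] by (cases "x \<in> K") (force simp: max_def)+
    then show ?thesis using that[of "max b 0"] by auto
  qed
  have shift: "((\<lambda>r. F (x + r *\<^sub>R v)) has_derivative (\<lambda>s. s * D F (x + r *\<^sub>R v) v)) (at r)" for x r
  proof -
    have 1: "(F has_derivative D F (x + r *\<^sub>R v)) (at (x + r *\<^sub>R v))" using C1_on_has[OF F] by auto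
    have "((\<lambda>r. F (x + r *\<^sub>R v)) has_derivative (\<lambda>s. D F (x + r *\<^sub>R v) (s *\<^sub>R v))) (at r)"
      by (rule has_derivative_compose[where f="\<lambda>r. x + r *\<^sub>R v", OF _ 1]) (auto intro!: derivative_eq_intros)
    then show ?thesis
      by (rule has_derivative_eq_rhs) (use 1 in \<open>auto simp: fun_eq_iff linear_cmul has_derivative_linear\<close>)
  qed
  define t where "t = (\<lambda>n. inverse (real (Suc n)))"
  have t: "t n > 0" "t n \<le> 1" for n by (auto simp: t_def field_simps)
  have t0: "t \<longlonglongrightarrow> 0" unfolding t_def by (rule LIMSEQ_inverse_real_of_nat)
  define q where "q = (\<lambda>n x. (F (x + t n *\<^sub>R v) - F x) / t n)"
  have qB: "norm (q n x) \<le> B" for n x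
  proof -
    have "\<exists>\<xi>>0. \<xi> < t n \<and> F (x + t n *\<^sub>R v) - F (x + 0 *\<^sub>R v) = (t n - 0) * D F (x + \<xi> *\<^sub>R v) v"
      using MVT2[of 0 "t n" "\<lambda>r. F (x + r *\<^sub>R v)" "\<lambda>r. D F (x + r *\<^sub>R v) v"] t(1) shift
      by (auto simp: has_field_derivative_def mult.commute[of _ "D F _ v"])
    then obtain \<xi> where "F (x + t n *\<^sub>R v) - F x = t n * D F (x + \<xi> *\<^sub>R v) v" by auto
    then have "q n x = D F (x + \<xi> *\<^sub>R v) v" using t(1)[of n] by (simp add: q_def)
    then show ?thesis using B by simp
  qed
  obtain R where R: "\<And>x. x \<in> K \<Longrightarrow> norm x \<le> R" using K compact_imp_bounded bounded_iff by metis
  \<comment> \<open>Since \<open>t n \<le> 1\<close>, a shift moves a point by at most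
    \<open>norm v\<close>, so all quotients \<open>q n\<close> vanish outside this one ball.
    Together with the bound \<open>B\<close> this gives an integrable majorant independent of
    \<open>n\<close>.\<close>
  define C where "C = cball (0::'a) (R + norm v)"
  have q0: "q n x = 0" if "x \<notin> C" for n x
  proof -
    have 1: "norm x > R + norm v" using that by (simp add: C_def)
    have "norm x \<le> norm (x + t n *\<^sub>R v) + norm (t n *\<^sub>R v)" using norm_triangle_ineq4[of "x + t n *\<^sub>R v" "t n *\<^sub>R v"] by simp
    moreover have "norm (t n *\<^sub>R v) \<le> norm v" using t[of n] by (simp add: mult_left_le_one_le)
    ultimately have "norm (x + t n *\<^sub>R v) > R" using 1 by linarith
    moreover have "norm x > R" using 1 norm_ge_zero[of v] by linarith
    ultimately have "x + t n *\<^sub>R v \<notin> K" "x \<notin> K" using R by force+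
    then show ?thesis by (simp add: q_def K)
  qed
  have mF: "F \<in> borel_measurable borel" using F by (simp add: borel_measurable_continuous_onI C1_on_continuous)
  have "(\<lambda>n. LINT x|lborel. q n x) \<longlonglongrightarrow> (LINT x|lborel. D F x v)"
  proof (rule integral_dominated_convergence)
    show "(\<lambda>x. D F x v) \<in> borel_measurable lborel" using cD by (simp add: borel_measurable_continuous_onI)
    show "q n \<in> borel_measurable lborel" for n using mF unfolding q_def by measurable
    show "integrable lborel (\<lambda>x. indicator C x *\<^sub>R B)"
      by (rule borel_integrable_compact) (auto simp: C_def)
    show "AE x in lborel. norm (q n x) \<le> indicator C x *\<^sub>R B" for n
      using qB q0 B(2) by (auto simp: indicator_def)
    show "AE x in lborel. (\<lambda>n. q n x) \<longlonglongrightarrow> D F x v"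
    proof (rule AE_I2)
      fix x
      have "((\<lambda>r. F (x + r *\<^sub>R v)) has_field_derivative D F x v) (at 0)"
        using shift[of x 0] by (simp add: has_field_derivative_def mult.commute[of _ "D F _ v"])
      then have "((\<lambda>h. (F (x + h *\<^sub>R v) - F x) / h) \<longlongrightarrow> D F x v) (at 0)" by (simp add: DERIV_def)
      then show "(\<lambda>n. q n x) \<longlonglongrightarrow> D F x v" unfolding q_def
        by (rule filterlim_compose[of _ _ _ t]) (use t t0 in \<open>auto simp: filterlim_at intro!: always_eventually, metis less_irrefl\<close>)
    qed
  qed
  moreover have "(LINT x|lborel. q n x) = 0" for n
  proof -
    have e: "distr lborel borel (\<lambda>x. t n *\<^sub>R v + x) = lborel" by (rule lborel_distr_plus)
    have "integrable lborel (\<lambda>x. F (t n *\<^sub>R v + x))"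
      using intF integrable_distr_eq[of "\<lambda>x. t n *\<^sub>R v + x" lborel borel F] mF unfolding e by simp
    moreover have "(LINT x|lborel. F (t n *\<^sub>R v + x)) = (LINT x|lborel. F x)"
      using integral_distr[of "\<lambda>x. t n *\<^sub>R v + x" lborel borel F] mF unfolding e by simp
    ultimately have 1: "integrable lborel (\<lambda>x. F (x + t n *\<^sub>R v))" "(LINT x|lborel. F (x + t n *\<^sub>R v)) = (LINT x|lborel. F x)"
      by (simp_all add: add.commute)
    show ?thesis using 1 intF by (simp add: q_def)
  qed
  ultimately show "(LINT x|lborel. D F x v) = 0" by (simp add: LIMSEQ_const_iff)
qed

section \<open>Gram matrices and orthonormal frames\<close>

text \<open>Stated for an abstract map \<open>J\<close>, so that the linear algebra is separated
  from patches. The metric in a patch is the case where \<open>J\<close> is the differential of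
  \<open>X \<circ> \<psi>\<close>.\<close>

definition gram :: "(real^'n \<Rightarrow> real^'k) \<Rightarrow> real^'n^'n" where
  "gram J = (\<chi> i j. J (axis i 1) \<bullet> J (axis j 1))"

definition orthonormal_for :: "(real^'n \<Rightarrow> real^'k) \<Rightarrow> ('n \<Rightarrow> real^'n) \<Rightarrow> bool" where
  "orthonormal_for J e \<longleftrightarrow> (\<forall>i j. J (e i) \<bullet> J (e j) = (if i = j then 1 else 0))"

lemma orthonormal_for_exists:
  fixes J :: "real^'n \<Rightarrow> real^'k"
  assumes "linear J" "inj J"
  obtains e where "orthonormal_for J e"
proof -
  have "subspace (range J)" using assms(1) by (simp add: linear_subspace_image)
  from orthonormal_basis_subspace[OF this] obtain B where B: "B \<subseteq> range J" "pairwise orthogonal B"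
    "\<And>x. x \<in> B \<Longrightarrow> norm x = 1" "independent B" "card B = dim (range J)" "span B = range J" by metis
  have "dim (range J) = CARD('n)" using dim_image_eq[of J UNIV] assms by simp
  then have "card B = CARD('n)" using B by simp
  moreover have "finite B" using B(4) by (simp add: independent_imp_finite)
  ultimately obtain b :: "'n \<Rightarrow> real^'k" where b: "bij_betw b UNIV B"
    using finite_same_card_bij[of "UNIV :: 'n set" B] by auto
  have "J (inv J (b i)) = b i" for i using b B(1) by (intro f_inv_into_f) (auto simp: bij_betw_def)
  moreover have "b i \<bullet> b j = (if i = j then 1 else 0)" for i j
  proof -
    have "b i \<in> B" "b j \<in> B" "i \<noteq> j \<Longrightarrow> b i \<noteq> b j" using b by (auto simp: bij_betw_def inj_def)
    then show ?thesis using B(2,3) by (auto simp: pairwise_def orthogonal_def norm_eq_1)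
  qed
  ultimately have "orthonormal_for J (\<lambda>i. inv J (b i))" by (simp add: orthonormal_for_def)
  then show ?thesis by (rule that)
qed

lemma linear_vec_expand:
  assumes "linear (J :: real^'n \<Rightarrow> 'b::real_vector)"
  shows "J v = (\<Sum>i\<in>UNIV. v $ i *\<^sub>R J (axis i 1))"
proof -
  have "J v = J (\<Sum>i\<in>UNIV. v $ i *s axis i 1)" by (simp only: basis_expansion)
  then show ?thesis using assms by (simp add: linear_sum linear_cmul scalar_mult_eq_scaleR)
qed

lemma gram_inner:
  assumes "linear J"
  shows "J v \<bullet> J w = (\<Sum>i\<in>UNIV. \<Sum>j\<in>UNIV. v $ i * gram J $ i $ j * w $ j)"
  unfolding linear_vec_expand[OF assms, of v] linear_vec_expand[OF assms, of w]
  by (simp add: inner_sum_left inner_sum_right gram_def sum_distrib_left mult_ac) (rule sum.swap)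

text \<open>With the frame vectors as columns of \<open>E\<close>, orthonormality reads
  \<open>E^T G E = 1\<close>. For square matrices a one-sided inverse is two-sided, hence
  \<open>E E^T\<close> is the inverse of the Gram matrix.\<close>

lemma frame_matrix:
  fixes J :: "real^'n \<Rightarrow> real^'k"
  assumes "linear J" "orthonormal_for J e"
  defines "E \<equiv> \<chi> i k. e k $ i"
  shows "E ** transpose E ** gram J = mat 1" "gram J ** (E ** transpose E) = mat 1"
    "transpose E ** gram J ** E = mat 1"
proof -
  show *: "transpose E ** gram J ** E = mat 1"
    unfolding vec_eq_iff
  proof (intro allI)
    fix k l
    have "(transpose E ** gram J ** E) $ k $ l = J (e k) \<bullet> J (e l)"
      unfolding gram_inner[OF assms(1)] matrix_matrix_mult_def transpose_def E_def
      by (simp add: sum_distrib_right mult.assoc) (rule sum.swap)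
    then show "(transpose E ** gram J ** E) $ k $ l = mat 1 $ k $ l"
      using assms(2) by (simp add: orthonormal_for_def mat_def)
  qed
  then have "E ** (transpose E ** gram J) = mat 1" using matrix_left_right_inverse by blast
  then show 1: "E ** transpose E ** gram J = mat 1" by (simp add: matrix_mul_assoc)
  then show "gram J ** (E ** transpose E) = mat 1" using matrix_left_right_inverse by blast
qed

lemma matrix_inv_mult:
  fixes A :: "real^'n^'n"
  assumes "invertible A" shows "A ** matrix_inv A = mat 1" "matrix_inv A ** A = mat 1"
proof -
  have "\<exists>A'. A ** A' = mat 1 \<and> A' ** A = mat 1" using assms by (auto simp: invertible_def)
  from someI_ex[OF this] show "A ** matrix_inv A = mat 1" "matrix_inv A ** A = mat 1"
    by (auto simp: matrix_inv_def)
qed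

lemma matrix_inv_eqI:
  fixes A :: "real^'n^'n"
  assumes "A ** B = mat 1" "B ** A = mat 1" shows "matrix_inv A = B"
proof -
  have "invertible A" unfolding invertible_def using assms by blast
  from matrix_inv_mult(2)[OF this] have "matrix_inv A ** (A ** B) = B"
    by (simp add: matrix_mul_assoc)
  then show ?thesis using assms by simp
qed

lemma matrix_inv_gram:
  assumes "linear J" "orthonormal_for J e"
  shows "matrix_inv (gram J) $ i $ j = (\<Sum>k\<in>UNIV. e k $ i * e k $ j)"
proof -
  let ?E = "(\<chi> i k. e k $ i)"
  have "matrix_inv (gram J) = ?E ** transpose ?E"
    using matrix_inv_eqI frame_matrix[OF assms] by metis
  then show ?thesis by (simp add: matrix_matrix_mult_def transpose_def)
qed

lemma gram_inverse:
  assumes "linear J" "inj J"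
  shows "matrix_inv (gram J) ** gram J = mat 1" "gram J ** matrix_inv (gram J) = mat 1"
proof -
  obtain e where "orthonormal_for J e" using assms by (rule orthonormal_for_exists)
  then have "invertible (gram J)" unfolding invertible_def using frame_matrix assms(1) by blast
  then show "matrix_inv (gram J) ** gram J = mat 1" "gram J ** matrix_inv (gram J) = mat 1"
    by (simp_all add: matrix_inv_mult)
qed

lemma matrix_inv_gram_sym:
  assumes "linear J" "inj J"
  shows "matrix_inv (gram J) $ i $ j = matrix_inv (gram J) $ j $ i"
proof -
  obtain e where "orthonormal_for J e" using assms by (rule orthonormal_for_exists)
  then show ?thesis using assms by (simp add: matrix_inv_gram mult.commute)
qed

text \<open>Taking determinants in \<open>E^T G E = 1\<close> exhibits \<open>det G\<close> as the
  inverse of a square.\<close>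

lemma det_gram_pos:
  assumes "linear J" "inj J" shows "det (gram J) > 0"
proof -
  obtain e where "orthonormal_for J e" using assms by (rule orthonormal_for_exists)
  from arg_cong[OF frame_matrix(3)[OF assms(1) this], of det]
  have "det (\<chi> i k. e k $ i) ^ 2 * det (gram J) = 1" by (simp add: det_mul power2_eq_square mult_ac)
  then show ?thesis by (metis zero_less_mult_pos zero_less_one zero_less_power2 mult_zero_left power_zero_numeral zero_neq_one)
qed

text \<open>The source of the Jacobian factor in the transformation of the volume density: the Gram
  matrix of a composition is \<open>L^T G L\<close>.\<close>

lemma det_gram_compose:
  assumes "linear J" "linear L"
  shows "det (gram (\<lambda>v. J (L v))) = (det (matrix L))\<^sup>2 * det (gram J)"
proof -
  have "gram (\<lambda>v. J (L v)) = transpose (matrix L) ** gram J ** matrix L"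
    unfolding vec_eq_iff
  proof (intro allI)
    fix k l
    have "(transpose (matrix L) ** gram J ** matrix L) $ k $ l = J (L (axis k 1)) \<bullet> J (L (axis l 1))"
      unfolding gram_inner[OF assms(1)] matrix_matrix_mult_def transpose_def matrix_def
      by (simp add: sum_distrib_right mult.assoc) (rule sum.swap)
    then show "gram (\<lambda>v. J (L v)) $ k $ l = (transpose (matrix L) ** gram J ** matrix L) $ k $ l"
      by (simp add: gram_def)
  qed
  then show ?thesis by (simp add: det_mul power2_eq_square mult_ac)
qed

lemma frame_expand:
  fixes J :: "real^'n \<Rightarrow> real^'k"
  assumes "linear J" "orthonormal_for J e"
  shows "w = (\<Sum>k\<in>UNIV. (J w \<bullet> J (e k)) *\<^sub>R e k)"
proof -
  let ?E = "(\<chi> i k. e k $ i)"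
  have "w = ?E *v ((transpose ?E ** gram J) *v w)"
    using frame_matrix(1)[OF assms] by (simp add: matrix_vector_mul_assoc matrix_mul_assoc)
  also have "(transpose ?E ** gram J) *v w = (\<chi> k. J (e k) \<bullet> J w)"
    unfolding vec_eq_iff gram_inner[OF assms(1)]
    by (simp add: matrix_vector_mult_def matrix_matrix_mult_def transpose_def sum_distrib_right)
       (intro allI sum.swap)
  finally show ?thesis
    by (simp add: vec_eq_iff matrix_vector_mult_def inner_commute mult.commute)
qed

text \<open>The bridge between two descriptions of a metric trace: curvature and gradient products
  are sums over an orthonormal frame, while the Laplacian is written with \<open>g^{ij}\<close>.
  Values in a vector space are allowed because the trace is also applied to the second derivative of
  the immersion itself.\<close>

lemma frame_trace:
  fixes B :: "real^'n \<Rightarrow> real^'n \<Rightarrow> 'b::real_vector"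
  assumes "linear J" "orthonormal_for J e" "\<And>w. linear (\<lambda>v. B v w)" "\<And>v. linear (B v)"
  shows "(\<Sum>k\<in>UNIV. B (e k) (e k)) =
    (\<Sum>i\<in>UNIV. \<Sum>j\<in>UNIV. matrix_inv (gram J) $ i $ j *\<^sub>R B (axis i 1) (axis j 1))"
proof -
  have "B v w = (\<Sum>i\<in>UNIV. \<Sum>j\<in>UNIV. (v $ i * w $ j) *\<^sub>R B (axis i 1) (axis j 1))" for v w
    by (subst linear_vec_expand[OF assms(3)], subst linear_vec_expand[OF assms(4)])
      (simp add: scaleR_sum_right)
  then have "(\<Sum>k\<in>UNIV. B (e k) (e k)) =
     (\<Sum>k\<in>UNIV. \<Sum>i\<in>UNIV. \<Sum>j\<in>UNIV. (e k $ i * e k $ j) *\<^sub>R B (axis i 1) (axis j 1))" by metis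
  also have "\<dots> = (\<Sum>i\<in>UNIV. \<Sum>k\<in>UNIV. \<Sum>j\<in>UNIV. (e k $ i * e k $ j) *\<^sub>R B (axis i 1) (axis j 1))"
    by (rule sum.swap)
  also have "\<dots> = (\<Sum>i\<in>UNIV. \<Sum>j\<in>UNIV. \<Sum>k\<in>UNIV. (e k $ i * e k $ j) *\<^sub>R B (axis i 1) (axis j 1))"
    by (rule sum.cong[OF refl], rule sum.swap)
  finally show ?thesis by (simp add: matrix_inv_gram[OF assms(1,2)] scaleR_sum_left)
qed

text \<open>By dimension the orthonormal family spans the whole space. The remainder
  \<open>r\<close> is orthogonal to the family, hence to itself.\<close>

lemma orthonormal_expand:
  fixes b :: "'i \<Rightarrow> real^'k"
  assumes b: "finite I" "card I = CARD('k)" "\<And>i j. i \<in> I \<Longrightarrow> j \<in> I \<Longrightarrow> b i \<bullet> b j = (if i = j then 1 else 0)"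
  shows "w = (\<Sum>i\<in>I. (w \<bullet> b i) *\<^sub>R b i)"
proof -
  have inj: "inj_on b I" using b(3) by (metis inj_onI zero_neq_one)
  have "pairwise orthogonal (b ` I)"
    using b(3) by (auto simp: pairwise_def orthogonal_def)
  moreover have "0 \<notin> b ` I" using b(3) by (metis imageE inner_zero_left zero_neq_one)
  ultimately have "independent (b ` I)" by (rule pairwise_orthogonal_independent)
  then have sp: "UNIV \<subseteq> span (b ` I)"
    by (intro card_ge_dim_independent) (auto simp: card_image[OF inj] b(2))
  define r where "r = w - (\<Sum>i\<in>I. (w \<bullet> b i) *\<^sub>R b i)"
  have "r \<bullet> b j = 0" if "j \<in> I" for j
  proof -
    have "(\<Sum>i\<in>I. (w \<bullet> b i) * (b i \<bullet> b j)) = (\<Sum>i\<in>I. if i = j then w \<bullet> b i else 0)"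
      by (rule sum.cong) (auto simp: b(3) that)
    then show ?thesis using that b(1) by (simp add: r_def inner_diff_left inner_sum_left)
  qed
  then have "orthogonal r x" if "x \<in> span (b ` I)" for x
    using orthogonal_to_span[OF that] by (auto simp: orthogonal_def)
  then have "r = 0" using sp by (metis UNIV_I orthogonal_self subsetD)
  then show ?thesis by (simp add: r_def)
qed

lemma normal_frame_expand:
  fixes J :: "real^'n \<Rightarrow> real^'k"
  assumes "CARD('k) = CARD('n) + 1" "orthonormal_for J e" "norm \<nu> = 1" "\<And>k. \<nu> \<bullet> J (e k) = 0"
  shows "w = (w \<bullet> \<nu>) *\<^sub>R \<nu> + (\<Sum>k\<in>UNIV. (w \<bullet> J (e k)) *\<^sub>R J (e k))"
proof -
  \<comment> \<open>The index type \<open>'n option\<close> has \<open>CARD('n) + 1\<close>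
    elements, exactly the dimension of the ambient space; \<open>None\<close> stands for the
    normal.\<close>
  define b where "b = case_option \<nu> (\<lambda>k. J (e k))"
  have "w = (\<Sum>i\<in>UNIV. (w \<bullet> b i) *\<^sub>R b i)"
  proof (rule orthonormal_expand)
    show "b i \<bullet> b j = (if i = j then 1 else 0)" for i j
      using assms(2-4) by (auto simp: b_def orthonormal_for_def norm_eq_1 inner_commute split: option.splits)
  qed (use assms(1) in auto)
  then show ?thesis by (simp add: UNIV_option_conv sum.reindex b_def)
qed

section \<open>Derivatives of determinants and inverse matrices\<close>

text \<open>Jacobi's formula, \<open>d det A = det A * tr (A^{-1} dA)\<close>. Differentiating the
  permutation expansion factor by factor gives a sum of determinants in which one row is replaced by
  its derivative; each is evaluated by writing that row in terms of the rows of
  \<open>A y\<close>.\<close>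

lemma has_derivative_det:
  fixes A :: "'a::real_normed_vector \<Rightarrow> real^'n^'n"
  assumes A: "\<And>i j. ((\<lambda>z. A z $ i $ j) has_derivative A' i j) (at y)" and B: "B ** A y = mat 1"
  shows "((\<lambda>z. det (A z)) has_derivative (\<lambda>v. det (A y) * (\<Sum>i\<in>UNIV. \<Sum>j\<in>UNIV. B $ j $ i * A' i j v))) (at y)"
proof -
  let ?P = "{p :: 'n \<Rightarrow> 'n. p permutes UNIV}"
  have "((\<lambda>z. det (A z)) has_derivative
     (\<lambda>v. \<Sum>p\<in>?P. of_int (sign p) * (\<Sum>i\<in>UNIV. A' i (p i) v * (\<Prod>j\<in>UNIV - {i}. A y $ j $ p j)))) (at y)"
    unfolding det_def by (intro has_derivative_sum has_derivative_mult_right has_derivative_prod A)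
  then show ?thesis
  proof (rule has_derivative_eq_rhs, intro ext)
    fix v
    \<comment> \<open>\<open>R i\<close> is the matrix \<open>A y\<close> with row \<open>i\<close>
      replaced by its derivative in direction \<open>v\<close>.\<close>
    define R where "R = (\<lambda>i. \<chi> k. if k = i then \<chi> j. A' i j v else A y $ k)"
    have "(\<Sum>p\<in>?P. of_int (sign p) * (\<Sum>i\<in>UNIV. A' i (p i) v * (\<Prod>j\<in>UNIV - {i}. A y $ j $ p j))) =
      (\<Sum>p\<in>?P. \<Sum>i\<in>UNIV. of_int (sign p) * (\<Prod>j\<in>UNIV. R i $ j $ p j))"
    proof (intro sum.cong refl, unfold sum_distrib_left, intro sum.cong refl)
      fix p i
      have "(\<Prod>j\<in>UNIV. R i $ j $ p j) = R i $ i $ p i * (\<Prod>j\<in>UNIV - {i}. R i $ j $ p j)"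
        by (rule prod.remove) auto
      also have "(\<Prod>j\<in>UNIV - {i}. R i $ j $ p j) = (\<Prod>j\<in>UNIV - {i}. A y $ j $ p j)"
        by (rule prod.cong) (auto simp: R_def)
      finally show "real_of_int (sign p) * (A' i (p i) v * (\<Prod>j\<in>UNIV - {i}. A y $ j $ p j)) =
        real_of_int (sign p) * (\<Prod>j\<in>UNIV. R i $ j $ p j)" by (simp add: R_def)
    qed
    also have "\<dots> = (\<Sum>i\<in>UNIV. det (R i))" unfolding det_def by (rule sum.swap)
    also have "\<dots> = (\<Sum>i\<in>UNIV. (\<Sum>j\<in>UNIV. B $ j $ i * A' i j v) * det (A y))"
    proof (rule sum.cong[OF refl])
      fix i
      \<comment> \<open>Coefficients of the differentiated row with respect to the rows of
        \<open>A y\<close>, obtained by multiplying it from the right by the inverse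
        \<open>B\<close>. Only coefficient \<open>i\<close> survives in the determinant.\<close>
      define x where "x = (\<chi> l. \<Sum>m\<in>UNIV. A' i m v * B $ m $ l)"
      have "(\<Sum>l\<in>UNIV. x $ l * A y $ l $ j) = A' i j v" for j
      proof -
        have "(\<Sum>l\<in>UNIV. x $ l * A y $ l $ j) = (\<Sum>l\<in>UNIV. \<Sum>m\<in>UNIV. A' i m v * (B $ m $ l * A y $ l $ j))"
          by (simp add: x_def sum_distrib_right mult.assoc)
        also have "\<dots> = (\<Sum>m\<in>UNIV. A' i m v * (B ** A y) $ m $ j)"
          by (subst sum.swap) (simp add: sum_distrib_left matrix_matrix_mult_def)
        also have "\<dots> = (\<Sum>m\<in>UNIV. if m = j then A' i m v else 0)"
          by (rule sum.cong) (auto simp: B mat_def)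
        finally show ?thesis by simp
      qed
      then have "R i = (\<chi> k. if k = i then (\<Sum>l\<in>UNIV. x $ l *s row l (A y)) else row k (A y))"
        by (auto simp: R_def vec_eq_iff row_def)
      then have "det (R i) = x $ i * det (A y)" by (simp only: cramer_lemma_transpose)
      then show "det (R i) = (\<Sum>j\<in>UNIV. B $ j $ i * A' i j v) * det (A y)" by (simp add: x_def mult.commute)
    qed
    finally show "(\<Sum>p\<in>?P. of_int (sign p) * (\<Sum>i\<in>UNIV. A' i (p i) v * (\<Prod>j\<in>UNIV - {i}. A y $ j $ p j)))
      = det (A y) * (\<Sum>i\<in>UNIV. \<Sum>j\<in>UNIV. B $ j $ i * A' i j v)"
      by (simp add: sum_distrib_left mult.commute[of "det (A y)"] sum_distrib_right)
  qed
qed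

lemma C1_on_det:
  fixes A :: "'a::euclidean_space \<Rightarrow> real^'n^'n"
  assumes "\<And>i j. C1_on S (\<lambda>z. A z $ i $ j)"
  shows "C1_on S (\<lambda>z. det (A z))"
  unfolding det_def by (intro C1_on_sum C1_on_mult C1_on_const C1_on_prod assms)

text \<open>Cramer's rule applied to column \<open>l\<close> of the inverse. As a quotient of
  determinants the entry visibly inherits differentiability from the matrix.\<close>

lemma matrix_inv_entry:
  fixes A :: "real^'n^'n"
  assumes "det A \<noteq> 0"
  shows "matrix_inv A $ k $ l = det (\<chi> i j. if j = k then axis l 1 $ i else A $ i $ j) / det A"
proof -
  have "A *v (matrix_inv A *v axis l 1) = axis l 1"
    using assms by (simp add: matrix_vector_mul_assoc matrix_inv_mult invertible_det_nz)
  then have "matrix_inv A *v axis l 1 = (\<chi> k. det (\<chi> i j. if j = k then axis l 1 $ i else A $ i $ j) / det A)"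
    using cramer[OF assms] by blast
  moreover have "matrix_inv A $ k $ l = (matrix_inv A *v axis l 1) $ k"
    by (simp add: matrix_vector_mult_def axis_def if_distrib cong: if_cong)
  ultimately show ?thesis by simp
qed

lemma C1_on_matrix_inv:
  fixes A :: "'a::euclidean_space \<Rightarrow> real^'n^'n"
  assumes "open S" "\<And>i j. C1_on S (\<lambda>z. A z $ i $ j)" "\<And>z. z \<in> S \<Longrightarrow> det (A z) \<noteq> 0"
  shows "C1_on S (\<lambda>z. matrix_inv (A z) $ k $ l)"
proof (subst C1_on_cong[OF assms(1) matrix_inv_entry])
  show "C1_on S (\<lambda>x. det (\<chi> i j. if j = k then axis l 1 $ i else A x $ i $ j) / det (A x))"
  proof (intro C1_on_divide C1_on_det)
    show "C1_on S (\<lambda>z. (\<chi> i j. if j = k then axis l 1 $ i else A z $ i $ j) $ i $ j)" for i j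
      by (cases "j = k") (auto simp: assms)
  qed (use assms in auto)
qed (use assms in auto)

section \<open>Change of variables\<close>

text \<open>Renames coordinates along a map of index types. It carries statements between a general
  index type and \<open>ord_index\<close>; for a bijection it preserves Lebesgue measure and
  determinants.\<close>

definition relabel :: "('m \<Rightarrow> 'n) \<Rightarrow> real^'n \<Rightarrow> real^'m" where
  "relabel b v = (\<chi> k. v $ b k)"

lemma relabel_inv [simp]:
  assumes "bij b" shows "relabel (inv b) (relabel b v) = v" "relabel b (relabel (inv b) w) = w"
  using assms by (simp_all add: relabel_def vec_eq_iff bij_is_surj surj_f_inv_f bij_is_inj)

lemma relabel_axis: "bij b \<Longrightarrow> relabel b (axis i 1) = axis (inv b i) 1"
  by (auto simp: relabel_def vec_eq_iff axis_def bij_is_surj surj_f_inv_f bij_is_inj)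

lemma linear_relabel: "linear (relabel b)"
  by (rule linearI) (simp_all add: relabel_def vec_eq_iff)

lemma has_derivative_relabel: "(relabel b has_derivative relabel b) F"
  by (simp add: linear_relabel bounded_linear_imp_has_derivative linear_linear)

lemma measurable_relabel [measurable]: "relabel b \<in> borel_measurable borel"
  by (simp add: borel_measurable_continuous_onI linear_continuous_on linear_relabel linear_linear)

lemma prod_Basis_vec:
  fixes f :: "real^'n \<Rightarrow> 'c::comm_monoid_mult"
  shows "(\<Prod>b\<in>Basis. f b) = (\<Prod>i\<in>UNIV. f (axis i 1))"
proof -
  have "Basis = range (\<lambda>i. axis i (1::real) :: real^'n)" by (auto simp: Basis_vec_def)
  moreover have "inj (\<lambda>i. axis i (1::real) :: real^'n)" by (auto simp: inj_def axis_eq_axis)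
  ultimately show ?thesis by (metis prod.reindex_cong)
qed

text \<open>Lebesgue measure is determined by the volumes of boxes, and the preimage of a box is a
  box with the same side lengths in another order.\<close>

lemma distr_lborel_relabel:
  fixes b :: "'m::finite \<Rightarrow> 'n::finite"
  assumes "bij b" shows "distr lborel borel (relabel b) = lborel"
proof (rule lborel_eqI[symmetric])
  fix l u :: "real^'m"
  assume le: "\<And>b. b \<in> Basis \<Longrightarrow> l \<bullet> b \<le> u \<bullet> b"
  have le': "l $ i \<le> u $ i" for i using le[of "axis i 1"] by (auto simp: Basis_vec_def inner_axis)
  have eq: "relabel b -` box l u = box (relabel (inv b) l) (relabel (inv b) u)"
    using assms by (auto simp: mem_box_cart relabel_def) (metis bij_inv_eq_iff)+
  have "emeasure (distr lborel borel (relabel b)) (box l u) =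
      emeasure lborel (box (relabel (inv b) l) (relabel (inv b) u))"
    by (simp add: emeasure_distr eq)
  also have "\<dots> = (\<Prod>i\<in>UNIV. (u - l) $ inv b i)"
    using le' unfolding emeasure_lborel_box_eq prod_Basis_vec
    by (auto simp: inner_axis relabel_def Basis_vec_def)
  also have "(\<Prod>i\<in>UNIV. (u - l) $ inv b i) = (\<Prod>k\<in>UNIV. (u - l) $ k)"
    using prod.reindex_bij_betw[OF bij_imp_bij_inv[OF assms], of "\<lambda>k. (u - l) $ k"] by simp
  finally show "emeasure (distr lborel borel (relabel b)) (box l u) = (\<Prod>b\<in>Basis. (u - l) \<bullet> b)"
    by (simp add: prod_Basis_vec inner_axis)
qed simp

lemma det_relabel:
  fixes A :: "real^'n^'n" and b :: "'m::finite \<Rightarrow> 'n::finite"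
  assumes "bij b" shows "det (\<chi> k l. A $ b k $ b l) = det A"
proof -
  have [simp]: "b (inv b i) = i" "inv b (b k) = k" for i k
    using assms by (simp_all add: bij_is_surj surj_f_inv_f bij_is_inj)
  have perm: "p permutes UNIV \<longleftrightarrow> bij p" for p :: "'x \<Rightarrow> 'x" by (simp add: permutes_univ bij_iff)
  show ?thesis unfolding det_def
  proof (rule sum.reindex_bij_witness[of _ "\<lambda>q. inv b \<circ> q \<circ> b" "\<lambda>p. b \<circ> p \<circ> inv b"])
    fix p :: "'m \<Rightarrow> 'm" assume p: "p \<in> {p. p permutes UNIV}"
    \<comment> \<open>The permutation sums are matched by conjugation with \<open>b\<close>;
      recognising the conjugate as \<open>map_permutation\<close> yields equality of signs across
      the two index types.\<close>
    have "map_permutation UNIV b p = b \<circ> p \<circ> inv b"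
      using assms by (simp add: map_permutation_def restrict_id_def bij_is_surj fun_eq_iff)
    then have s: "sign (b \<circ> p \<circ> inv b) = sign p"
      using sign_map_permutation[of b UNIV p] p assms by (simp add: bij_is_inj)
    have "(\<Prod>i\<in>UNIV. A $ i $ (b \<circ> p \<circ> inv b) i) = (\<Prod>k\<in>UNIV. A $ b k $ (b \<circ> p \<circ> inv b) (b k))"
      by (rule prod.reindex_bij_betw[OF assms, symmetric])
    then show "of_int (sign (b \<circ> p \<circ> inv b)) * (\<Prod>i\<in>UNIV. A $ i $ (b \<circ> p \<circ> inv b) i) =
      of_int (sign p) * (\<Prod>i\<in>UNIV. (\<chi> k l. A $ b k $ b l) $ i $ p i)" by (simp add: s)
  qed (use assms in \<open>auto simp: perm fun_eq_iff intro!: bij_comp bij_imp_bij_inv\<close>)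
qed

text \<open>The change of variables theorem of the library requires a well-ordered index type.\<close>

typedef 'n ord_index = "{..<CARD('n::finite)}"
  by (rule exI[of _ 0]) simp

instance ord_index :: (finite) finite
proof
  show "finite (UNIV :: 'a ord_index set)"
    unfolding type_definition.univ[OF type_definition_ord_index[where 'n='a]] by simp
qed

instantiation ord_index :: (finite) wellorder
begin

definition "x \<le> y \<longleftrightarrow> Rep_ord_index x \<le> Rep_ord_index y"
definition "x < y \<longleftrightarrow> Rep_ord_index x < Rep_ord_index y"

instance
proof
  fix P :: "'a ord_index \<Rightarrow> bool" and a :: "'a ord_index"
  assume *: "\<And>x. (\<And>y. y < x \<Longrightarrow> P y) \<Longrightarrow> P x"
  show "P a" by (induction a rule: measure_induct[of Rep_ord_index]) (rule *, simp add: less_ord_index_def)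
qed (auto simp: less_eq_ord_index_def less_ord_index_def Rep_ord_index_inject)

end

lemma ord_index_bij: "\<exists>b :: 'n::finite ord_index \<Rightarrow> 'n. bij b"
proof -
  have "CARD('n ord_index) = CARD('n)"
    using type_definition.card[OF type_definition_ord_index[where 'n='n]] by simp
  then show ?thesis using finite_same_card_bij[of "UNIV :: 'n ord_index set" "UNIV :: 'n set"] by auto
qed

text \<open>Passes from an equivalence of \<open>has_integral\<close> statements to nonnegative
  integrals that may be infinite: a finite value on either side transfers to the other, and
  otherwise both are infinite.\<close>

lemma nn_integral_eqI_has_integral:
  fixes f :: "'a::euclidean_space \<Rightarrow> real" and g :: "'b::euclidean_space \<Rightarrow> real"
  assumes f: "\<And>x. 0 \<le> f x" "f \<in> borel_measurable borel"
    and g: "\<And>x. 0 \<le> g x" "g \<in> borel_measurable borel"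
    and eq: "\<And>r. (f has_integral r) UNIV \<longleftrightarrow> (g has_integral r) UNIV"
  shows "(\<integral>\<^sup>+x. f x \<partial>lborel) = (\<integral>\<^sup>+x. g x \<partial>lborel)"
proof -
  show ?thesis
  proof (cases "(\<integral>\<^sup>+x. f x \<partial>lborel) = \<infinity> \<and> (\<integral>\<^sup>+x. g x \<partial>lborel) = \<infinity>")
    case False
    then consider r where "r \<ge> 0" "(\<integral>\<^sup>+x. f x \<partial>lborel) = ennreal r"
      | r where "r \<ge> 0" "(\<integral>\<^sup>+x. g x \<partial>lborel) = ennreal r"
      by (metis ennreal_cases infinity_ennreal_def)
    then show ?thesis
    proof cases
      case 1
      then have "(f has_integral r) UNIV" using nn_integral_has_integral[of f r] f by auto
      then show ?thesis using 1 eq nn_integral_has_integral_lborel[OF g(2,1)] by auto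
    next
      case 2
      then have "(g has_integral r) UNIV" using nn_integral_has_integral[of g r] g by auto
      then show ?thesis using 2 eq nn_integral_has_integral_lborel[OF f(2,1)] by auto
    qed
  qed simp
qed

lemma nn_integral_change_of_variables_wellorder:
  fixes g h :: "real^'n::{finite,wellorder} \<Rightarrow> real^'n::_"
  assumes der: "\<And>x. x \<in> S \<Longrightarrow> (g has_derivative g' x) (at x)" "\<And>y. y \<in> T \<Longrightarrow> (h has_derivative h' y) (at y)"
    and S: "open S" and T: "open T"
    and f0: "\<And>y. y \<in> T \<Longrightarrow> 0 \<le> f y"
    and hg: "\<And>x. x \<in> S \<Longrightarrow> g x \<in> T \<and> h (g x) = x" "\<And>y. y \<in> T \<Longrightarrow> h y \<in> S \<and> g (h y) = y"
    and meas: "(\<lambda>y. indicator T y * f y) \<in> borel_measurable borel"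
      "(\<lambda>x. indicator S x * (\<bar>det (matrix (g' x))\<bar> * f (g x))) \<in> borel_measurable borel"
  shows "(\<integral>\<^sup>+y. ennreal (indicator T y * f y) \<partial>lborel) =
    (\<integral>\<^sup>+x. ennreal (indicator S x * (\<bar>det (matrix (g' x))\<bar> * f (g x))) \<partial>lborel)"
proof (rule nn_integral_eqI_has_integral)
  \<comment> \<open>The chain rule for \<open>h \<circ> g\<close>, which is the identity on the open
    set \<open>S\<close>, makes the derivatives inverse to each other; this is the invertibility
    premise of the change of variables formula.\<close>
  have id: "h' y \<circ> g' (h y) = id" if "y \<in> T" for y
  proof -
    have x: "h y \<in> S" "g (h y) = y" using hg that by auto
    have 1: "(h has_derivative h' y) (at (g (h y)))" using der(2)[OF that] x by simp
    have "((\<lambda>x. h (g x)) has_derivative (\<lambda>v. h' y (g' (h y) v))) (at (h y))"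
      by (rule has_derivative_compose[OF der(1)[OF x(1)] 1])
    moreover have "((\<lambda>x. h (g x)) has_derivative (\<lambda>v. v)) (at (h y))"
      by (rule has_derivative_transform_within_open[OF has_derivative_ident S x(1)]) (use hg in auto)
    ultimately have "(\<lambda>v. h' y (g' (h y) v)) = (\<lambda>v. v)" by (rule has_derivative_unique)
    then show ?thesis by (simp add: o_def id_def)
  qed
  show "((\<lambda>y. indicator T y * f y) has_integral r) UNIV \<longleftrightarrow>
     ((\<lambda>x. indicator S x * (\<bar>det (matrix (g' x))\<bar> * f (g x))) has_integral r) UNIV" for r
  proof -
    have "((\<lambda>x. \<bar>det (matrix (g' x))\<bar> * f (g x)) has_integral r) S \<longleftrightarrow> (f has_integral r) T"
      by (rule cov_invertible_nonneg_eq[where h = h and h' = h'])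
        (use der f0 hg id in \<open>auto intro: has_derivative_at_withinI\<close>)
    moreover have "(k has_integral r) A \<longleftrightarrow> ((\<lambda>x. indicator A x * k x) has_integral r) UNIV"
      for k :: "real^'n::_ \<Rightarrow> real" and A
      using has_integral_restrict_UNIV[of A k r]
      by (simp add: indicator_def of_bool_def if_distrib[of "\<lambda>x. x * _"] cong: if_cong)
    ultimately show ?thesis by simp
  qed
qed (use f0 hg meas in \<open>auto simp: indicator_def\<close>)

theorem nn_integral_change_of_variables:
  fixes g h :: "real^'n \<Rightarrow> real^'n"
  assumes der: "\<And>x. x \<in> S \<Longrightarrow> (g has_derivative g' x) (at x)" "\<And>y. y \<in> T \<Longrightarrow> (h has_derivative h' y) (at y)"
    and S: "open S" and T: "open T"
    and f0: "\<And>y. y \<in> T \<Longrightarrow> 0 \<le> f y"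
    and hg: "\<And>x. x \<in> S \<Longrightarrow> g x \<in> T \<and> h (g x) = x" "\<And>y. y \<in> T \<Longrightarrow> h y \<in> S \<and> g (h y) = y"
    and meas: "(\<lambda>y. indicator T y * f y) \<in> borel_measurable borel"
      "(\<lambda>x. indicator S x * (\<bar>det (matrix (g' x))\<bar> * f (g x))) \<in> borel_measurable borel"
  shows "(\<integral>\<^sup>+y. ennreal (indicator T y * f y) \<partial>lborel) =
    (\<integral>\<^sup>+x. ennreal (indicator S x * (\<bar>det (matrix (g' x))\<bar> * f (g x))) \<partial>lborel)"
proof -
  obtain b :: "'n ord_index \<Rightarrow> 'n" where b: "bij b" using ord_index_bij by blast
  define R where "R = relabel b"
  define Q where "Q = relabel (inv b)"
  have [simp]: "Q (R v) = v" "R (Q w) = w" for v w using b by (simp_all add: R_def Q_def)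
  have dR: "(R has_derivative R) F" and dQ: "(Q has_derivative Q) F'" for F F'
    by (simp_all add: R_def Q_def has_derivative_relabel)
  have contQ: "continuous_on UNIV Q" by (rule has_derivative_continuous_on[OF dQ])
  have mQ [measurable]: "Q \<in> borel_measurable borel" by (simp add: Q_def measurable_relabel)
  have tr: "(\<integral>\<^sup>+y. ennreal (F y) \<partial>lborel) = (\<integral>\<^sup>+y. ennreal (F (Q y)) \<partial>lborel)"
    if [measurable]: "F \<in> borel_measurable borel" for F
  proof -
    have "(\<integral>\<^sup>+y. ennreal (F y) \<partial>lborel) = (\<integral>\<^sup>+y. ennreal (F y) \<partial>distr lborel borel Q)"
      using distr_lborel_relabel[OF bij_imp_bij_inv[OF b]] by (simp add: Q_def)
    then show ?thesis by (simp add: nn_integral_distr)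
  qed
  \<comment> \<open>Conjugation by a relabelling permutes rows and columns simultaneously, so the
    Jacobian determinant is the same in both index types.\<close>
  have det: "det (matrix (\<lambda>v. R (L (Q v)))) = det (matrix L)" for L
  proof -
    have "matrix (\<lambda>v. R (L (Q v))) = (\<chi> k l. matrix L $ b k $ b l)"
      using b by (simp add: matrix_def R_def Q_def relabel_axis bij_imp_bij_inv inv_inv_eq)
        (simp add: relabel_def)
    then show ?thesis by (simp add: det_relabel[OF b])
  qed
  have ind: "indicator (Q -` A) x = (indicator A (Q x) :: real)" for A x by (simp add: indicator_def)
  have "(\<integral>\<^sup>+y. ennreal (indicator (Q -` T) y * f (Q y)) \<partial>lborel) =
    (\<integral>\<^sup>+x. ennreal (indicator (Q -` S) x * (\<bar>det (matrix (\<lambda>v. R (g' (Q x) (Q v))))\<bar> * f (Q (R (g (Q x)))))) \<partial>lborel)"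
  proof (rule nn_integral_change_of_variables_wellorder[where h = "\<lambda>y. R (h (Q y))" and h' = "\<lambda>y v. R (h' (Q y) (Q v))"])
    show "((\<lambda>x. R (g (Q x))) has_derivative (\<lambda>v. R (g' (Q x) (Q v)))) (at x)" if "x \<in> Q -` S" for x
      using that by (intro has_derivative_compose[OF _ dR] has_derivative_compose[OF dQ] der) auto
    show "((\<lambda>x. R (h (Q x))) has_derivative (\<lambda>v. R (h' (Q x) (Q v)))) (at x)" if "x \<in> Q -` T" for x
      using that by (intro has_derivative_compose[OF _ dR] has_derivative_compose[OF dQ] der) auto
    show "open (Q -` S)" "open (Q -` T)" using S T contQ by (auto intro: open_vimage)
    show "(\<lambda>y. indicator (Q -` T) y * f (Q y)) \<in> borel_measurable borel"
      using measurable_compose[OF mQ meas(1)] by (simp add: ind)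
    show "(\<lambda>x. indicator (Q -` S) x * (\<bar>det (matrix (\<lambda>v. R (g' (Q x) (Q v))))\<bar> * f (Q (R (g (Q x)))))) \<in> borel_measurable borel"
      using measurable_compose[OF mQ meas(2)] by (simp add: ind det)
  qed (use f0 hg in auto)
  then show ?thesis by (simp add: tr[OF meas(1)] tr[OF meas(2)] ind det)
qed

section \<open>The Riemannian volume\<close>

lemma Ck_on_2: "Ck_on 2 S f \<longleftrightarrow> C2_on S f"
proof -
  have "continuous_on S g" if "\<forall>x\<in>S. g differentiable (at x)" for g :: "'a \<Rightarrow> 'b"
    using that by (meson continuous_at_imp_continuous_on differentiable_imp_continuous_within)
  then show ?thesis by (auto simp: numeral_2_eq_2 C2_on_def C1_on_def)
qed

lemma C2_on_C1: "C2_on S f \<Longrightarrow> C1_on S f"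
  by (simp add: C2_on_def)

lemma C2_on_D: "C2_on S f \<Longrightarrow> C1_on S (\<lambda>x. D f x v)"
  by (simp add: C2_on_def)

definition vol_density :: "('m \<Rightarrow> real^'k) \<Rightarrow> (real^'n \<Rightarrow> 'm) \<Rightarrow> real^'n::finite \<Rightarrow> real" where
  "vol_density X \<psi> y = sqrt (det (metric_matrix X \<psi> y))"

lemma metric_matrix_gram: "metric_matrix X \<psi> y = gram (D (X \<circ> \<psi>) y)"
  by (simp add: metric_matrix_def gram_def pd_def)

locale smooth_immersed =
  fixes \<A> :: "('n::finite, 'm::{t2_space, second_countable_topology}) patch set"
    and X :: "'m \<Rightarrow> real^'k"
  assumes manifold: "smooth_atlas \<A>" and immersion: "smooth_immersion \<A> X"
begin

context
  fixes V and \<psi>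
  assumes c: "(V, \<psi>) \<in> \<A>"
begin

lemma patch_open: "open V" "open (\<psi> ` V)"
  using manifold c unfolding smooth_atlas_def by auto

lemma patch_homeo: "\<exists>\<phi>. homeomorphism V (\<psi> ` V) \<psi> \<phi>"
  using manifold c unfolding smooth_atlas_def by auto

lemma patch_cont: "continuous_on V \<psi>"
  using patch_homeo by (auto simp: homeomorphism_def)

lemma patch_inj: "inj_on \<psi> V"
  using patch_homeo by (auto simp: homeomorphism_def intro: inj_on_inverseI)

lemma patch_inv: "y \<in> V \<Longrightarrow> inv_into V \<psi> (\<psi> y) = y"
  by (simp add: inv_into_f_f patch_inj)

lemma patch_inv_cont: "continuous_on (\<psi> ` V) (inv_into V \<psi>)"
proof -
  obtain \<phi> where "homeomorphism V (\<psi> ` V) \<psi> \<phi>" using patch_homeo by blast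
  then have "continuous_on (\<psi> ` V) \<phi>" "\<And>p. p \<in> \<psi> ` V \<Longrightarrow> inv_into V \<psi> p = \<phi> p"
    by (auto simp: homeomorphism_def patch_inv)
  then show ?thesis by (simp cong: continuous_on_cong)
qed

lemma patch_open_image: "open U \<Longrightarrow> U \<subseteq> V \<Longrightarrow> open (\<psi> ` U)"
proof -
  assume U: "open U" "U \<subseteq> V"
  have "open (\<psi> ` V \<inter> inv_into V \<psi> -` U)"
    using continuous_open_preimage[OF patch_inv_cont patch_open(2) U(1)] .
  moreover have "\<psi> ` V \<inter> inv_into V \<psi> -` U = \<psi> ` U" using U(2) by (auto simp: patch_inv)
  ultimately show ?thesis by simp
qed

lemma patch_open_vimage: "open U \<Longrightarrow> open (V \<inter> \<psi> -` U)"
  using continuous_open_preimage[OF patch_cont patch_open(1)] .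

lemma patch_C2: "C2_on V (X \<circ> \<psi>)"
  using immersion c unfolding smooth_immersion_def smooth_on_def by (auto simp: Ck_on_2[symmetric])

lemma patch_linear: "y \<in> V \<Longrightarrow> linear (D (X \<circ> \<psi>) y)"
  using C1_on_differentiable[OF C2_on_C1[OF patch_C2]] D_linear by blast

lemma patch_D_inj: "y \<in> V \<Longrightarrow> inj (D (X \<circ> \<psi>) y)"
  using immersion c unfolding smooth_immersion_def by auto

lemma metric_C1: "C1_on V (\<lambda>y. metric_matrix X \<psi> y $ i $ j)"
  unfolding metric_matrix_def pd_def by (simp add: C1_on_inner C2_on_D[OF patch_C2])

lemma metric_det_pos: "y \<in> V \<Longrightarrow> det (metric_matrix X \<psi> y) > 0"
  unfolding metric_matrix_gram by (intro det_gram_pos patch_linear patch_D_inj)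

lemma vol_density_pos: "y \<in> V \<Longrightarrow> vol_density X \<psi> y > 0"
  by (simp add: vol_density_def metric_det_pos)

lemma vol_density_C1: "C1_on V (vol_density X \<psi>)"
  unfolding vol_density_def[abs_def] by (intro C1_on_sqrt C1_on_det metric_C1 metric_det_pos)

lemma inverse_metric_C1: "C1_on V (\<lambda>y. matrix_inv (metric_matrix X \<psi> y) $ i $ j)"
  by (intro C1_on_matrix_inv patch_open metric_C1) (use metric_det_pos in force)

end

lemma patch_cover: "\<exists>V \<psi> y. (V, \<psi>) \<in> \<A> \<and> y \<in> V \<and> \<psi> y = p"
proof -
  have "p \<in> (\<Union>(V, \<psi>)\<in>\<A>. \<psi> ` V)" using manifold unfolding smooth_atlas_def by auto
  then show ?thesis by auto
qed

definition transition where
  "transition V' \<psi>' \<psi> = inv_into V' \<psi>' \<circ> \<psi>"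

context
  fixes V \<psi> V' \<psi>'
  assumes c: "(V, \<psi>) \<in> \<A>" and c': "(V', \<psi>') \<in> \<A>"
begin

lemma overlap_open: "open (V \<inter> \<psi> -` (\<psi>' ` V'))"
  using patch_open_vimage[OF c patch_open(2)[OF c']] .

lemma transition_C2: "C2_on (V \<inter> \<psi> -` (\<psi>' ` V')) (transition V' \<psi>' \<psi>)"
  using manifold c c' unfolding smooth_atlas_def smooth_on_def transition_def
  by (fastforce simp: Ck_on_2[symmetric])

lemma transition_eq:
  assumes "y \<in> V" "y' \<in> V'" "\<psi> y = \<psi>' y'" shows "transition V' \<psi>' \<psi> y = y'"
  by (simp add: transition_def assms patch_inv[OF c'])

lemma transition_in:
  assumes "y \<in> V \<inter> \<psi> -` (\<psi>' ` V')"
  shows "transition V' \<psi>' \<psi> y \<in> V'" "\<psi>' (transition V' \<psi>' \<psi> y) = \<psi> y"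
  using assms by (auto simp: transition_def inv_into_into f_inv_into_f)

lemma transition_compose:
  assumes "y \<in> V \<inter> \<psi> -` (\<psi>' ` V')"
  shows "(F \<circ> \<psi>) y = (F \<circ> \<psi>') (transition V' \<psi>' \<psi> y)"
  using transition_in[OF assms] by simp

lemma D_transition:
  assumes y: "y \<in> V \<inter> \<psi> -` (\<psi>' ` V')" and F: "(F \<circ> \<psi>') differentiable (at (transition V' \<psi>' \<psi> y))"
  shows "D (F \<circ> \<psi>) y v = D (F \<circ> \<psi>') (transition V' \<psi>' \<psi> y) (D (transition V' \<psi>' \<psi>) y v)"
proof -
  have e: "D (F \<circ> \<psi>) y = D (\<lambda>z. (F \<circ> \<psi>') (transition V' \<psi>' \<psi> z)) y"
    using transition_compose by (intro D_cong_open[OF overlap_open y])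
  have "D (\<lambda>z. (F \<circ> \<psi>') (transition V' \<psi>' \<psi> z)) y v = D (F \<circ> \<psi>') (transition V' \<psi>' \<psi> y) (D (transition V' \<psi>' \<psi>) y v)"
    using F C1_on_differentiable[OF C2_on_C1[OF transition_C2] y] by (intro D_compose)
  then show ?thesis by (simp only: e)
qed

text \<open>The Gram determinant acquires the squared Jacobian; its square root is the absolute
  value expected by the change of variables formula.\<close>

lemma vol_density_transition:
  assumes y: "y \<in> V \<inter> \<psi> -` (\<psi>' ` V')"
  shows "vol_density X \<psi> y =
    \<bar>det (matrix (D (transition V' \<psi>' \<psi>) y))\<bar> * vol_density X \<psi>' (transition V' \<psi>' \<psi> y)"
proof -
  have d: "(X \<circ> \<psi>') differentiable (at (transition V' \<psi>' \<psi> y))"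
    using transition_in[OF y] C1_on_differentiable[OF C2_on_C1[OF patch_C2[OF c']]] by blast
  have "gram (D (X \<circ> \<psi>) y) =
      gram (\<lambda>v. D (X \<circ> \<psi>') (transition V' \<psi>' \<psi> y) (D (transition V' \<psi>' \<psi>) y v))"
    by (simp add: gram_def D_transition[OF y d])
  then show ?thesis unfolding vol_density_def metric_matrix_gram
    by (simp add: det_gram_compose D_linear d C1_on_differentiable[OF C2_on_C1[OF transition_C2] y] real_sqrt_mult)
qed

end

section \<open>Patch measures and their agreement on overlaps\<close>

text \<open>Nothing is known about \<open>\<psi>\<close> outside \<open>V\<close>, so the map is
  made constant there to be Borel measurable on the whole space. The arbitrary value has no effect,
  since the density below vanishes off \<open>V\<close>.\<close>

definition patch_map where
  "patch_map V \<psi> = (\<lambda>y. if y \<in> V then \<psi> y else undefined)"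

text \<open>The push-forward of \<open>sqrt (det g) dy\<close>: the restriction of the Riemannian
  volume to the image of one patch, regarded as a measure on the whole manifold.\<close>

definition patch_measure where
  "patch_measure V \<psi> = distr (density lborel (\<lambda>y. ennreal (indicator V y * vol_density X \<psi> y))) borel
     (patch_map V \<psi>)"

context
  fixes V and \<psi>
  assumes c: "(V, \<psi>) \<in> \<A>"
begin

lemma patch_map_measurable [measurable]: "patch_map V \<psi> \<in> borel \<rightarrow>\<^sub>M borel"
  unfolding patch_map_def
  by (rule borel_measurable_continuous_on_if) (use patch_open[OF c] patch_cont[OF c] in auto)

lemma indicator_vol_measurable [measurable]:
  "(\<lambda>y. indicator V y * vol_density X \<psi> y) \<in> borel_measurable borel"
  using borel_measurable_continuous_on_indicator[OF _ C1_on_continuous[OF vol_density_C1[OF c]]]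
    patch_open[OF c] by auto

lemma patch_vimage_measurable: "B \<in> sets borel \<Longrightarrow> V \<inter> \<psi> -` B \<in> sets borel"
proof -
  assume B: "B \<in> sets borel"
  have "V \<inter> patch_map V \<psi> -` B \<in> sets borel"
    using measurable_sets[OF patch_map_measurable B] patch_open[OF c] by auto
  then show ?thesis by (simp add: patch_map_def Int_def cong: conj_cong)
qed

lemma emeasure_patch_measure:
  assumes [measurable]: "B \<in> sets borel"
  shows "emeasure (patch_measure V \<psi>) B =
    (\<integral>\<^sup>+y. ennreal (vol_density X \<psi> y) * indicator (V \<inter> \<psi> -` B) y \<partial>lborel)"
  unfolding patch_measure_def
  by (subst emeasure_distr, measurable, subst emeasure_density, measurable)
    (auto intro!: nn_integral_cong simp: indicator_def patch_map_def)

lemma sets_patch_measure [simp]: "sets (patch_measure V \<psi>) = sets borel"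
  by (simp add: patch_measure_def)

lemma patch_measure_Int:
  assumes "B \<in> sets borel" shows "emeasure (patch_measure V \<psi>) (B \<inter> \<psi> ` V) = emeasure (patch_measure V \<psi>) B"
  using assms patch_open[OF c]
  by (subst (1 2) emeasure_patch_measure) (auto intro!: nn_integral_cong simp: indicator_def)

end

text \<open>The transition map has Jacobian exactly compensating the quotient of the two densities.
  This is the consistency needed to glue the patch measures.\<close>

lemma patch_measure_overlap:
  assumes c: "(V, \<psi>) \<in> \<A>" and c': "(V', \<psi>') \<in> \<A>"
    and B: "B \<in> sets borel" "B \<subseteq> \<psi> ` V" "B \<subseteq> \<psi>' ` V'"
  shows "emeasure (patch_measure V \<psi>) B = emeasure (patch_measure V' \<psi>') B"
proof -
  define S where "S = V \<inter> \<psi> -` (\<psi>' ` V')"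
  define T where "T = V' \<inter> \<psi>' -` (\<psi> ` V)"
  define g where "g = transition V' \<psi>' \<psi>"
  define h where "h = transition V \<psi> \<psi>'"
  define f where "f = (\<lambda>y. indicator (V' \<inter> \<psi>' -` B) y * vol_density X \<psi>' y)"
  have g: "g x \<in> T" "h (g x) = x" "\<psi>' (g x) = \<psi> x" if "x \<in> S" for x
  proof -
    have "g x \<in> V'" "\<psi>' (g x) = \<psi> x" using transition_in[OF c c'] that by (auto simp: S_def g_def)
    then show "g x \<in> T" "h (g x) = x" "\<psi>' (g x) = \<psi> x"
      using that transition_eq[OF c' c, of "g x" x] by (auto simp: T_def S_def h_def)
  qed
  have h: "h y \<in> S" "g (h y) = y" if "y \<in> T" for y
  proof -
    have "h y \<in> V" "\<psi> (h y) = \<psi>' y" using transition_in[OF c' c] that by (auto simp: T_def h_def)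
    then show "h y \<in> S" "g (h y) = y"
      using that transition_eq[OF c c', of "h y" y] by (auto simp: T_def S_def g_def)
  qed
  have gS: "C1_on S g" and hT: "C1_on T h" and oS: "open S" and oT: "open T"
    using C2_on_C1[OF transition_C2[OF c c']] C2_on_C1[OF transition_C2[OF c' c]]
      overlap_open[OF c c'] overlap_open[OF c' c]
    by (auto simp: S_def T_def g_def h_def)
  have B': "V' \<inter> \<psi>' -` B \<subseteq> T" "V \<inter> \<psi> -` B \<subseteq> S" using B by (auto simp: S_def T_def)
  \<comment> \<open>The Jacobian times the density of the second patch is the density of the first,
    and the two preimages of \<open>B\<close> correspond under the transition map.\<close>
  have Sd: "indicator S x * (\<bar>det (matrix (D g x))\<bar> * f (g x)) = vol_density X \<psi> x * indicator (V \<inter> \<psi> -` B) x" for x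
  proof (cases "x \<in> S")
    case True
    have "g x \<in> V' \<inter> \<psi>' -` B \<longleftrightarrow> x \<in> V \<inter> \<psi> -` B"
      using g[OF True] True by (auto simp: S_def T_def)
    then show ?thesis using True vol_density_transition[OF c c', of x]
      by (auto simp: f_def g_def S_def indicator_def)
  next
    case False then show ?thesis using B' by (auto simp: indicator_def)
  qed
  have Td: "indicator T y * f y = vol_density X \<psi>' y * indicator (V' \<inter> \<psi>' -` B) y" for y
    using B' by (auto simp: f_def indicator_def)
  have meas: "(\<lambda>y. vol_density X \<psi> y * indicator (V \<inter> \<psi> -` B) y) \<in> borel_measurable borel"
    if "(V, \<psi>) \<in> \<A>" for V \<psi>
  proof -
    have "(\<lambda>y. (indicator V y * vol_density X \<psi> y) * indicator (V \<inter> \<psi> -` B) y) \<in> borel_measurable borel"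
      using patch_vimage_measurable[OF that B(1)] indicator_vol_measurable[OF that] by measurable
    moreover have "(indicator V y * vol_density X \<psi> y) * indicator (V \<inter> \<psi> -` B) y
        = vol_density X \<psi> y * indicator (V \<inter> \<psi> -` B) y" for y by (auto simp: indicator_def)
    ultimately show ?thesis by simp
  qed
  have "(\<integral>\<^sup>+y. ennreal (indicator T y * f y) \<partial>lborel) =
      (\<integral>\<^sup>+x. ennreal (indicator S x * (\<bar>det (matrix (D g x))\<bar> * f (g x))) \<partial>lborel)"
  proof (rule nn_integral_change_of_variables[where h = h and h' = "D h", OF _ _ oS oT])
    show "(g has_derivative D g x) (at x)" if "x \<in> S" for x by (rule C1_on_has[OF gS that])
    show "(h has_derivative D h x) (at x)" if "x \<in> T" for x by (rule C1_on_has[OF hT that])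
    show "0 \<le> f y" if "y \<in> T" for y using that vol_density_pos[OF c', of y]
      by (auto simp: f_def T_def indicator_def)
  qed (use g h meas[OF c] meas[OF c'] in \<open>auto simp: Sd Td\<close>)
  then show ?thesis unfolding Sd Td
    by (simp add: emeasure_patch_measure[OF c B(1)] emeasure_patch_measure[OF c' B(1)] ennreal_mult'' ennreal_indicator)
qed

section \<open>Existence and uniqueness of the Riemannian volume\<close>

text \<open>The condition inside the definite description \<open>riemannian_volume\<close>, restated
  through \<open>patch_measure\<close>.\<close>

definition volume_like where
  "volume_like \<mu> \<longleftrightarrow> sets \<mu> = sets borel \<and>
     (\<forall>(V, \<psi>)\<in>\<A>. \<forall>B\<in>sets borel. B \<subseteq> \<psi> ` V \<longrightarrow> emeasure \<mu> B = emeasure (patch_measure V \<psi>) B)"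

text \<open>Second countability enters here through the Lindelof property. Countability permits the
  cover to be made disjoint and the local measures to be summed.\<close>

lemma countable_patches:
  "\<exists>c :: nat \<Rightarrow> ('n, 'm) patch. (\<forall>i. c i \<in> \<A>) \<and> (\<Union>i. snd (c i) ` fst (c i)) = UNIV"
proof -
  let ?F = "(\<lambda>c. snd c ` fst c) ` \<A>"
  obtain F where F: "F \<subseteq> ?F" "countable F" "\<Union>F = \<Union>?F"
  proof (rule Lindelof[of ?F])
    show "open S" if "S \<in> ?F" for S using that patch_open(2) by auto
  qed
  have "\<Union>?F = UNIV" using manifold unfolding smooth_atlas_def by (auto simp: case_prod_unfold)
  then have F': "\<Union>F = UNIV" "F \<noteq> {}" using F by auto
  define c where "c = (\<lambda>i. SOME c. c \<in> \<A> \<and> from_nat_into F i = snd c ` fst c)"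
  have c: "c i \<in> \<A> \<and> from_nat_into F i = snd (c i) ` fst (c i)" for i
  proof -
    have "\<exists>c. c \<in> \<A> \<and> from_nat_into F i = snd c ` fst c"
      using from_nat_into[OF F'(2), of i] F(1) by blast
    from someI_ex[OF this] show ?thesis unfolding c_def .
  qed
  have "(\<Union>i. snd (c i) ` fst (c i)) = (\<Union>i. from_nat_into F i)" using c by simp
  also have "\<dots> = UNIV" using range_from_nat_into[OF F'(2) F(2)] F'(1) by simp
  finally show ?thesis using c by blast
qed

text \<open>Each piece \<open>E i\<close> of a disjoint Borel partition lies in one patch, so the
  measure of its Borel subsets is prescribed and countable additivity forces the rest. Conversely,
  summing the prescribed values defines a measure, which is correct in every other patch because
  patch measures agree on overlaps.\<close>

lemma volume_like_ex1: "\<exists>!\<mu>. volume_like \<mu>"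
proof -
  obtain c :: "nat \<Rightarrow> ('n, 'm) patch" where c: "\<And>i. c i \<in> \<A>" and cov: "(\<Union>i. snd (c i) ` fst (c i)) = UNIV"
    using countable_patches by blast
  define E where "E = disjointed (\<lambda>i. snd (c i) ` fst (c i))"
  have E: "E i \<in> sets borel" "E i \<subseteq> snd (c i) ` fst (c i)" for i
  proof -
    have "snd (c i) ` fst (c i) \<in> sets borel" for i
      using patch_open(2)[of "fst (c i)" "snd (c i)"] c by simp
    then have "range E \<subseteq> sets borel" unfolding E_def
      by (intro sets.range_disjointed_sets) auto
    then show "E i \<in> sets borel" by auto
    show "E i \<subseteq> snd (c i) ` fst (c i)" unfolding E_def by (rule disjointed_subset)
  qed
  have Ecov: "(\<Union>i. E i) = UNIV" unfolding E_def UN_disjointed_eq by (rule cov)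
  have Edis: "disjoint_family E" unfolding E_def by (rule disjoint_family_disjointed)
  have split: "emeasure M B = (\<Sum>i. emeasure M (B \<inter> E i))" if "sets M = sets borel" "B \<in> sets borel" for M B
  proof -
    have "(\<Sum>i. emeasure M (B \<inter> E i)) = emeasure M (\<Union>i. B \<inter> E i)"
    proof (rule suminf_emeasure)
      show "disjoint_family (\<lambda>i. B \<inter> E i)" using Edis unfolding disjoint_family_on_def by blast
    qed (use E that in auto)
    also have "(\<Union>i. B \<inter> E i) = B" using Ecov by auto
    finally show ?thesis by simp
  qed
  define \<rho> where "\<rho> = (\<lambda>i. patch_measure (fst (c i)) (snd (c i)))"
  have c': "(fst (c i), snd (c i)) \<in> \<A>" for i using c by simp
  have sets\<rho>: "sets (\<rho> i) = sets borel" for i unfolding \<rho>_def using c' by simp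
  define \<mu> where "\<mu> = measure_of UNIV (sets (borel :: 'm measure)) (\<lambda>B. \<Sum>i. emeasure (\<rho> i) (B \<inter> E i))"
  have sig: "sigma_algebra UNIV (sets (borel :: 'm measure))"
    using sets.sigma_algebra_axioms[of "borel :: 'm measure"] by simp
  have sets\<mu>: "sets \<mu> = sets borel" unfolding \<mu>_def
    by (subst sets_measure_of) (use sigma_algebra.sigma_sets_eq[OF sig] in auto)
  have em: "emeasure \<mu> B = (\<Sum>i. emeasure (\<rho> i) (B \<inter> E i))" if "B \<in> sets borel" for B
    unfolding \<mu>_def
  proof (rule emeasure_measure_of_sigma[OF sig _ _ that])
    show "positive (sets borel) (\<lambda>B. \<Sum>i. emeasure (\<rho> i) (B \<inter> E i))" by (simp add: positive_def)
    show "countably_additive (sets borel) (\<lambda>B. \<Sum>i. emeasure (\<rho> i) (B \<inter> E i))"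
    proof (rule countably_additiveI)
      fix A :: "nat \<Rightarrow> 'm set" assume A: "range A \<subseteq> sets borel" "disjoint_family A"
      \<comment> \<open>The double series is interchanged by reading the sum over the pieces as an
        integral against counting measure.\<close>
      have "(\<Sum>j. \<Sum>i. emeasure (\<rho> i) (A j \<inter> E i)) = (\<Sum>i. \<Sum>j. emeasure (\<rho> i) (A j \<inter> E i))"
        unfolding nn_integral_count_space_nat[symmetric] by (subst nn_integral_count_space_nat, subst (2) nn_integral_count_space_nat, subst nn_integral_suminf[symmetric]) auto
      also have "\<dots> = (\<Sum>i. emeasure (\<rho> i) ((\<Union>j. A j) \<inter> E i))"
      proof (rule suminf_cong)
        fix i
        have "(\<Sum>j. emeasure (\<rho> i) (A j \<inter> E i)) = emeasure (\<rho> i) (\<Union>j. A j \<inter> E i)"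
        proof (rule suminf_emeasure)
          show "disjoint_family (\<lambda>j. A j \<inter> E i)" using A(2) unfolding disjoint_family_on_def by blast
        qed (use A E(1)[of i] in \<open>auto simp: sets\<rho>\<close>)
        also have "(\<Union>j. A j \<inter> E i) = (\<Union>j. A j) \<inter> E i" by blast
        finally show "(\<Sum>j. emeasure (\<rho> i) (A j \<inter> E i)) = emeasure (\<rho> i) ((\<Union>j. A j) \<inter> E i)" .
      qed
      finally show "(\<Sum>j. \<Sum>i. emeasure (\<rho> i) (A j \<inter> E i)) = (\<Sum>i. emeasure (\<rho> i) ((\<Union>j. A j) \<inter> E i))" .
    qed
  qed
  show ?thesis
  proof (rule ex1I[of _ \<mu>])
    show "volume_like \<mu>" unfolding volume_like_def
    proof (intro conjI sets\<mu> ballI, clarify)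
      fix V \<psi> B assume p: "(V, \<psi>) \<in> \<A>" and B: "B \<in> sets borel" "B \<subseteq> \<psi> ` V"
      have "emeasure (\<rho> i) (B \<inter> E i) = emeasure (patch_measure V \<psi>) (B \<inter> E i)" for i
        unfolding \<rho>_def using E[of i] B by (intro patch_measure_overlap c' p) auto
      then show "emeasure \<mu> B = emeasure (patch_measure V \<psi>) B"
        using em[OF B(1)] split[OF sets_patch_measure[OF p] B(1)] by simp
    qed
    fix \<nu> assume \<nu>: "volume_like \<nu>"
    show "\<nu> = \<mu>"
    proof (rule measure_eqI)
      show "sets \<nu> = sets \<mu>" using \<nu> sets\<mu> by (simp add: volume_like_def)
      fix B assume "B \<in> sets \<nu>"
      then have B: "B \<in> sets borel" using \<nu> by (simp add: volume_like_def)
      have "emeasure \<nu> (B \<inter> E i) = emeasure (\<rho> i) (B \<inter> E i)" for i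
        using \<nu> c'[of i] B E[of i] unfolding volume_like_def \<rho>_def by (auto simp: le_infI2)
      then show "emeasure \<nu> B = emeasure \<mu> B" using em[OF B] split[OF _ B, of \<nu>] \<nu> by (simp add: volume_like_def)
    qed
  qed
qed

lemma volume_like_riemannian_volume: "volume_like (riemannian_volume \<A> X)"
proof -
  have "(\<lambda>\<mu>. sets \<mu> = sets borel \<and> (\<forall>(V, \<psi>)\<in>\<A>. \<forall>B\<in>sets borel. B \<subseteq> \<psi> ` V \<longrightarrow>
        emeasure \<mu> B =
          (\<integral>\<^sup>+y. ennreal (sqrt (det (metric_matrix X \<psi> y))) * indicator (V \<inter> \<psi> -` B) y \<partial>lborel))) = volume_like"
    unfolding volume_like_def
    by (intro ext conj_cong refl ball_cong) (auto simp: emeasure_patch_measure vol_density_def)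
  then show ?thesis unfolding riemannian_volume_def using theI'[OF volume_like_ex1] by simp
qed

lemma sets_riemannian_volume [simp, measurable_cong]: "sets (riemannian_volume \<A> X) = sets borel"
  using volume_like_riemannian_volume by (simp add: volume_like_def)

lemma integral_patch:
  fixes h :: "'m \<Rightarrow> real"
  assumes c: "(V, \<psi>) \<in> \<A>" and [measurable]: "h \<in> borel_measurable borel"
    and h0: "\<And>p. p \<notin> \<psi> ` V \<Longrightarrow> h p = 0"
  shows "integrable (riemannian_volume \<A> X) h \<longleftrightarrow>
      integrable lborel (\<lambda>y. indicator V y * vol_density X \<psi> y * h (\<psi> y))"
    "(LINT p|riemannian_volume \<A> X. h p) = (LINT y|lborel. indicator V y * vol_density X \<psi> y * h (\<psi> y))"
proof -
  let ?\<mu> = "riemannian_volume \<A> X"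
  note [measurable] = patch_map_measurable[OF c] indicator_vol_measurable[OF c]
  have [measurable]: "\<psi> ` V \<in> sets borel" using patch_open(2)[OF c] by simp
  have eq: "density ?\<mu> (\<lambda>p. ennreal (indicator (\<psi> ` V) p)) = patch_measure V \<psi>"
  proof (rule measure_eqI)
    fix B assume "B \<in> sets (density ?\<mu> (\<lambda>p. ennreal (indicator (\<psi> ` V) p)))"
    then have B [measurable]: "B \<in> sets borel" by simp
    have "emeasure (density ?\<mu> (\<lambda>p. ennreal (indicator (\<psi> ` V) p))) B = emeasure ?\<mu> (B \<inter> \<psi> ` V)"
      by (simp add: emeasure_density ennreal_indicator Int_commute flip: indicator_inter_arith)
    also have "\<dots> = emeasure (patch_measure V \<psi>) (B \<inter> \<psi> ` V)"
      using volume_like_riemannian_volume c unfolding volume_like_def by auto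
    finally show "emeasure (density ?\<mu> (\<lambda>p. ennreal (indicator (\<psi> ` V) p))) B = emeasure (patch_measure V \<psi>) B"
      using patch_measure_Int[OF c B] by simp
  qed (simp add: c)
  have h: "indicator (\<psi> ` V) p *\<^sub>R h p = h p" for p using h0 by (auto simp: indicator_def)
  have "integrable (density ?\<mu> (\<lambda>p. ennreal (indicator (\<psi> ` V) p))) h \<longleftrightarrow> integrable ?\<mu> h"
    by (subst integrable_density) (auto simp del: real_scaleR_def simp: h)
  moreover have "integral\<^sup>L (density ?\<mu> (\<lambda>p. ennreal (indicator (\<psi> ` V) p))) h = integral\<^sup>L ?\<mu> h"
    by (subst integral_density) (auto simp del: real_scaleR_def simp: h)
  moreover have h2: "(indicator V y * vol_density X \<psi> y) *\<^sub>R h (patch_map V \<psi> y) =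
      indicator V y * vol_density X \<psi> y * h (\<psi> y)" for y by (auto simp: patch_map_def indicator_def)
  have nn: "0 \<le> indicator V y * vol_density X \<psi> y" for y
    using vol_density_pos[OF c, of y] by (auto simp: indicator_def)
  have "integrable (patch_measure V \<psi>) h \<longleftrightarrow> integrable lborel (\<lambda>y. indicator V y * vol_density X \<psi> y * h (\<psi> y))"
    unfolding patch_measure_def
    by (subst integrable_distr_eq, measurable, subst integrable_density) (auto simp del: real_scaleR_def simp: h2 nn)
  moreover have "integral\<^sup>L (patch_measure V \<psi>) h = (LINT y|lborel. indicator V y * vol_density X \<psi> y * h (\<psi> y))"
    unfolding patch_measure_def
    by (subst integral_distr, measurable, subst integral_density) (auto simp del: real_scaleR_def simp: h2 nn)
  ultimately show "integrable ?\<mu> h \<longleftrightarrow> integrable lborel (\<lambda>y. indicator V y * vol_density X \<psi> y * h (\<psi> y))"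
    "(LINT p|?\<mu>. h p) = (LINT y|lborel. indicator V y * vol_density X \<psi> y * h (\<psi> y))"
    unfolding eq by auto
qed

end

section \<open>The Laplacian\<close>

text \<open>The coordinate second derivative, not the covariant Hessian; the outer differentiation
  is in direction \<open>v\<close>. It is therefore not tensorial under a change of patch.\<close>

abbreviation hess :: "(real^'n \<Rightarrow> 'b::real_normed_vector) \<Rightarrow> real^'n \<Rightarrow> real^'n \<Rightarrow> real^'n \<Rightarrow> 'b" where
  "hess f y v w \<equiv> D (\<lambda>z. D f z w) y v"

lemma linear_mult_right: "linear f \<Longrightarrow> linear (\<lambda>v. f v * (r :: real))"
  by (rule linearI) (simp_all add: linear_add linear_cmul algebra_simps)

lemma linear_mult_left: "linear f \<Longrightarrow> linear (\<lambda>v. (r :: real) * f v)"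
  by (rule linearI) (simp_all add: linear_add linear_cmul algebra_simps)

text \<open>Linearity in \<open>v\<close> is that of a derivative. In \<open>w\<close> it comes from
  expanding \<open>D G z w\<close> near \<open>y\<close> and differentiating the expansion.\<close>

lemma hess_expand:
  fixes G :: "real^'n \<Rightarrow> 'b::real_normed_vector"
  assumes "open S" "C2_on S G" "y \<in> S"
  shows "hess G y v w = (\<Sum>b\<in>Basis. (w \<bullet> b) *\<^sub>R hess G y v b)"
proof -
  have "D (\<lambda>z. D G z w) y = D (\<lambda>z. \<Sum>b\<in>Basis. (w \<bullet> b) *\<^sub>R D G z b) y"
    by (rule D_cong_open[OF assms(1,3)]) (rule D_expand, use assms in \<open>auto simp: C2_on_def C1_on_def\<close>)
  moreover have "((\<lambda>z. \<Sum>b\<in>Basis. (w \<bullet> b) *\<^sub>R D G z b) has_derivative (\<lambda>v. \<Sum>b\<in>Basis. (w \<bullet> b) *\<^sub>R hess G y v b)) (at y)"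
    by (intro has_derivative_sum has_derivative_scaleR_right has_D) (use assms in \<open>auto simp: C2_on_def C1_on_def\<close>)
  ultimately show ?thesis by (simp add: D_eqI)
qed

lemma hess_linear:
  assumes "open S" "C2_on S G" "y \<in> S"
  shows "linear (\<lambda>v. hess G y v w)" "linear (hess G y v)"
proof -
  show "linear (\<lambda>v. hess G y v w)" using assms by (intro D_linear) (auto simp: C2_on_def C1_on_def)
  show "linear (hess G y v)"
  proof -
    have "hess G y v = (\<lambda>w. \<Sum>b\<in>Basis. (w \<bullet> b) *\<^sub>R hess G y v b)"
      by (rule ext) (rule hess_expand[OF assms])
    moreover have "linear (\<lambda>w. \<Sum>b\<in>Basis. (w \<bullet> b) *\<^sub>R hess G y v b)"
      by (rule linearI) (simp_all add: inner_add_left scaleR_add_left sum.distrib scaleR_sum_right)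
    ultimately show ?thesis using arg_cong[of _ _ linear] by blast
  qed
qed

text \<open>The second-order chain rule. The term with \<open>hess \<tau>\<close> is the
  non-tensorial part, which the correction vector in the Laplacian must absorb.\<close>

lemma hess_compose:
  fixes G :: "real^'n \<Rightarrow> 'b::real_normed_vector" and \<tau> :: "real^'n \<Rightarrow> real^'n"
  assumes O: "open O'" "y \<in> O'" and \<tau>: "C2_on O' \<tau>" and S: "open S" "\<tau> ` O' \<subseteq> S" and G: "C2_on S G"
  shows "hess (\<lambda>z. G (\<tau> z)) y v w = hess G (\<tau> y) (D \<tau> y v) (D \<tau> y w) + D G (\<tau> y) (hess \<tau> y v w)"
proof -
  have d\<tau>: "\<tau> differentiable (at z)" "(\<lambda>z. D \<tau> z u) differentiable (at z)" if "z \<in> O'" for z u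
    using \<tau> that by (auto simp: C2_on_def C1_on_def)
  have dG: "G differentiable (at (\<tau> z))" "(\<lambda>z. D G z u) differentiable (at (\<tau> z))" if "z \<in> O'" for z u
    using G S(2) that by (auto simp: C2_on_def C1_on_def image_subset_iff)
  have "D (\<lambda>z. D (\<lambda>z. G (\<tau> z)) z w) y = D (\<lambda>z. \<Sum>b\<in>Basis. (D \<tau> z w \<bullet> b) *\<^sub>R D G (\<tau> z) b) y"
  proof (rule D_cong_open[OF O])
    fix z assume z: "z \<in> O'"
    show "D (\<lambda>z. G (\<tau> z)) z w = (\<Sum>b\<in>Basis. (D \<tau> z w \<bullet> b) *\<^sub>R D G (\<tau> z) b)"
      unfolding D_compose[OF dG(1)[OF z] d\<tau>(1)[OF z]] by (rule D_expand[OF dG(1)[OF z]])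
  qed
  moreover have "((\<lambda>z. \<Sum>b\<in>Basis. (D \<tau> z w \<bullet> b) *\<^sub>R D G (\<tau> z) b) has_derivative
     (\<lambda>v. \<Sum>b\<in>Basis. (D \<tau> y w \<bullet> b) *\<^sub>R hess G (\<tau> y) (D \<tau> y v) b + (hess \<tau> y v w \<bullet> b) *\<^sub>R D G (\<tau> y) b)) (at y)"
    by (intro has_derivative_sum has_derivative_scaleR has_derivative_inner_left
        has_derivative_compose[OF has_D[OF d\<tau>(1)[OF O(2)]] has_D[OF dG(2)[OF O(2)]]] has_D d\<tau> O)
  ultimately have "hess (\<lambda>z. G (\<tau> z)) y v w =
     (\<Sum>b\<in>Basis. (D \<tau> y w \<bullet> b) *\<^sub>R hess G (\<tau> y) (D \<tau> y v) b) + (\<Sum>b\<in>Basis. (hess \<tau> y v w \<bullet> b) *\<^sub>R D G (\<tau> y) b)"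
    by (simp add: D_eqI sum.distrib)
  also have "\<dots> = hess G (\<tau> y) (D \<tau> y v) (D \<tau> y w) + D G (\<tau> y) (hess \<tau> y v w)"
  proof -
    have "\<tau> y \<in> S" using S(2) O(2) by auto
    then have "hess G (\<tau> y) (D \<tau> y v) (D \<tau> y w) = (\<Sum>b\<in>Basis. (D \<tau> y w \<bullet> b) *\<^sub>R hess G (\<tau> y) (D \<tau> y v) b)"
      by (rule hess_expand[OF S(1) G])
    moreover have "D G (\<tau> y) (hess \<tau> y v w) = (\<Sum>b\<in>Basis. (hess \<tau> y v w \<bullet> b) *\<^sub>R D G (\<tau> y) b)"
      by (rule D_expand[OF dG(1)[OF O(2)]])
    ultimately show ?thesis by (simp only:)
  qed
  finally show ?thesis .
qed

text \<open>The frame gives the orthogonal projection explicitly. It serves both for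
  \<open>W\<close> and for the trace of the second derivatives of the immersion.\<close>

lemma tangential_component_exists:
  fixes J :: "real^'n \<Rightarrow> real^'k"
  assumes J: "linear J" and e: "orthonormal_for J e"
  shows "(T - J (\<Sum>k\<in>UNIV. (T \<bullet> J (e k)) *\<^sub>R e k)) \<bullet> J w = 0"
proof -
  have "T \<bullet> J w = T \<bullet> J (\<Sum>k\<in>UNIV. (J w \<bullet> J (e k)) *\<^sub>R e k)" by (simp only: frame_expand[OF J e, symmetric])
  then show ?thesis using J
    by (simp add: linear_sum linear_cmul inner_sum_right inner_sum_left inner_diff_left inner_commute[of "J w"] mult.commute)
qed

text \<open>The image of the difference of two candidates is orthogonal to itself, and
  \<open>J\<close> is injective.\<close>

lemma tangential_component_unique:
  fixes J :: "real^'n \<Rightarrow> real^'k"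
  assumes J: "linear J" "inj J" and "\<And>w. (T - J c) \<bullet> J w = 0" "\<And>w. (T - J c') \<bullet> J w = 0"
  shows "c = c'"
proof -
  have "J (c - c') \<bullet> J (c - c') = (T - J c') \<bullet> J (c - c') - (T - J c) \<bullet> J (c - c')"
    using J by (simp add: linear_diff inner_diff_left)
  then have "J (c - c') = 0" unfolding assms(3,4) by simp
  then have "J c = J c'" using J by (simp add: linear_diff)
  then show ?thesis using J by (simp add: inj_eq)
qed

context smooth_immersed
begin

context
  fixes V and \<psi>
  assumes c: "(V, \<psi>) \<in> \<A>"
begin

lemma D_metric:
  assumes y: "y \<in> V"
  shows "((\<lambda>z. metric_matrix X \<psi> z $ i $ j) has_derivative
    (\<lambda>v. hess (X \<circ> \<psi>) y v (axis i 1) \<bullet> D (X \<circ> \<psi>) y (axis j 1) + D (X \<circ> \<psi>) y (axis i 1) \<bullet> hess (X \<circ> \<psi>) y v (axis j 1))) (at y)"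
proof -
  have d: "((\<lambda>z. D (X \<circ> \<psi>) z u) has_derivative (\<lambda>v. hess (X \<circ> \<psi>) y v u)) (at y)" for u
    using C1_on_has[OF C2_on_D[OF patch_C2[OF c]] y] .
  show ?thesis unfolding metric_matrix_def pd_def vec_lambda_beta
    by (rule has_derivative_eq_rhs[OF has_derivative_inner[OF d d]]) (simp add: fun_eq_iff add.commute)
qed

lemma metric_inverse:
  assumes y: "y \<in> V"
  shows "matrix_inv (metric_matrix X \<psi> y) ** metric_matrix X \<psi> y = mat 1"
    "matrix_inv (metric_matrix X \<psi> y) $ i $ j = matrix_inv (metric_matrix X \<psi> y) $ j $ i"
  unfolding metric_matrix_gram
  by (intro gram_inverse matrix_inv_gram_sym patch_linear[OF c y] patch_D_inj[OF c y])+

text \<open>Jacobi's formula under the square root. The derivative of \<open>g_{ij}\<close> has two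
  terms with equal traces because \<open>g^{ij}\<close> is symmetric, and the resulting factor 2
  cancels the one half from the root.\<close>

lemma D_vol_density:
  assumes y: "y \<in> V"
  shows "D (vol_density X \<psi>) y v = vol_density X \<psi> y *
    (\<Sum>i\<in>UNIV. \<Sum>j\<in>UNIV. matrix_inv (metric_matrix X \<psi> y) $ i $ j * (hess (X \<circ> \<psi>) y v (axis i 1) \<bullet> D (X \<circ> \<psi>) y (axis j 1)))"
    (is "_ = _ * ?T")
proof -
  let ?g = "metric_matrix X \<psi>" and ?x = "X \<circ> \<psi>"
  let ?gi = "matrix_inv (?g y)"
  let ?S = "\<lambda>v. (\<Sum>i\<in>UNIV. \<Sum>j\<in>UNIV. ?gi $ j $ i *
      (hess ?x y v (axis i 1) \<bullet> D ?x y (axis j 1) + D ?x y (axis i 1) \<bullet> hess ?x y v (axis j 1)))"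
  have pos: "det (?g y) > 0" by (rule metric_det_pos[OF c y])
  have "((\<lambda>z. det (?g z)) has_derivative (\<lambda>v. det (?g y) * ?S v)) (at y)"
    by (rule has_derivative_det[OF D_metric[OF y] metric_inverse(1)[OF y]])
  then have "((\<lambda>z. sqrt (det (?g z))) has_derivative (\<lambda>v. (det (?g y) * ?S v) * (inverse (sqrt (det (?g y))) / 2))) (at y)"
    by (rule has_derivative_real_sqrt[where g = "\<lambda>z. det (?g z)", OF pos])
  then have "D (vol_density X \<psi>) y v = (det (?g y) * ?S v) * (inverse (sqrt (det (?g y))) / 2)"
    unfolding vol_density_def[abs_def] by (simp only: D_eqI)
  also have "\<dots> = sqrt (det (?g y)) * (?S v / 2)"
  proof -
    have "(d * s) * (inverse (sqrt d) / 2) = sqrt d * (s / 2)" if "d > 0" for d s :: real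
      using that by (simp add: field_simps)
    then show ?thesis using pos by blast
  qed
  also have "?S v = 2 * ?T"
  proof -
    have "?S v = (\<Sum>i\<in>UNIV. \<Sum>j\<in>UNIV. ?gi $ i $ j * (hess ?x y v (axis i 1) \<bullet> D ?x y (axis j 1))) +
       (\<Sum>i\<in>UNIV. \<Sum>j\<in>UNIV. ?gi $ j $ i * (hess ?x y v (axis j 1) \<bullet> D ?x y (axis i 1)))"
      using metric_inverse(2)[OF y]
      by (simp add: distrib_left sum.distrib inner_commute)
    also have "(\<Sum>i\<in>UNIV. \<Sum>j\<in>UNIV. ?gi $ j $ i * (hess ?x y v (axis j 1) \<bullet> D ?x y (axis i 1))) = ?T"
      by (rule sum.swap)
    finally show ?thesis by (simp only: mult_2)
  qed
  finally show ?thesis unfolding vol_density_def[of X \<psi> y] by (simp only: nonzero_mult_div_cancel_left[of "2::real"] zero_neq_numeral[symmetric] not_False_eq_True simp_thms)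
qed

text \<open>
  The vector a has components g^{ij} Gamma_{ij}^k: its image is the tangential part of the metric
  trace of the second derivative of the immersion. In this form the Laplacian no longer contains
  derivatives of the metric, and under a change of patch the second derivatives of the transition
  map cancel between the two terms.
\<close>

lemma patch_laplacian_trace:
  assumes y: "y \<in> V" and f: "C2_on V (f \<circ> \<psi>)" and e: "orthonormal_for (D (X \<circ> \<psi>) y) e"
    and a: "\<And>w. ((\<Sum>k\<in>UNIV. hess (X \<circ> \<psi>) y (e k) (e k)) - D (X \<circ> \<psi>) y a) \<bullet> D (X \<circ> \<psi>) y w = 0"
  shows "patch_laplacian X \<psi> f y = (\<Sum>k\<in>UNIV. hess (f \<circ> \<psi>) y (e k) (e k)) - D (f \<circ> \<psi>) y a"
proof -
  define x where "x = X \<circ> \<psi>"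
  define \<phi> where "\<phi> = f \<circ> \<psi>"
  define q where "q = vol_density X \<psi>"
  define g where "g = metric_matrix X \<psi>"
  define gi where "gi = (\<lambda>z. matrix_inv (g z))"
  define J where "J = D x y"
  define E where "E = (\<lambda>i. axis i (1::real) :: real^'n)"
  have oV: "open V" by (rule patch_open[OF c])
  have J: "linear J" "inj J" unfolding J_def x_def by (intro patch_linear[OF c y] patch_D_inj[OF c y])+
  have gJ: "g y = gram J" by (simp add: g_def J_def x_def metric_matrix_gram)
  have q0: "q y > 0" unfolding q_def by (rule vol_density_pos[OF c y])
  have e': "orthonormal_for J e" using e by (simp add: J_def x_def)
  have x2: "C2_on V x" unfolding x_def by (rule patch_C2[OF c])
  have \<phi>2: "C2_on V \<phi>" unfolding \<phi>_def by (rule f)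
  have qd: "q differentiable (at y)" unfolding q_def by (rule C1_on_differentiable[OF vol_density_C1[OF c] y])
  have gid: "(\<lambda>z. gi z $ i $ j) differentiable (at y)" for i j
    unfolding gi_def g_def by (rule C1_on_differentiable[OF inverse_metric_C1[OF c] y])
  have gd: "(\<lambda>z. g z $ i $ j) differentiable (at y)" for i j
    unfolding g_def by (rule C1_on_differentiable[OF metric_C1[OF c] y])
  have \<phi>d: "(\<lambda>z. D \<phi> z w) differentiable (at y)" for w by (rule C1_on_differentiable[OF C2_on_D[OF \<phi>2] y])
  define P where "P = (\<lambda>i j z. q z * gi z $ i $ j)"
  have Pd: "P i j differentiable (at y)" for i j unfolding P_def by (intro differentiable_mult qd gid)
  have symm: "hess x y (E k) (E i) = hess x y (E i) (E k)" for i k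
    by (rule second_derivative_symmetric[OF oV y x2])
  have prodD: "D (\<lambda>z. u z * w z) y v = u y * D w y v + D u y v * w y"
    if "u differentiable (at y)" "w differentiable (at y)" for u w :: "real^'n \<Rightarrow> real" and v
    using D_eqI[OF has_derivative_mult[OF has_D[OF that(1)] has_D[OF that(2)]]] by simp
  have sumD: "D (\<lambda>z. \<Sum>j\<in>UNIV. F j z) y v = (\<Sum>j\<in>UNIV. D (F j) y v)"
    if "\<And>j. F j differentiable (at y)" for F :: "'n \<Rightarrow> real^'n \<Rightarrow> real" and v
    using D_eqI[OF has_derivative_sum[of UNIV F "\<lambda>j. D (F j) y"]] has_D[OF that] by simp

  \<comment> \<open>The divergence \<open>d_i (sqrt G g^{ij})\<close>, the coefficient of the first
    derivatives of \<open>f\<close>. It turns out to be \<open>- sqrt G\<close> times component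
    \<open>j\<close> of the vector \<open>a\<close>.\<close>
  define B where "B = (\<lambda>j. \<Sum>i\<in>UNIV. D (P i j) y (E i))"
  have lap: "patch_laplacian X \<psi> f y * q y = q y * (\<Sum>i\<in>UNIV. \<Sum>j\<in>UNIV. gi y $ i $ j * hess \<phi> y (E i) (E j)) +
      (\<Sum>j\<in>UNIV. B j * D \<phi> y (E j))"
  proof -
    have "patch_laplacian X \<psi> f y * q y = (\<Sum>i\<in>UNIV. D (\<lambda>z. q z * (\<Sum>j\<in>UNIV. gi z $ i $ j * D \<phi> z (E j))) y (E i))"
      using q0 by (simp add: patch_laplacian_def pd_def q_def vol_density_def[abs_def] gi_def g_def \<phi>_def E_def)
    also have "\<dots> = (\<Sum>i\<in>UNIV. D (\<lambda>z. \<Sum>j\<in>UNIV. P i j z * D \<phi> z (E j)) y (E i))"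
      by (simp add: P_def sum_distrib_left mult.assoc)
    also have "\<dots> = (\<Sum>i\<in>UNIV. \<Sum>j\<in>UNIV. P i j y * hess \<phi> y (E i) (E j) + D (P i j) y (E i) * D \<phi> y (E j))"
      by (simp add: sumD prodD Pd \<phi>d differentiable_mult)
    also have "\<dots> = (\<Sum>i\<in>UNIV. \<Sum>j\<in>UNIV. P i j y * hess \<phi> y (E i) (E j)) + (\<Sum>j\<in>UNIV. B j * D \<phi> y (E j))"
      unfolding B_def sum.distrib sum_distrib_right by (rule arg_cong2[where f="(+)", OF refl sum.swap])
    finally show ?thesis by (simp add: P_def sum_distrib_left mult.assoc)
  qed
  have tr: "(\<Sum>k\<in>UNIV. hess h y (e k) (e k)) = (\<Sum>i\<in>UNIV. \<Sum>j\<in>UNIV. gi y $ i $ j *\<^sub>R hess h y (E i) (E j))"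
    if "C2_on V h" for h :: "real^'n \<Rightarrow> 'b::real_normed_vector"
    unfolding gi_def gJ E_def
    by (rule frame_trace[of J e "hess h y", OF J(1) e' hess_linear[OF oV that y]])

  \<comment> \<open>Obtained by differentiating
    \<open>sqrt G g^{ij} g_{jk} = sqrt G \<delta>_{ik}\<close>, which avoids a formula for the
    derivative of the inverse metric.\<close>
  have key: "(\<Sum>j\<in>UNIV. B j * g y $ j $ k) = - q y * ((\<Sum>l\<in>UNIV. hess x y (e l) (e l)) \<bullet> J (E k))" for k
  proof -
    have "(\<Sum>i\<in>UNIV. \<Sum>j\<in>UNIV. P i j y * D (\<lambda>z. g z $ j $ k) y (E i) + D (P i j) y (E i) * g y $ j $ k) =
        (\<Sum>i\<in>UNIV. D (\<lambda>z. \<Sum>j\<in>UNIV. P i j z * g z $ j $ k) y (E i))"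
      by (simp add: sumD prodD Pd gd differentiable_mult)
    also have "\<dots> = (\<Sum>i\<in>UNIV. if i = k then D q y (E i) else 0)"
    proof (rule sum.cong[OF refl])
      fix i
      have "(\<Sum>j\<in>UNIV. P i j z * g z $ j $ k) = q z * (if i = k then 1 else 0)" if "z \<in> V" for z
      proof -
        have "(\<Sum>j\<in>UNIV. P i j z * g z $ j $ k) = q z * (gi z ** g z) $ i $ k"
          by (simp add: P_def matrix_matrix_mult_def sum_distrib_left mult.assoc)
        then show ?thesis using metric_inverse(1)[OF that] by (simp add: gi_def g_def mat_def)
      qed
      then have "D (\<lambda>z. \<Sum>j\<in>UNIV. P i j z * g z $ j $ k) y = D (\<lambda>z. q z * (if i = k then 1 else 0)) y"
        by (intro D_cong_open[OF oV y])
      then show "D (\<lambda>z. \<Sum>j\<in>UNIV. P i j z * g z $ j $ k) y (E i) = (if i = k then D q y (E i) else 0)"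
        by simp
    qed
    also have "\<dots> = D q y (E k)" by simp
    also have "\<dots> = q y * (\<Sum>i\<in>UNIV. \<Sum>j\<in>UNIV. gi y $ i $ j * (hess x y (E k) (E i) \<bullet> J (E j)))"
      using D_vol_density[OF y, of "E k"] unfolding q_def gi_def g_def x_def J_def E_def .
    finally have 1: "(\<Sum>i\<in>UNIV. \<Sum>j\<in>UNIV. P i j y * D (\<lambda>z. g z $ j $ k) y (E i)) + (\<Sum>i\<in>UNIV. \<Sum>j\<in>UNIV. D (P i j) y (E i) * g y $ j $ k)
       = q y * (\<Sum>i\<in>UNIV. \<Sum>j\<in>UNIV. gi y $ i $ j * (hess x y (E k) (E i) \<bullet> J (E j)))" by (simp add: sum.distrib)
    \<comment> \<open>Symmetry of second derivatives puts the second term into the form that occurs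
      in the derivative of \<open>sqrt G\<close>, so that these contributions cancel and only the
      trace of the second derivatives remains.\<close>
    have "D (\<lambda>z. g z $ j $ k) y (E i) = hess x y (E i) (E j) \<bullet> J (E k) + hess x y (E k) (E i) \<bullet> J (E j)" for i j
      using D_eqI[OF D_metric[OF y, of j k]] symm[of k i] unfolding g_def x_def J_def E_def by (simp add: inner_commute)
    then have 2: "(\<Sum>i\<in>UNIV. \<Sum>j\<in>UNIV. P i j y * D (\<lambda>z. g z $ j $ k) y (E i)) =
      q y * (\<Sum>i\<in>UNIV. \<Sum>j\<in>UNIV. gi y $ i $ j * (hess x y (E i) (E j) \<bullet> J (E k))) +
      q y * (\<Sum>i\<in>UNIV. \<Sum>j\<in>UNIV. gi y $ i $ j * (hess x y (E k) (E i) \<bullet> J (E j)))"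
      by (simp add: P_def sum_distrib_left distrib_left sum.distrib mult.assoc)
    have 3: "(\<Sum>j\<in>UNIV. B j * g y $ j $ k) = (\<Sum>i\<in>UNIV. \<Sum>j\<in>UNIV. D (P i j) y (E i) * g y $ j $ k)"
      unfolding B_def sum_distrib_right by (rule sum.swap)
    show ?thesis using 1 2 3 by (simp add: tr[OF x2] inner_sum_left)
  qed
  \<comment> \<open>\<open>key\<close> says that the vector on the right also represents the
    tangential part of the trace, and that representation is unique.\<close>
  have "a = - (\<chi> j. B j / q y)"
  proof (rule tangential_component_unique[OF J])
    let ?T = "\<Sum>k\<in>UNIV. hess x y (e k) (e k)"
    show "(?T - J a) \<bullet> J w = 0" for w using a unfolding x_def J_def .
    show "(?T - J (- (\<chi> j. B j / q y))) \<bullet> J w = 0" for w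
    proof -
      have "(?T - J (- (\<chi> j. B j / q y))) \<bullet> J (E k) = 0" for k
      proof -
        have "J (- (\<chi> j. B j / q y)) = - (\<Sum>j\<in>UNIV. (B j / q y) *\<^sub>R J (E j))"
          using J by (simp add: linear_neg) (subst linear_vec_expand[OF J(1)], simp add: E_def)
        then have "(?T - J (- (\<chi> j. B j / q y))) \<bullet> J (E k) = ?T \<bullet> J (E k) + (\<Sum>j\<in>UNIV. B j * g y $ j $ k) / q y"
          by (simp add: inner_diff_left inner_sum_left gJ gram_def E_def sum_divide_distrib inner_add_left)
        then show ?thesis using q0 by (simp add: key)
      qed
      then show ?thesis by (subst linear_vec_expand[OF J(1)]) (simp add: inner_sum_right E_def)
    qed
  qed
  moreover have "linear (D \<phi> y)" by (rule D_linear[OF C1_on_differentiable[OF C2_on_C1[OF \<phi>2] y]])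
  ultimately have "D \<phi> y a = - (\<Sum>j\<in>UNIV. B j * D \<phi> y (E j)) / q y"
    by (simp add: linear_neg) (subst linear_vec_expand, assumption, simp add: E_def sum_divide_distrib)
  then have "q y * D \<phi> y a = - (\<Sum>j\<in>UNIV. B j * D \<phi> y (E j))" using q0 by simp
  then have "q y * patch_laplacian X \<psi> f y =
      q y * ((\<Sum>i\<in>UNIV. \<Sum>j\<in>UNIV. gi y $ i $ j * hess \<phi> y (E i) (E j)) - D \<phi> y a)"
    using lap by (simp add: right_diff_distrib mult.commute[of "patch_laplacian X \<psi> f y"])
  then have "patch_laplacian X \<psi> f y = (\<Sum>i\<in>UNIV. \<Sum>j\<in>UNIV. gi y $ i $ j * hess \<phi> y (E i) (E j)) - D \<phi> y a"
    using q0 by simp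
  then show ?thesis unfolding \<phi>_def[symmetric] tr[OF \<phi>2] by simp
qed

lemma frame_exists:
  assumes "y \<in> V" shows "\<exists>e. orthonormal_for (D (X \<circ> \<psi>) y) e"
  using orthonormal_for_exists patch_linear[OF c assms] patch_D_inj[OF c assms] by metis

end

section \<open>Change of patch\<close>

context
  fixes V \<psi> V' \<psi>' y y'
  assumes c: "(V, \<psi>) \<in> \<A>" and c': "(V', \<psi>') \<in> \<A>" and y: "y \<in> V" and y': "y' \<in> V'" and eq: "\<psi> y = \<psi>' y'"
begin

private abbreviation "\<tau> \<equiv> transition V' \<psi>' \<psi>"
private abbreviation "ov \<equiv> V \<inter> \<psi> -` (\<psi>' ` V')"

lemma overlap_point: "y \<in> ov" "\<tau> y = y'"
  using y y' eq transition_eq[OF c c' y y' eq] by auto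

lemma D_patch_change:
  assumes "(F \<circ> \<psi>') differentiable (at y')"
  shows "D (F \<circ> \<psi>) y v = D (F \<circ> \<psi>') y' (D \<tau> y v)"
  using D_transition[OF c c' overlap_point(1)] assms by (simp add: overlap_point(2))

lemma immersion_differentiable: "(X \<circ> \<psi>') differentiable (at y')"
  by (rule C1_on_differentiable[OF C2_on_C1[OF patch_C2[OF c']] y'])

lemma D_transition_linear: "linear (D \<tau> y)"
  by (rule D_linear[OF C1_on_differentiable[OF C2_on_C1[OF transition_C2[OF c c']] overlap_point(1)]])

text \<open>Followed by the differential of \<open>X \<circ> \<psi>'\<close> this map becomes the
  injective differential of \<open>X \<circ> \<psi>\<close>; in equal dimensions injectivity gives
  surjectivity. Hence every direction in the second patch is the image of one in the first.\<close>

lemma D_transition_surj: "surj (D \<tau> y)"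
proof -
  have "inj (D \<tau> y)"
    using patch_D_inj[OF c y] D_patch_change[OF immersion_differentiable] by (metis injD injI)
  then show ?thesis using D_transition_linear linear_injective_imp_surjective by blast
qed

lemma frame_patch_change:
  assumes "orthonormal_for (D (X \<circ> \<psi>) y) e"
  shows "orthonormal_for (D (X \<circ> \<psi>') y') (\<lambda>k. D \<tau> y (e k))"
  using assms by (simp add: orthonormal_for_def D_patch_change[OF immersion_differentiable])

lemma hess_patch_change:
  fixes F :: "'m \<Rightarrow> 'b::real_normed_vector"
  assumes "C2_on V' (F \<circ> \<psi>')"
  shows "hess (F \<circ> \<psi>) y v w = hess (F \<circ> \<psi>') y' (D \<tau> y v) (D \<tau> y w) + D (F \<circ> \<psi>') y' (hess \<tau> y v w)"
proof -
  let ?G = "\<lambda>z. (F \<circ> \<psi>') (\<tau> z)"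
  have "D (F \<circ> \<psi>) z = D ?G z" if "z \<in> ov" for z
    using transition_compose[OF c c'] by (intro D_cong_open[OF overlap_open[OF c c'] that])
  then have "D (\<lambda>z. D (F \<circ> \<psi>) z w) y = D (\<lambda>z. D ?G z w) y"
    by (intro D_cong_open[OF overlap_open[OF c c'] overlap_point(1)]) (simp only:)
  then have "hess (F \<circ> \<psi>) y v w = hess ?G y v w" by (simp only:)
  also have "\<dots> = hess (F \<circ> \<psi>') y' (D \<tau> y v) (D \<tau> y w) + D (F \<circ> \<psi>') y' (hess \<tau> y v w)"
    unfolding overlap_point(2)[symmetric]
    by (rule hess_compose[OF overlap_open[OF c c'] overlap_point(1) transition_C2[OF c c'] patch_open(1)[OF c'] _ assms])
      (use transition_in[OF c c'] in auto)
  finally show ?thesis .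
qed

lemma patch_laplacian_change:
  assumes f: "C2_on V (f \<circ> \<psi>)" "C2_on V' (f \<circ> \<psi>')"
  shows "patch_laplacian X \<psi> f y = patch_laplacian X \<psi>' f y'"
proof -
  obtain e where e: "orthonormal_for (D (X \<circ> \<psi>) y) e" using frame_exists[OF c y] by blast
  define T where "T = (\<Sum>k\<in>UNIV. hess (X \<circ> \<psi>) y (e k) (e k))"
  define a where "a = (\<Sum>k\<in>UNIV. (T \<bullet> D (X \<circ> \<psi>) y (e k)) *\<^sub>R e k)"
  have a: "(T - D (X \<circ> \<psi>) y a) \<bullet> D (X \<circ> \<psi>) y w = 0" for w
    unfolding a_def by (rule tangential_component_exists[OF patch_linear[OF c y] e])
  \<comment> \<open>The trace of the second derivatives of the transition map, the inhomogeneous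
    term in every transformed trace. Applied to \<open>X\<close> it shows that
    \<open>D \<tau> y a - r\<close> is the correction vector in the second patch; applied to
    \<open>f\<close> it produces the same \<open>r\<close>, and the two cancel.\<close>
  define r where "r = (\<Sum>k\<in>UNIV. hess \<tau> y (e k) (e k))"
  define T' where "T' = (\<Sum>k\<in>UNIV. hess (X \<circ> \<psi>') y' (D \<tau> y (e k)) (D \<tau> y (e k)))"
  have tr: "(\<Sum>k\<in>UNIV. hess (F \<circ> \<psi>) y (e k) (e k)) =
      (\<Sum>k\<in>UNIV. hess (F \<circ> \<psi>') y' (D \<tau> y (e k)) (D \<tau> y (e k))) + D (F \<circ> \<psi>') y' r"
    if F: "C2_on V' (F \<circ> \<psi>')" for F :: "'m \<Rightarrow> 'b::real_normed_vector"
  proof -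
    have "linear (D (F \<circ> \<psi>') y')" by (rule D_linear[OF C1_on_differentiable[OF C2_on_C1[OF F] y']])
    then show ?thesis by (simp add: hess_patch_change[OF F] sum.distrib r_def linear_sum)
  qed
  have "(T' - D (X \<circ> \<psi>') y' (D \<tau> y a - r)) \<bullet> D (X \<circ> \<psi>') y' w' = 0" for w'
  proof -
    obtain w where w: "w' = D \<tau> y w" using D_transition_surj by (metis surjD)
    have "T' - D (X \<circ> \<psi>') y' (D \<tau> y a - r) = T - D (X \<circ> \<psi>) y a"
      using tr[OF patch_C2[OF c']] patch_linear[OF c' y'] D_patch_change[OF immersion_differentiable, of a]
      by (simp add: T_def T'_def linear_diff)
    then show ?thesis using a[of w] D_patch_change[OF immersion_differentiable, of w] by (simp add: w)
  qed
  then have "patch_laplacian X \<psi>' f y' =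
      (\<Sum>k\<in>UNIV. hess (f \<circ> \<psi>') y' (D \<tau> y (e k)) (D \<tau> y (e k))) - D (f \<circ> \<psi>') y' (D \<tau> y a - r)"
    unfolding T'_def by (intro patch_laplacian_trace[OF c' y' f(2) frame_patch_change[OF e]])
  also have "\<dots> = (\<Sum>k\<in>UNIV. hess (f \<circ> \<psi>) y (e k) (e k)) - D (f \<circ> \<psi>) y a"
    using tr[OF f(2)] D_patch_change[OF C1_on_differentiable[OF C2_on_C1[OF f(2)] y'], of a]
      D_linear[OF C1_on_differentiable[OF C2_on_C1[OF f(2)] y']]
    by (simp add: linear_diff)
  also have "\<dots> = patch_laplacian X \<psi> f y"
    by (rule patch_laplacian_trace[OF c y f(1) e a[unfolded T_def], symmetric])
  finally show ?thesis by simp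
qed

end

text \<open>This is \<open>Delta X = - H \<nu>\<close> paired with \<open>W\<close>: removing the
  tangential part of the trace of second derivatives leaves a normal vector, whose length is the
  trace of the second fundamental form.\<close>

lemma patch_laplacian_coordinate:
  assumes codim: "CARD('k) = CARD('n) + 1"
    and c: "(V, \<psi>) \<in> \<A>" and y: "y \<in> V" and e: "orthonormal_for (D (X \<circ> \<psi>) y) e"
    and O: "open O'" "y \<in> O'" "O' \<subseteq> V"
    and N: "N differentiable (at y)" "\<And>z v. z \<in> O' \<Longrightarrow> N z \<bullet> D (X \<circ> \<psi>) z v = 0" "norm (N y) = 1"
    and H: "(\<Sum>k\<in>UNIV. D N y (e k) \<bullet> D (X \<circ> \<psi>) y (e k)) = h"
  shows "patch_laplacian X \<psi> (\<lambda>p. X p \<bullet> W) y = - h * (N y \<bullet> W)"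
proof -
  let ?x = "X \<circ> \<psi>"
  define T where "T = (\<Sum>k\<in>UNIV. hess ?x y (e k) (e k))"
  define a where "a = (\<Sum>k\<in>UNIV. (T \<bullet> D ?x y (e k)) *\<^sub>R e k)"
  have a: "(T - D ?x y a) \<bullet> D ?x y w = 0" for w
    unfolding a_def by (rule tangential_component_exists[OF patch_linear[OF c y] e])
  have oV: "open V" by (rule patch_open[OF c])
  have x2: "C2_on V ?x" by (rule patch_C2[OF c])
  have eq: "(\<lambda>p. X p \<bullet> W) \<circ> \<psi> = (\<lambda>z. ?x z \<bullet> W)" by auto
  have "patch_laplacian X \<psi> (\<lambda>p. X p \<bullet> W) y = (\<Sum>k\<in>UNIV. hess (\<lambda>z. ?x z \<bullet> W) y (e k) (e k)) - D (\<lambda>z. ?x z \<bullet> W) y a"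
    using patch_laplacian_trace[OF c y _ e a[unfolded T_def], of "\<lambda>p. X p \<bullet> W"] C2_on_inner_const[OF oV x2]
    unfolding eq by blast
  also have "\<dots> = (T - D ?x y a) \<bullet> W"
    using D2_inner_const[OF oV x2 y] D_inner_const[OF C1_on_differentiable[OF C2_on_C1[OF x2] y]]
    by (simp add: T_def inner_diff_left inner_sum_left)
  \<comment> \<open>The frame coefficients vanish by the choice of \<open>a\<close>, so only the
    normal coefficient has to be computed.\<close>
  also have "T - D ?x y a = ((T - D ?x y a) \<bullet> N y) *\<^sub>R N y + (\<Sum>k\<in>UNIV. ((T - D ?x y a) \<bullet> D ?x y (e k)) *\<^sub>R D ?x y (e k))"
    by (rule normal_frame_expand[OF codim e N(3)]) (use N(2) O in auto)
  also have "(\<Sum>k\<in>UNIV. ((T - D ?x y a) \<bullet> D ?x y (e k)) *\<^sub>R D ?x y (e k)) = 0"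
    by (simp add: a)
  also have "(T - D ?x y a) \<bullet> N y = - h"
  proof -
    \<comment> \<open>Differentiating \<open><N, D x w> = 0\<close> moves the second derivative of
      the immersion onto the normal; the minus sign comes from the convention
      \<open>h_ij = <D_i \<nu>, e_j>\<close>.\<close>
    have "hess ?x y v w \<bullet> N y = - (D N y v \<bullet> D ?x y w)" for v w
    proof -
      have "D (\<lambda>z. N z \<bullet> D ?x z w) y v = N y \<bullet> hess ?x y v w + D N y v \<bullet> D ?x y w"
        using D_eqI[OF has_derivative_inner[OF has_D[OF N(1)] has_D[OF C1_on_differentiable[OF C2_on_D[OF x2] y]]]] by simp
      moreover have "D (\<lambda>z. N z \<bullet> D ?x z w) y = D (\<lambda>_. 0) y"
        by (rule D_cong_open[OF O(1,2)]) (use N in auto)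
      ultimately show ?thesis by (simp add: inner_commute)
    qed
    then show ?thesis using N(2)[OF O(2), of a]
      by (simp add: T_def inner_diff_left inner_sum_left inner_commute[of "D (X \<circ> \<psi>) y a"] sum_negf flip: H)
  qed
  finally show ?thesis by simp
qed

section \<open>Gradients and Laplacians in an arbitrary patch\<close>

text \<open>For differentiable functions this is \<open><grad u, grad v>\<close>; no gradient vector
  has to be introduced.\<close>

definition frame_inner where
  "frame_inner u v p = (\<Sum>k\<in>UNIV. mdiff \<A> u p (frame_at \<A> X p k) * mdiff \<A> v p (frame_at \<A> X p k))"

lemma patch_at_props: "patch_at \<A> p = (V, \<psi>) \<Longrightarrow> (V, \<psi>) \<in> \<A> \<and> coords_at \<A> p \<in> V \<and> \<psi> (coords_at \<A> p) = p"
proof -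
  assume eq: "patch_at \<A> p = (V, \<psi>)"
  obtain V0 \<psi>0 y0 where "(V0, \<psi>0) \<in> \<A>" "y0 \<in> V0" "\<psi>0 y0 = p" using patch_cover by blast
  then have "\<exists>c. c \<in> \<A> \<and> p \<in> snd c ` fst c" by force
  from someI_ex[OF this] have "(V, \<psi>) \<in> \<A>" "p \<in> \<psi> ` V" using eq unfolding patch_at_def by auto
  then show ?thesis using eq by (simp add: coords_at_def inv_into_into f_inv_into_f)
qed

lemma frame_at_orthonormal:
  assumes "patch_at \<A> p = (V, \<psi>)"
  shows "orthonormal_for (D (X \<circ> \<psi>) (coords_at \<A> p)) (frame_at \<A> X p)"
proof -
  have "orthonormal_frame \<A> X p e \<longleftrightarrow> orthonormal_for (D (X \<circ> \<psi>) (coords_at \<A> p)) e" for e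
    using assms by (simp add: orthonormal_frame_def orthonormal_for_def induced_metric_def mdiff_def)
  moreover have "\<exists>e. orthonormal_for (D (X \<circ> \<psi>) (coords_at \<A> p)) e"
    using patch_at_props[OF assms] frame_exists by blast
  ultimately show ?thesis unfolding frame_at_def using someI_ex by metis
qed

text \<open>The chosen frame lives in the patch selected at the point. Its image under the
  differential of the transition map is an orthonormal frame in the given patch, where the trace
  formula applies.\<close>

lemma frame_inner_patch:
  assumes c: "(V, \<psi>) \<in> \<A>" and y: "y \<in> V"
    and u: "(u \<circ> \<psi>) differentiable (at y)" and v: "(v \<circ> \<psi>) differentiable (at y)"
  shows "frame_inner u v (\<psi> y) =
    (\<Sum>i\<in>UNIV. \<Sum>j\<in>UNIV. matrix_inv (metric_matrix X \<psi> y) $ i $ j * (pd i (u \<circ> \<psi>) y * pd j (v \<circ> \<psi>) y))"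
proof -
  obtain V0 \<psi>0 where p: "patch_at \<A> (\<psi> y) = (V0, \<psi>0)" by (metis surj_pair)
  let ?y0 = "coords_at \<A> (\<psi> y)"
  have 0: "(V0, \<psi>0) \<in> \<A>" "?y0 \<in> V0" "\<psi>0 ?y0 = \<psi> y" using patch_at_props[OF p] by auto
  define e where "e = (\<lambda>k. D (transition V \<psi> \<psi>0) ?y0 (frame_at \<A> X (\<psi> y) k))"
  have e: "orthonormal_for (D (X \<circ> \<psi>) y) e"
    unfolding e_def by (rule frame_patch_change[OF 0(1) c 0(2) y 0(3) frame_at_orthonormal[OF p]])
  have m: "mdiff \<A> w (\<psi> y) (frame_at \<A> X (\<psi> y) k) = D (w \<circ> \<psi>) y (e k)"
    if "(w \<circ> \<psi>) differentiable (at y)" for w :: "'m \<Rightarrow> real" and k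
    unfolding e_def using D_patch_change[OF 0(1) c 0(2) y 0(3) that] by (simp add: mdiff_def p)
  have "frame_inner u v (\<psi> y) = (\<Sum>k\<in>UNIV. D (u \<circ> \<psi>) y (e k) * D (v \<circ> \<psi>) y (e k))"
    unfolding frame_inner_def by (simp add: m u v)
  also have "\<dots> = (\<Sum>i\<in>UNIV. \<Sum>j\<in>UNIV. matrix_inv (gram (D (X \<circ> \<psi>) y)) $ i $ j *\<^sub>R
      (D (u \<circ> \<psi>) y (axis i 1) * D (v \<circ> \<psi>) y (axis j 1)))"
    by (rule frame_trace[where B = "\<lambda>a b. D (u \<circ> \<psi>) y a * D (v \<circ> \<psi>) y b", OF patch_linear[OF c y] e])
      (rule linear_mult_right[OF D_linear[OF u]], rule linear_mult_left[OF D_linear[OF v]])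
  finally show ?thesis by (simp add: metric_matrix_gram pd_def)
qed

text \<open>The selected patch may vary from point to point; this lets a single patch be used over
  its whole domain, as differentiation and integration there require.\<close>

lemma laplacian_patch:
  assumes "(V, \<psi>) \<in> \<A>" "y \<in> V" "Ck_fun 2 \<A> f"
  shows "laplacian \<A> X f (\<psi> y) = patch_laplacian X \<psi> f y"
proof -
  obtain V0 \<psi>0 where p: "patch_at \<A> (\<psi> y) = (V0, \<psi>0)" by (metis surj_pair)
  have 0: "(V0, \<psi>0) \<in> \<A>" "coords_at \<A> (\<psi> y) \<in> V0" "\<psi>0 (coords_at \<A> (\<psi> y)) = \<psi> y" using patch_at_props[OF p] by auto
  have "C2_on V' (f \<circ> \<psi>')" if "(V', \<psi>') \<in> \<A>" for V' \<psi>'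
    using assms(3) that unfolding Ck_fun_def Ck_on_2 by auto
  then show ?thesis unfolding laplacian_def p snd_conv
    using patch_laplacian_change[OF 0(1) assms(1) 0(2) assms(2) 0(3)] 0(1) assms(1) by blast
qed

end

section \<open>Green's identity\<close>

text \<open>The quotient \<open>m (b - t) / (m (b - t) + m (t - a))\<close>, where \<open>m\<close>
  is \<open>t^2\<close> for positive \<open>t\<close> and 0 otherwise. Class C^1 is the regularity
  asked of a multiplier in Green's identity.\<close>

lemma C1_cutoff:
  fixes a b :: real
  assumes "a < b"
  obtains h h' where "\<And>t. (h has_real_derivative h' t) (at t)" "continuous_on UNIV h'"
    "\<And>t. t \<le> a \<Longrightarrow> h t = 1" "\<And>t. t \<ge> b \<Longrightarrow> h t = 0"
proof -
  define m where "m = (\<lambda>t::real. t * max 0 t)"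
  \<comment> \<open>At 0 the difference quotient is \<open>max 0 h\<close>, which tends to 0; on
    either side \<open>m\<close> agrees locally with a polynomial.\<close>
  have m: "(m has_real_derivative 2 * max 0 t) (at t)" for t
  proof (cases "t = 0")
    case True
    have "((\<lambda>h. max 0 h) \<longlongrightarrow> max 0 0) (at (0::real))" by (intro tendsto_intros)
    moreover have "\<forall>\<^sub>F h in at 0. max 0 h = (m (0 + h) - m 0) / h" by (auto simp: m_def eventually_at_filter)
    ultimately have "((\<lambda>h. (m (0 + h) - m 0) / h) \<longlongrightarrow> 0) (at 0)"
      using Lim_transform_eventually by fastforce
    then show ?thesis using True by (simp add: DERIV_def)
  next
    case False
    show ?thesis
    proof (cases "t > 0")
      case True
      have "((\<lambda>t. t * t) has_real_derivative 2 * max 0 t) (at t)"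
        using True by (auto intro!: derivative_eq_intros)
      then show ?thesis
        by (rule has_field_derivative_transform_within_open[of _ _ _ "{0<..}"]) (use True in \<open>auto simp: m_def\<close>)
    next
      case False
      with \<open>t \<noteq> 0\<close> have "t < 0" by simp
      have "((\<lambda>t. 0) has_real_derivative 2 * max 0 t) (at t)"
        using \<open>t < 0\<close> by auto
      then show ?thesis
        by (rule has_field_derivative_transform_within_open[of _ _ _ "{..<0}"]) (use \<open>t < 0\<close> in \<open>auto simp: m_def\<close>)
    qed
  qed
  have mpos: "m t > 0" if "t > 0" for t using that by (simp add: m_def)
  have m0: "m t = 0" if "t \<le> 0" for t using that by (simp add: m_def)
  have mnn: "m t \<ge> 0" for t using mpos[of t] m0[of t] by (cases "t > 0") auto
  define d where "d = (\<lambda>t. m (b - t) + m (t - a))"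
  \<comment> \<open>Since \<open>a < b\<close>, at least one of \<open>b - t\<close> and
    \<open>t - a\<close> is positive.\<close>
  have d: "d t > 0" for t
  proof (cases "t < b")
    case True then show ?thesis using mpos[of "b - t"] mnn[of "t - a"] by (simp add: d_def)
  next
    case False then show ?thesis using mpos[of "t - a"] mnn[of "b - t"] assms by (simp add: d_def)
  qed
  have m1: "((\<lambda>t. m (b - t)) has_real_derivative - (2 * max 0 (b - t))) (at t)" for t
  proof -
    have "((-) b has_real_derivative - 1) (at t)" by (auto intro!: derivative_eq_intros)
    from DERIV_chain2[OF m this] show ?thesis by simp
  qed
  have m2: "((\<lambda>t. m (t - a)) has_real_derivative 2 * max 0 (t - a)) (at t)" for t
  proof -
    have "((\<lambda>t. t - a) has_real_derivative 1) (at t)" by (auto intro!: derivative_eq_intros)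
    from DERIV_chain2[OF m this] show ?thesis by simp
  qed
  let ?d' = "\<lambda>t. - (2 * max 0 (b - t)) + 2 * max 0 (t - a)"
  have d': "(d has_real_derivative ?d' t) (at t)" for t
    unfolding d_def by (intro DERIV_add m1 m2)
  have cm: "continuous_on UNIV m" unfolding m_def by (intro continuous_intros)
  show ?thesis
  proof (rule that)
    show "((\<lambda>t. m (b - t) / d t) has_real_derivative
       (- (2 * max 0 (b - t)) * d t - m (b - t) * ?d' t) / (d t * d t)) (at t)" for t
      using DERIV_divide[OF m1 d', of t] d[of t] by simp
    have "d t \<noteq> 0" for t using d[of t] by simp
    then show "continuous_on UNIV (\<lambda>t. (- (2 * max 0 (b - t)) * d t - m (b - t) * ?d' t) / (d t * d t))"
      unfolding d_def by (intro continuous_intros continuous_on_compose2[OF cm]) auto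
    show "m (b - t) / d t = 1" if "t \<le> a" for t using that d[of t] m0[of "t - a"] by (simp add: d_def)
    show "m (b - t) / d t = 0" if "t \<ge> b" for t using that m0[of "b - t"] by simp
  qed
qed

text \<open>The cut-off is composed with the squared distance, which unlike the distance is
  differentiable at the centre; hence the thresholds \<open>r\<^sup>2\<close> and
  \<open>(2 * r)\<^sup>2\<close>.\<close>

lemma C1_bump:
  fixes y :: "'a::euclidean_space"
  assumes "r > 0"
  obtains b where "C1_on UNIV b" "\<And>z. z \<in> ball y r \<Longrightarrow> b z = (1::real)" "\<And>z. z \<notin> cball y (2 * r) \<Longrightarrow> b z = 0"
proof -
  have "r\<^sup>2 < (2 * r)\<^sup>2" using assms by (simp add: power_mult_distrib)
  from C1_cutoff[OF this] obtain h h' where h: "\<And>t. (h has_real_derivative h' t) (at t)" "continuous_on UNIV h'"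
    "\<And>t. t \<le> r\<^sup>2 \<Longrightarrow> h t = 1" "\<And>t. t \<ge> (2 * r)\<^sup>2 \<Longrightarrow> h t = 0" by blast
  show ?thesis
  proof (rule that[of "\<lambda>z. h ((z - y) \<bullet> (z - y))"])
    show "C1_on UNIV (\<lambda>z. h ((z - y) \<bullet> (z - y)))"
      by (rule C1_on_real_fun[OF h(1,2)]) (auto intro!: C1_on_inner C1_on_minus C1_on_id)
    show "h ((z - y) \<bullet> (z - y)) = 1" if "z \<in> ball y r" for z
      using that by (intro h(3)) (auto simp: dist_norm norm_minus_commute power2_norm_eq_inner[symmetric] intro!: power_mono)
    show "h ((z - y) \<bullet> (z - y)) = 0" if "z \<notin> cball y (2 * r)" for z
      unfolding power2_norm_eq_inner[symmetric] using that assms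
      by (intro h(4) power_mono) (auto simp: dist_norm norm_minus_commute)
  qed
qed

context smooth_immersed
begin

lemma Ck_fun_1_iff: "Ck_fun 1 \<A> u \<longleftrightarrow> (\<forall>(V, \<psi>)\<in>\<A>. C1_on V (u \<circ> \<psi>))"
  unfolding Ck_fun_def Ck_on_1 ..

lemma Ck_fun_1: "Ck_fun 1 \<A> u \<Longrightarrow> (V, \<psi>) \<in> \<A> \<Longrightarrow> C1_on V (u \<circ> \<psi>)"
  unfolding Ck_fun_1_iff by auto

lemma Ck_fun_2: "Ck_fun 2 \<A> u \<Longrightarrow> (V, \<psi>) \<in> \<A> \<Longrightarrow> C2_on V (u \<circ> \<psi>)"
  unfolding Ck_fun_def Ck_on_2 by auto

lemma Ck_fun_2_1: "Ck_fun 2 \<A> u \<Longrightarrow> Ck_fun 1 \<A> u"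
  using Ck_fun_2 C2_on_C1 unfolding Ck_fun_1_iff by blast

lemma mdiff_has_derivative:
  assumes "Ck_fun 1 \<A> u"
  shows "((u \<circ> snd (patch_at \<A> p)) has_derivative mdiff \<A> u p) (at (coords_at \<A> p))"
proof -
  obtain V \<psi> where p: "patch_at \<A> p = (V, \<psi>)" by (metis surj_pair)
  then show ?thesis using C1_on_has[OF Ck_fun_1[OF assms]] patch_at_props[OF p] unfolding mdiff_def by force
qed

lemma patch_at_coords: "snd (patch_at \<A> p) (coords_at \<A> p) = p"
  using patch_at_props[of p "fst (patch_at \<A> p)" "snd (patch_at \<A> p)"] by simp

lemma mdiff_eqI:
  assumes "((u \<circ> snd (patch_at \<A> p)) has_derivative u') (at (coords_at \<A> p))"
  shows "mdiff \<A> u p = u'"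
  using D_eqI[OF assms] by (simp add: mdiff_def)

lemma mdiff_add:
  assumes "Ck_fun 1 \<A> u" "Ck_fun 1 \<A> w"
  shows "mdiff \<A> (\<lambda>p. u p + w p) p v = mdiff \<A> u p v + mdiff \<A> w p v"
proof -
  let ?\<psi> = "snd (patch_at \<A> p)"
  have "((\<lambda>z. (u \<circ> ?\<psi>) z + (w \<circ> ?\<psi>) z) has_derivative (\<lambda>v. mdiff \<A> u p v + mdiff \<A> w p v)) (at (coords_at \<A> p))"
    by (rule has_derivative_add[OF mdiff_has_derivative[OF assms(1), of p] mdiff_has_derivative[OF assms(2), of p]])
  then show ?thesis using mdiff_eqI[of "\<lambda>p. u p + w p"] by (simp add: o_def)
qed

lemma mdiff_mult:
  fixes u w :: "'m \<Rightarrow> real"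
  assumes "Ck_fun 1 \<A> u" "Ck_fun 1 \<A> w"
  shows "mdiff \<A> (\<lambda>p. u p * w p) p v = u p * mdiff \<A> w p v + mdiff \<A> u p v * w p"
proof -
  let ?\<psi> = "snd (patch_at \<A> p)"
  have "((\<lambda>z. (u \<circ> ?\<psi>) z * (w \<circ> ?\<psi>) z) has_derivative (\<lambda>v. u p * mdiff \<A> w p v + mdiff \<A> u p v * w p)) (at (coords_at \<A> p))"
    using has_derivative_mult[OF mdiff_has_derivative[OF assms(1), of p] mdiff_has_derivative[OF assms(2), of p]]
    by (simp add: patch_at_coords)
  then show ?thesis using mdiff_eqI[of "\<lambda>p. u p * w p"] by (simp add: o_def)
qed

lemma mdiff_exp:
  fixes u :: "'m \<Rightarrow> real"
  assumes "Ck_fun 1 \<A> u"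
  shows "mdiff \<A> (\<lambda>p. exp (u p)) p v = exp (u p) * mdiff \<A> u p v"
proof -
  let ?\<psi> = "snd (patch_at \<A> p)"
  have "((\<lambda>z. exp ((u \<circ> ?\<psi>) z)) has_derivative (\<lambda>v. exp (u p) * mdiff \<A> u p v)) (at (coords_at \<A> p))"
    using has_derivative_exp[OF mdiff_has_derivative[OF assms(1), of p]]
    by (simp add: patch_at_coords mult.commute)
  then show ?thesis using mdiff_eqI[of "\<lambda>p. exp (u p)"] by (simp add: o_def)
qed

lemma mdiff_minus:
  assumes "Ck_fun 1 \<A> u"
  shows "mdiff \<A> (\<lambda>p. - u p) p v = - mdiff \<A> u p v"
proof -
  let ?\<psi> = "snd (patch_at \<A> p)"
  have "((\<lambda>z. - ((u \<circ> ?\<psi>) z)) has_derivative (\<lambda>v. - mdiff \<A> u p v)) (at (coords_at \<A> p))"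
    by (rule has_derivative_minus[OF mdiff_has_derivative[OF assms(1), of p]])
  then show ?thesis using mdiff_eqI[of "\<lambda>p. - u p"] by (simp add: o_def)
qed

text \<open>This is the divergence of the vector field u grad v.\<close>

definition green where
  "green u v p = frame_inner u v p + u p * laplacian \<A> X v p"

text \<open>In the patch, \<open>sqrt G\<close> times the divergence of \<open>u grad v\<close> is
  the coordinate divergence of \<open>sqrt G u g^{ij} d_j v\<close>. Each component is C^1 with
  compact support, so every partial derivative integrates to 0.\<close>

lemma green_patch_support:
  assumes c: "(V, \<psi>) \<in> \<A>" and K: "compact K" "K \<subseteq> V"
    and u: "Ck_fun 1 \<A> u" "\<And>p. p \<notin> \<psi> ` K \<Longrightarrow> u p = 0" and v: "Ck_fun 2 \<A> v"
  shows "integrable (riemannian_volume \<A> X) (green u v)" "(LINT p|riemannian_volume \<A> X. green u v p) = 0"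
proof -
  define q where "q = vol_density X \<psi>"
  define Y where "Y = (\<lambda>i z. q z * (\<Sum>j\<in>UNIV. matrix_inv (metric_matrix X \<psi> z) $ i $ j * pd j (v \<circ> \<psi>) z))"
  define F where "F = (\<lambda>i z. if z \<in> V then (u \<circ> \<psi>) z * Y i z else 0)"
  have oV: "open V" by (rule patch_open[OF c])
  have cK: "closed K" using K by (simp add: compact_imp_closed)
  have cpK: "closed (\<psi> ` K)"
    using K patch_cont[OF c] by (intro compact_imp_closed compact_continuous_image) (auto intro: continuous_on_subset)
  have u1: "C1_on V (u \<circ> \<psi>)" by (rule Ck_fun_1[OF u(1) c])
  have v2: "C2_on V (v \<circ> \<psi>)" by (rule Ck_fun_2[OF v c])
  have Y1: "C1_on V (Y i)" for i
    unfolding Y_def q_def pd_def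
    by (intro C1_on_mult C1_on_sum vol_density_C1[OF c] inverse_metric_C1[OF c] C2_on_D[OF v2])
  have F0: "F i z = 0" if "z \<notin> K" for i z
    using that u(2)[of "\<psi> z"] patch_inj[OF c] K(2) by (auto simp: F_def inj_on_def)
  \<comment> \<open>The extension by 0 is C^1 because the open sets \<open>V\<close> and
    \<open>- K\<close> cover the space and \<open>F i\<close> is identically 0 on the
    second.\<close>
  have F1: "C1_on UNIV (F i)" for i
  proof -
    have "C1_on V (F i)"
      by (subst C1_on_cong[OF oV, of _ "\<lambda>z. (u \<circ> \<psi>) z * Y i z"]) (simp add: F_def, rule C1_on_mult[OF u1 Y1])
    moreover have "C1_on (- K) (F i)"
      by (subst C1_on_cong[of _ _ "\<lambda>_. 0"]) (use cK F0 in auto)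
    moreover have "V \<union> - K = UNIV" using K by auto
    ultimately show ?thesis using C1_on_open_Un[of V "F i" "- K"] oV cK by auto
  qed
  define R where "R = (\<lambda>z. \<Sum>i\<in>UNIV. D (F i) z (axis i 1))"
  have R: "R y = q y * green u v (\<psi> y)" if y: "y \<in> V" for y
  proof -
    have du: "(u \<circ> \<psi>) differentiable (at y)" by (rule C1_on_differentiable[OF u1 y])
    have dv: "(v \<circ> \<psi>) differentiable (at y)" by (rule C1_on_differentiable[OF C2_on_C1[OF v2] y])
    have "D (F i) y w = (u \<circ> \<psi>) y * D (Y i) y w + D (u \<circ> \<psi>) y w * Y i y" for i w
    proof -
      have "D (F i) y = D (\<lambda>z. (u \<circ> \<psi>) z * Y i z) y"
        by (rule D_cong_open[OF oV y]) (simp add: F_def)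
      then show ?thesis
        using D_eqI[OF has_derivative_mult[OF has_D[OF du] has_D[OF C1_on_differentiable[OF Y1 y]]]] by simp
    qed
    then have "R y = u (\<psi> y) * (\<Sum>i\<in>UNIV. D (Y i) y (axis i 1)) + (\<Sum>i\<in>UNIV. D (u \<circ> \<psi>) y (axis i 1) * Y i y)"
      by (simp add: R_def sum.distrib sum_distrib_left)
    moreover have "(\<Sum>i\<in>UNIV. D (Y i) y (axis i 1)) = q y * laplacian \<A> X v (\<psi> y)"
      using vol_density_pos[OF c y] laplacian_patch[OF c y v]
      by (simp add: patch_laplacian_def Y_def q_def pd_def vol_density_def[abs_def])
    moreover have "(\<Sum>i\<in>UNIV. D (u \<circ> \<psi>) y (axis i 1) * Y i y) = q y * frame_inner u v (\<psi> y)"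
      unfolding frame_inner_patch[OF c y du dv]
      by (simp add: Y_def pd_def sum_distrib_left mult_ac)
    ultimately show ?thesis by (simp add: green_def algebra_simps)
  qed
  have R0: "R y = 0" if "y \<notin> K" for y
  proof -
    have "D (F i) y = D (\<lambda>_. 0) y" for i by (rule D_cong_open[of "- K"]) (use that cK F0 in auto)
    then show ?thesis by (simp add: R_def)
  qed
  \<comment> \<open>The compact image of \<open>K\<close> is closed, as the manifold is Hausdorff.
    So \<open>u\<close> vanishes in a neighbourhood of \<open>p\<close>, and its differential in the
    patch selected at \<open>p\<close> vanishes as well.\<close>
  have G0: "green u v p = 0" if p: "p \<notin> \<psi> ` K" for p
  proof -
    obtain V1 \<psi>1 where pa: "patch_at \<A> p = (V1, \<psi>1)" by (metis surj_pair)
    note pb = patch_at_props[OF pa]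
    have "D (u \<circ> \<psi>1) (coords_at \<A> p) = D (\<lambda>_. 0) (coords_at \<A> p)"
    proof (rule D_cong_open)
      show "open (V1 \<inter> \<psi>1 -` (- \<psi> ` K))" using pb cpK by (intro patch_open_vimage) auto
    qed (use pb p u(2) in auto)
    then show ?thesis using u(2)[OF p] by (simp add: green_def frame_inner_def mdiff_def pa)
  qed
  have eq: "indicator V y * vol_density X \<psi> y * green u v (\<psi> y) = R y" for y
    using R[of y] R0[of y] K by (auto simp: indicator_def q_def)
  have iR: "integrable lborel R" "(LINT y|lborel. R y) = 0"
    unfolding R_def using integral_D_eq_0[OF F1 K(1) F0]
    by (auto intro!: Bochner_Integration.integrable_sum simp: Bochner_Integration.integral_sum)
  \<comment> \<open>The pointwise choice of patches hides measurability; it is recovered from the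
    continuous expression \<open>R / q\<close> on the image of the patch, together with the value 0
    elsewhere.\<close>
  have meas: "green u v \<in> borel_measurable borel"
  proof -
    have "continuous_on UNIV R" unfolding R_def by (intro continuous_on_sum C1_on_D F1)
    then have "continuous_on (\<psi> ` V) (\<lambda>p. R (inv_into V \<psi> p) / q (inv_into V \<psi> p))"
      unfolding q_def
      by (intro continuous_on_divide continuous_on_compose2[OF _ patch_inv_cont[OF c]]
          continuous_on_compose2[OF C1_on_continuous[OF vol_density_C1[OF c]] patch_inv_cont[OF c]])
        (use vol_density_pos[OF c] in \<open>force simp: patch_inv[OF c]\<close>)+
    then have "(\<lambda>p. if p \<in> \<psi> ` V then R (inv_into V \<psi> p) / q (inv_into V \<psi> p) else 0) \<in> borel_measurable borel"
      by (intro borel_measurable_continuous_on_if) (use patch_open[OF c] in auto)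
    moreover have "(if p \<in> \<psi> ` V then R (inv_into V \<psi> p) / q (inv_into V \<psi> p) else 0) = green u v p" for p
      using R vol_density_pos[OF c] G0[of p] K by (auto simp: patch_inv[OF c] q_def) force
    ultimately show ?thesis by simp
  qed
  have "green u v p = 0" if "p \<notin> \<psi> ` V" for p using that K by (intro G0) auto
  from integral_patch[OF c meas this] iR show "integrable (riemannian_volume \<A> X) (green u v)"
    "(LINT p|riemannian_volume \<A> X. green u v p) = 0" by (simp_all add: eq)
qed

section \<open>Localisation by finitely many cut-offs\<close>

definition cutoff_set where
  "cutoff_set B \<longleftrightarrow> (\<exists>V \<psi> K \<beta>. (V, \<psi>) \<in> \<A> \<and> compact K \<and> K \<subseteq> V \<and> Ck_fun 1 \<A> \<beta> \<and>
     (\<forall>p. p \<notin> \<psi> ` K \<longrightarrow> \<beta> p = 0) \<and> (\<forall>p\<in>B. \<beta> p = (1::real)))"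

text \<open>A bump in the coordinates of one patch is transported to the manifold and extended by 0.
  The radii are chosen so that the closed ball supporting it stays inside the patch domain.\<close>

lemma cutoff_set_exists: "\<exists>B. open B \<and> p \<in> B \<and> cutoff_set B"
proof -
  obtain V \<psi> y where c: "(V, \<psi>) \<in> \<A>" and y: "y \<in> V" "\<psi> y = p" using patch_cover by blast
  have oV: "open V" by (rule patch_open[OF c])
  obtain s where s: "s > 0" "cball y s \<subseteq> V" using oV y(1) by (meson open_contains_cball)
  define r where "r = s / 2"
  have r: "r > 0" "cball y (2 * r) \<subseteq> V" using s by (auto simp: r_def)
  obtain b where b: "C1_on UNIV b" "\<And>z. z \<in> ball y r \<Longrightarrow> b z = (1::real)" "\<And>z. z \<notin> cball y (2 * r) \<Longrightarrow> b z = 0"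
    using C1_bump[OF r(1)] by metis
  let ?K = "cball y (2 * r)"
  have cpK: "closed (\<psi> ` ?K)"
    using r patch_cont[OF c] by (intro compact_imp_closed compact_continuous_image) (auto intro: continuous_on_subset)
  define \<beta> where "\<beta> = (\<lambda>p. if p \<in> \<psi> ` V then b (inv_into V \<psi> p) else 0)"
  have \<beta>: "\<beta> (\<psi> z) = b z" if "z \<in> V" for z using that by (simp add: \<beta>_def patch_inv[OF c])
  have \<beta>0: "\<beta> p = 0" if "p \<notin> \<psi> ` ?K" for p
  proof (cases "p \<in> \<psi> ` V")
    case True
    then obtain x where x: "x \<in> V" "p = \<psi> x" by blast
    then have "x \<notin> ?K" using that by blast
    then show ?thesis using \<beta>[OF x(1)] b(3) x(2) by simp
  qed (simp add: \<beta>_def)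
  have "C1_on V' (\<beta> \<circ> \<psi>')" if c': "(V', \<psi>') \<in> \<A>" for V' \<psi>'
  proof -
    \<comment> \<open>Regularity in another patch is checked on two open pieces: on the overlap the
      function is the bump composed with a transition map, and off the closed image of the support
      it is 0.\<close>
    let ?O1 = "V' \<inter> \<psi>' -` (\<psi> ` V)" and ?O2 = "V' \<inter> \<psi>' -` (- \<psi> ` ?K)"
    have o1: "open ?O1" by (rule overlap_open[OF c' c])
    have o2: "open ?O2" by (rule patch_open_vimage[OF c']) (use cpK in auto)
    have "C1_on ?O1 (\<beta> \<circ> \<psi>')"
    proof (subst C1_on_cong[OF o1])
      show "(\<beta> \<circ> \<psi>') x = b (transition V \<psi> \<psi>' x)" if "x \<in> ?O1" for x
        using that by (simp add: \<beta>_def transition_def)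
      show "C1_on ?O1 (\<lambda>x. b (transition V \<psi> \<psi>' x))"
        by (rule C1_on_compose[OF b(1) C2_on_C1[OF transition_C2[OF c' c]]]) simp
    qed
    moreover have "C1_on ?O2 (\<beta> \<circ> \<psi>')"
      by (subst C1_on_cong[OF o2, of _ "\<lambda>_. 0"]) (use \<beta>0 in auto)
    moreover have "?O1 \<union> ?O2 = V'" using r(2) by blast
    ultimately show ?thesis using C1_on_open_Un[OF _ _ o1 o2] by metis
  qed
  then have "Ck_fun 1 \<A> \<beta>" unfolding Ck_fun_1_iff by auto
  moreover have "\<forall>p\<in>\<psi> ` ball y r. \<beta> p = 1"
  proof -
    have "ball y r \<subseteq> V" using r by (force simp: subset_iff)
    then show ?thesis using \<beta> b(2) by auto
  qed
  ultimately have "cutoff_set (\<psi> ` ball y r)"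
    unfolding cutoff_set_def using c r(2) \<beta>0
    by (intro exI[of _ V] exI[of _ \<psi>] exI[of _ ?K] exI[of _ \<beta>] conjI allI impI) auto
  moreover have "open (\<psi> ` ball y r)"
    by (rule patch_open_image[OF c]) (use r in \<open>force simp: subset_iff\<close>)+
  moreover have "p \<in> \<psi> ` ball y r" using y r(1) by force
  ultimately show ?thesis by blast
qed

lemma Ck_fun_1_mult:
  fixes u w :: "'m \<Rightarrow> real"
  shows "Ck_fun 1 \<A> u \<Longrightarrow> Ck_fun 1 \<A> w \<Longrightarrow> Ck_fun 1 \<A> (\<lambda>p. u p * w p)"
  unfolding Ck_fun_1_iff by (auto simp: o_def intro!: C1_on_mult)

lemma Ck_fun_1_diff:
  fixes u w :: "'m \<Rightarrow> real"
  shows "Ck_fun 1 \<A> u \<Longrightarrow> Ck_fun 1 \<A> w \<Longrightarrow> Ck_fun 1 \<A> (\<lambda>p. u p - w p)"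
  unfolding Ck_fun_1_iff by (auto simp: o_def intro!: C1_on_minus)

lemma Ck_fun_1_exp:
  fixes u :: "'m \<Rightarrow> real"
  shows "Ck_fun 1 \<A> u \<Longrightarrow> Ck_fun 1 \<A> (\<lambda>p. exp (u p))"
  unfolding Ck_fun_1_iff by (auto simp: o_def intro!: C1_on_exp)

lemma Ck_fun_1_const: "Ck_fun 1 \<A> (\<lambda>p. c)"
  unfolding Ck_fun_1_iff by (auto simp: o_def)

lemma Ck_fun_1_minus:
  fixes u :: "'m \<Rightarrow> real"
  shows "Ck_fun 1 \<A> u \<Longrightarrow> Ck_fun 1 \<A> (\<lambda>p. - u p)"
  using Ck_fun_1_diff[OF Ck_fun_1_const[of "0::real"]] by simp

lemma green_add:
  fixes u w :: "'m \<Rightarrow> real"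
  assumes "Ck_fun 1 \<A> u" "Ck_fun 1 \<A> w"
  shows "green (\<lambda>p. u p + w p) v p = green u v p + green w v p"
  by (simp add: green_def frame_inner_def mdiff_add[OF assms] distrib_right sum.distrib)

text \<open>Splitting u = \<beta> u + (1 - \<beta>) u replaces a partition of unity: the second summand vanishes on the set B where \<beta> = 1.\<close>

lemma green_cover:
  assumes "finite \<B>" "\<forall>B\<in>\<B>. cutoff_set B" and v: "Ck_fun 2 \<A> v"
    and "Ck_fun 1 \<A> u" "\<And>p. u p \<noteq> 0 \<Longrightarrow> p \<in> \<Union>\<B>"
  shows "integrable (riemannian_volume \<A> X) (green u v) \<and> (LINT p|riemannian_volume \<A> X. green u v p) = 0"
  using assms(1,2,4,5)
proof (induction \<B> arbitrary: u rule: finite_induct)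
  case empty
  then have "u p = 0" for p by auto
  then have "green u v = (\<lambda>_. 0)" by (auto simp: green_def frame_inner_def mdiff_def o_def)
  then show ?case by simp
next
  case (insert B \<B>)
  obtain V \<psi> K \<beta> where c: "(V, \<psi>) \<in> \<A>" "compact K" "K \<subseteq> V" and \<beta>: "Ck_fun 1 \<A> \<beta>"
     "\<And>p. p \<notin> \<psi> ` K \<Longrightarrow> \<beta> p = 0" "\<And>p. p \<in> B \<Longrightarrow> \<beta> p = (1::real)"
    using insert.prems(1) unfolding cutoff_set_def by auto
  let ?u1 = "\<lambda>p. \<beta> p * u p" and ?u2 = "\<lambda>p. (1 - \<beta> p) * u p"
  have C: "Ck_fun 1 \<A> ?u1" "Ck_fun 1 \<A> ?u2"
    by (intro Ck_fun_1_mult Ck_fun_1_diff Ck_fun_1_const \<beta>(1) insert.prems(2))+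
  have 1: "integrable (riemannian_volume \<A> X) (green ?u1 v)" "(LINT p|riemannian_volume \<A> X. green ?u1 v p) = 0"
    by (rule green_patch_support[OF c C(1) _ v]; use \<beta>(2) in simp)+
  have "p \<in> \<Union>\<B>" if "?u2 p \<noteq> 0" for p using that insert.prems(3)[of p] \<beta>(3)[of p] by auto
  then have 2: "integrable (riemannian_volume \<A> X) (green ?u2 v)" "(LINT p|riemannian_volume \<A> X. green ?u2 v p) = 0"
    using insert.IH[OF _ C(2)] insert.prems(1) by auto
  have "green u v = (\<lambda>p. green ?u1 v p + green ?u2 v p)"
    unfolding green_add[OF C, symmetric] by (simp add: algebra_simps)
  then show ?case using 1 2 by simp
qed

theorem green_compact_support:
  assumes "Ck_fun 1 \<A> u" "compact K" "\<And>p. p \<notin> K \<Longrightarrow> u p = 0" and v: "Ck_fun 2 \<A> v"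
  shows "integrable (riemannian_volume \<A> X) (green u v)" "(LINT p|riemannian_volume \<A> X. green u v p) = 0"
proof -
  obtain \<B> where "\<B> \<subseteq> {B. open B \<and> cutoff_set B}" "finite \<B>" "K \<subseteq> \<Union>\<B>"
  proof (rule compactE[OF assms(2)])
    show "K \<subseteq> \<Union>{B. open B \<and> cutoff_set B}" using cutoff_set_exists by fast
  qed auto
  moreover from this have "p \<in> \<Union>\<B>" if "u p \<noteq> 0" for p using assms(3)[of p] that by blast
  ultimately have "integrable (riemannian_volume \<A> X) (green u v) \<and> (LINT p|riemannian_volume \<A> X. green u v p) = 0"
    by (intro green_cover[of \<B>, OF _ _ v assms(1)]) auto
  then show "integrable (riemannian_volume \<A> X) (green u v)" "(LINT p|riemannian_volume \<A> X. green u v p) = 0"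
    by auto
qed

section \<open>Unit normals and the height function\<close>

text \<open>At each point \<open>mdiff\<close> uses the patch selected there. Orthogonality verified
  in a fixed patch reaches all tangent vectors in the sense of \<open>mdiff\<close> through this
  inclusion of ranges.\<close>

lemma mdiff_patch:
  assumes c: "(V, \<psi>) \<in> \<A>" and z: "z \<in> V"
  shows "\<exists>w. mdiff \<A> X (\<psi> z) v = D (X \<circ> \<psi>) z w"
proof -
  obtain V1 \<psi>1 where p: "patch_at \<A> (\<psi> z) = (V1, \<psi>1)" by (metis surj_pair)
  note pb = patch_at_props[OF p]
  show ?thesis
    using D_patch_change[OF _ c _ z _ immersion_differentiable[OF _ c _ z]] pb by (auto simp: mdiff_def p)
qed

text \<open>A vector normal at the one point \<open>y\<close> is extended as a constant, its
  tangential part is removed at neighbouring points, and the result is normalised where it is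
  nonzero. The construction gives C^1 dependence, so that the normal can be differentiated.\<close>

lemma local_unit_normal:
  assumes codim: "CARD('k) = CARD('n) + 1" and c: "(V, \<psi>) \<in> \<A>" and y: "y \<in> V"
  obtains O' N where "open O'" "y \<in> O'" "O' \<subseteq> V" "C1_on O' N"
    "\<And>z. z \<in> O' \<Longrightarrow> norm (N z) = 1" "\<And>z v. z \<in> O' \<Longrightarrow> N z \<bullet> D (X \<circ> \<psi>) z v = 0"
    "unit_normal_near \<A> X (\<psi> y) (\<lambda>q. N (inv_into V \<psi> q))"
proof -
  let ?x = "X \<circ> \<psi>"
  have oV: "open V" by (rule patch_open[OF c])
  have x2: "C2_on V ?x" by (rule patch_C2[OF c])
  have "dim (range (D ?x y)) \<le> CARD('n)"
    using dim_image_le[OF patch_linear[OF c y], of UNIV] by simp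
  then have "dim (range (D ?x y)) < DIM(real^'k)" using codim by simp
  then obtain N0 where N0: "N0 \<noteq> 0" "\<And>w. w \<in> span (range (D ?x y)) \<Longrightarrow> orthogonal N0 w"
    using orthogonal_to_subspace_exists by metis
  have N0': "N0 \<bullet> D ?x y v = 0" for v using N0(2)[of "D ?x y v"] by (auto simp: orthogonal_def span_base)
  define gi where "gi = (\<lambda>z. matrix_inv (metric_matrix X \<psi> z))"
  \<comment> \<open>The tangential projection is written with \<open>g^{ij}\<close> instead of an
    orthonormal frame, so its regularity follows from that of the inverse metric and no frame field
    has to be chosen.\<close>
  define M where "M = (\<lambda>z. N0 - (\<Sum>i\<in>UNIV. \<Sum>j\<in>UNIV. (gi z $ i $ j * (N0 \<bullet> D ?x z (axis i 1))) *\<^sub>R D ?x z (axis j 1)))"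
  have M1: "C1_on V M"
    unfolding M_def gi_def
    by (intro C1_on_minus C1_on_sum C1_on_scaleR C1_on_mult C1_on_inner C1_on_const inverse_metric_C1[OF c] C2_on_D[OF x2])
  have Mn: "M z \<bullet> D ?x z v = 0" if z: "z \<in> V" for z v
  proof -
    have "M z \<bullet> D ?x z (axis k 1) = 0" for k
    proof -
      have "(\<Sum>i\<in>UNIV. \<Sum>j\<in>UNIV. (gi z $ i $ j * (N0 \<bullet> D ?x z (axis i 1))) *\<^sub>R D ?x z (axis j 1)) \<bullet> D ?x z (axis k 1)
        = (\<Sum>i\<in>UNIV. (N0 \<bullet> D ?x z (axis i 1)) * (gi z ** metric_matrix X \<psi> z) $ i $ k)"
        by (simp add: inner_sum_left matrix_matrix_mult_def metric_matrix_gram gram_def sum_distrib_left mult_ac)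
      also have "\<dots> = (\<Sum>i\<in>UNIV. if i = k then N0 \<bullet> D ?x z (axis i 1) else 0)"
        using metric_inverse(1)[OF c z] by (intro sum.cong) (auto simp: gi_def mat_def)
      finally show ?thesis by (simp add: M_def inner_diff_left)
    qed
    then show ?thesis by (subst linear_vec_expand[OF patch_linear[OF c z]]) (simp add: inner_sum_right)
  qed
  define O' where "O' = V \<inter> M -` (- {0})"
  have oO: "open O'" unfolding O'_def by (rule continuous_open_preimage[OF C1_on_continuous[OF M1] oV]) auto
  have "M y = N0" using N0' by (simp add: M_def)
  then have yO: "y \<in> O'" using y N0 by (simp add: O'_def)
  have OV: "O' \<subseteq> V" by (auto simp: O'_def)
  define N where "N = (\<lambda>z. inverse (sqrt (M z \<bullet> M z)) *\<^sub>R M z)"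
  have "M z \<bullet> M z > 0" if "z \<in> O'" for z using that by (simp add: O'_def)
  then have N1: "C1_on O' N" unfolding N_def
    by (intro C1_on_scaleR C1_on_inverse C1_on_sqrt C1_on_inner C1_on_subset[OF M1 OV]) force+
  have Nn: "norm (N z) = 1" if "z \<in> O'" for z
    using that by (simp add: N_def O'_def norm_eq_sqrt_inner[symmetric])
  have No: "N z \<bullet> D ?x z v = 0" if "z \<in> O'" for z v
    using Mn[of z v] that OV by (auto simp: N_def)
  have "unit_normal_near \<A> X (\<psi> y) (\<lambda>q. N (inv_into V \<psi> q))"
    unfolding unit_normal_near_def
  proof (intro exI[of _ "\<psi> ` O'"] conjI ballI allI)
    show "open (\<psi> ` O')" by (rule patch_open_image[OF c oO OV])
    show "\<psi> y \<in> \<psi> ` O'" using yO by simp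
    show "continuous_on (\<psi> ` O') (\<lambda>q. N (inv_into V \<psi> q))"
      by (rule continuous_on_compose2[OF C1_on_continuous[OF N1] continuous_on_subset[OF patch_inv_cont[OF c]]])
        (use OV patch_inv[OF c] in auto)
    fix q assume "q \<in> \<psi> ` O'"
    then obtain z where z: "z \<in> O'" "q = \<psi> z" "inv_into V \<psi> q = z" using OV patch_inv[OF c] by auto
    show "norm (N (inv_into V \<psi> q)) = 1" using z Nn by simp
    show "N (inv_into V \<psi> q) \<bullet> mdiff \<A> X q v = 0" for v
    proof -
      obtain w where "mdiff \<A> X (\<psi> z) v = D (X \<circ> \<psi>) z w" using mdiff_patch[OF c, of z v] z(1) OV by blast
      then show ?thesis using No[OF z(1), of w] z by simp
    qed
  qed
  then show ?thesis using that[OF oO yO OV N1 Nn No] by blast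
qed

lemma Ck_fun_height: "Ck_fun 2 \<A> (\<lambda>p. X p \<bullet> W)"
  unfolding Ck_fun_def Ck_on_2
proof (clarify)
  fix V \<psi> assume c: "(V, \<psi>) \<in> \<A>"
  show "C2_on V ((\<lambda>p. X p \<bullet> W) \<circ> \<psi>)"
    using C2_on_inner_const[OF patch_open(1)[OF c] patch_C2[OF c], of W] by (simp add: o_def)
qed

lemma mdiff_height: "mdiff \<A> (\<lambda>p. X p \<bullet> W) p v = mdiff \<A> X p v \<bullet> W"
proof -
  obtain V \<psi> where p: "patch_at \<A> p = (V, \<psi>)" by (metis surj_pair)
  note pb = patch_at_props[OF p]
  have "(X \<circ> \<psi>) differentiable (at (coords_at \<A> p))" using C1_on_differentiable[OF C2_on_C1[OF patch_C2]] pb by blast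
  from D_inner_const[OF this, of W v] show ?thesis by (simp add: mdiff_def p o_def)
qed

text \<open>The tangential part of \<open>W\<close> is the gradient of the height, so the drift term
  is \<open><grad f, grad S>\<close>.\<close>

lemma mdiff_tangential_part:
  fixes f :: "'m \<Rightarrow> real"
  assumes "Ck_fun 1 \<A> f"
  shows "mdiff \<A> f p (tangential_part \<A> X W p) = frame_inner f (\<lambda>p. X p \<bullet> W) p"
proof -
  obtain V \<psi> where p: "patch_at \<A> p = (V, \<psi>)" by (metis surj_pair)
  note pb = patch_at_props[OF p]
  define J where "J = mdiff \<A> X p"
  define e where "e = frame_at \<A> X p"
  have Jx: "J = D (X \<circ> \<psi>) (coords_at \<A> p)" by (simp add: J_def mdiff_def p fun_eq_iff)
  have J: "linear J" "inj J" using pb patch_linear patch_D_inj by (auto simp: Jx)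
  have e: "orthonormal_for J e" using frame_at_orthonormal[OF p] by (simp add: Jx e_def)
  have "tangential_part \<A> X W p = (\<Sum>k\<in>UNIV. (W \<bullet> J (e k)) *\<^sub>R e k)"
    unfolding tangential_part_def J_def[symmetric]
    using tangential_component_exists[OF J(1) e] tangential_component_unique[OF J, of W]
    by (intro the_equality) auto
  moreover have "linear (mdiff \<A> f p)" using mdiff_has_derivative[OF assms] has_derivative_linear by blast
  ultimately show ?thesis
    by (simp add: frame_inner_def mdiff_height linear_sum linear_cmul e_def J_def inner_commute[of W] mult.commute)
qed

end

locale soliton = smooth_immersed \<A> X
  for \<A> :: "('n::finite, 'm::{t2_space, second_countable_topology}) patch set"
    and X :: "'m \<Rightarrow> real^'k" +
  fixes W :: "real^'k"
  assumes codim: "CARD('k) = CARD('n) + 1"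
    and unit: "norm W = 1"
    and soliton: "translating_soliton \<A> X W"
begin

text \<open>Pythagoras for the unit vector \<open>W\<close>: its tangential part has squared length
  \<open>|grad S|^2\<close>.\<close>

lemma normal_component:
  assumes "unit_normal_near \<A> X p \<nu>"
  shows "(\<nu> p \<bullet> W)\<^sup>2 = 1 - frame_inner (\<lambda>p. X p \<bullet> W) (\<lambda>p. X p \<bullet> W) p"
proof -
  obtain V \<psi> where p: "patch_at \<A> p = (V, \<psi>)" by (metis surj_pair)
  have e: "orthonormal_for (mdiff \<A> X p) (frame_at \<A> X p)" using frame_at_orthonormal[OF p] by (simp add: mdiff_def p orthonormal_for_def)
  have \<nu>: "norm (\<nu> p) = 1" "\<And>v. \<nu> p \<bullet> mdiff \<A> X p v = 0" using assms by (auto simp: unit_normal_near_def)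
  have "W \<bullet> W = ((W \<bullet> \<nu> p) *\<^sub>R \<nu> p + (\<Sum>k\<in>UNIV. (W \<bullet> mdiff \<A> X p (frame_at \<A> X p k)) *\<^sub>R mdiff \<A> X p (frame_at \<A> X p k))) \<bullet> W"
    using normal_frame_expand[OF codim e \<nu>, of W] by simp
  then have "1 = (W \<bullet> \<nu> p) * (\<nu> p \<bullet> W) + (\<Sum>k\<in>UNIV. (W \<bullet> mdiff \<A> X p (frame_at \<A> X p k)) * (mdiff \<A> X p (frame_at \<A> X p k) \<bullet> W))"
    using unit unfolding norm_eq_1 inner_add_left inner_sum_left inner_scaleR_left by (simp only:)
  then show ?thesis
    unfolding frame_inner_def mdiff_height inner_commute[of W] power2_eq_square by linarith
qed

text \<open>The soliton equation turns \<open>Delta S = - H <\<nu>, W>\<close> into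
  \<open>- <\<nu>, W>^2\<close>. The same equation gives \<open>H^2 = <\<nu>, W>^2\<close> for the
  selected normal, and \<open>normal_component\<close> evaluates both squares without comparing the
  two normals.\<close>

lemma laplacian_height:
  "laplacian \<A> X (\<lambda>p. X p \<bullet> W) p = frame_inner (\<lambda>p. X p \<bullet> W) (\<lambda>p. X p \<bullet> W) p - 1"
  and mean_curvature_sq_height:
  "mean_curvature_sq \<A> X p = 1 - frame_inner (\<lambda>p. X p \<bullet> W) (\<lambda>p. X p \<bullet> W) p"
proof -
  obtain V \<psi> where p: "patch_at \<A> p = (V, \<psi>)" by (metis surj_pair)
  note pb = patch_at_props[OF p]
  let ?y = "coords_at \<A> p" and ?e = "frame_at \<A> X p"
  have c: "(V, \<psi>) \<in> \<A>" and y: "?y \<in> V" and yp: "\<psi> ?y = p" using pb by auto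
  obtain O' N where O: "open O'" "?y \<in> O'" "O' \<subseteq> V" and N1: "C1_on O' N"
    and N: "\<And>z. z \<in> O' \<Longrightarrow> norm (N z) = 1" "\<And>z v. z \<in> O' \<Longrightarrow> N z \<bullet> D (X \<circ> \<psi>) z v = 0"
    and un: "unit_normal_near \<A> X p (\<lambda>q. N (inv_into V \<psi> q))"
    using local_unit_normal[OF codim c y] unfolding yp by metis
  let ?\<nu> = "\<lambda>q. N (inv_into V \<psi> q)"
  have \<nu>p: "?\<nu> p = N ?y" using patch_inv[OF c y] by (simp add: yp)
  have "D (?\<nu> \<circ> \<psi>) ?y = D N ?y"
    by (rule D_cong_open[OF O(1,2)]) (use O(3) patch_inv[OF c] in auto)
  then have "mean_curvature_wrt \<A> X ?\<nu> p = (\<Sum>k\<in>UNIV. D N ?y (?e k) \<bullet> D (X \<circ> \<psi>) ?y (?e k))"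
    by (simp add: mean_curvature_wrt_def sff_def mdiff_def p)
  moreover have "mean_curvature_wrt \<A> X ?\<nu> p = N ?y \<bullet> W"
    using soliton un \<nu>p unfolding translating_soliton_def by metis
  ultimately have H: "(\<Sum>k\<in>UNIV. D N ?y (?e k) \<bullet> D (X \<circ> \<psi>) ?y (?e k)) = N ?y \<bullet> W" by simp
  have "laplacian \<A> X (\<lambda>p. X p \<bullet> W) p = - (N ?y \<bullet> W) * (N ?y \<bullet> W)"
    unfolding laplacian_def p snd_conv
    by (rule patch_laplacian_coordinate[OF codim c y frame_at_orthonormal[OF p] O C1_on_differentiable[OF N1 O(2)] N(2) N(1)[OF O(2)] H])
  then show "laplacian \<A> X (\<lambda>p. X p \<bullet> W) p = frame_inner (\<lambda>p. X p \<bullet> W) (\<lambda>p. X p \<bullet> W) p - 1"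
    using normal_component[OF un] \<nu>p by (simp add: power2_eq_square)
  \<comment> \<open>The locally constructed normal witnesses existence, so the selected normal
    satisfies its specification and the soliton equation applies to it.\<close>
  have sn: "unit_normal_near \<A> X p (some_normal \<A> X p)" unfolding some_normal_def by (rule someI[of "unit_normal_near \<A> X p"], rule un)
  then show "mean_curvature_sq \<A> X p = 1 - frame_inner (\<lambda>p. X p \<bullet> W) (\<lambda>p. X p \<bullet> W) p"
    using normal_component[OF sn] soliton unfolding mean_curvature_sq_def translating_soliton_def by simp
qed

section \<open>Stability\<close>

lemma stability:
  fixes f :: "'m \<Rightarrow> real"
  assumes curv: "\<And>p. a * (a - 1) - a\<^sup>2 * mean_curvature_sq \<A> X p + sff_norm_sq \<A> X p \<le> 0"
    and f: "Ck_fun 2 \<A> f" "compactly_supported f"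
  shows "0 \<le> (LINT p|riemannian_volume \<A> X.
           (- laplacian \<A> X f p + mdiff \<A> f p (tangential_part \<A> X W p) - sff_norm_sq \<A> X p * f p)
           * f p * exp (- (X p \<bullet> W)))"
    (is "0 \<le> (LINT p|?\<mu>. ?I p)")
proof (cases "integrable ?\<mu> ?I")
  case False
  \<comment> \<open>the Bochner integral of a nonintegrable function is 0; no regularity of |A|^2 is needed\<close>
  then show ?thesis by (simp add: not_integrable_integral_eq)
next
  case True
  define S where "S = (\<lambda>p. X p \<bullet> W)"
  define E where "E = (\<lambda>p. exp (- S p))"
  \<comment> \<open>The divergence field is split as \<open>a * w grad S - u grad f\<close>. Here
    \<open>u\<close> is the weighted test function, not the supersolution
    \<open>exp (a S)\<close>.\<close>
  define u where "u = (\<lambda>p. E p * f p)"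
  define w where "w = (\<lambda>p. u p * f p)"
  let ?K = "closure {p. f p \<noteq> 0}"
  have K: "compact ?K" using f(2) by (simp add: compactly_supported_def)
  have f0: "f p = 0" if "p \<notin> ?K" for p using that closure_subset[of "{p. f p \<noteq> 0}"] by blast
  have f1: "Ck_fun 1 \<A> f" and S2: "Ck_fun 2 \<A> S" and S1: "Ck_fun 1 \<A> S"
    using Ck_fun_2_1 f(1) Ck_fun_height by (auto simp: S_def)
  have E1: "Ck_fun 1 \<A> E" unfolding E_def by (intro Ck_fun_1_exp Ck_fun_1_minus S1)
  have u1: "Ck_fun 1 \<A> u" unfolding u_def by (intro Ck_fun_1_mult E1 f1)
  have w1: "Ck_fun 1 \<A> w" unfolding w_def by (intro Ck_fun_1_mult u1 f1)
  have u0: "u p = 0" and w0: "w p = 0" if "p \<notin> ?K" for p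
    using f0[OF that] by (simp_all add: u_def w_def)
  have gu: "integrable ?\<mu> (green u f)" "(LINT p|?\<mu>. green u f p) = 0"
    using green_compact_support[OF u1 K u0 f(1)] by blast+
  have gw: "integrable ?\<mu> (green w S)" "(LINT p|?\<mu>. green w S p) = 0"
    using green_compact_support[OF w1 K w0 S2] by blast+
  have le: "a * green w S p - green u f p \<le> ?I p" for p
  proof -
    define df where "df = (\<lambda>k. mdiff \<A> f p (frame_at \<A> X p k))"
    define s where "s = (\<lambda>k. mdiff \<A> S p (frame_at \<A> X p k))"
    have fold_frame: "mdiff \<A> f p (frame_at \<A> X p k) = df k" "mdiff \<A> S p (frame_at \<A> X p k) = s k" for k
      by (simp_all add: df_def s_def)
    define P where "P = (\<Sum>k\<in>UNIV. df k * df k)"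
    define Q where "Q = (\<Sum>k\<in>UNIV. df k * s k)"
    define R where "R = (\<Sum>k\<in>UNIV. s k * s k)"
    define L where "L = laplacian \<A> X f p"
    define A2 where "A2 = sff_norm_sq \<A> X p"
    have du: "mdiff \<A> u p v = E p * (mdiff \<A> f p v - f p * mdiff \<A> S p v)" for v
      unfolding u_def mdiff_mult[OF E1 f1] unfolding E_def mdiff_exp[OF Ck_fun_1_minus[OF S1]] mdiff_minus[OF S1]
      by (simp add: algebra_simps)
    have dw: "mdiff \<A> w p v = E p * (2 * f p * mdiff \<A> f p v - f p * f p * mdiff \<A> S p v)" for v
      unfolding w_def mdiff_mult[OF u1 f1] du by (simp add: u_def algebra_simps)
    have R: "frame_inner S S p = R" by (simp add: frame_inner_def R_def s_def)
    have fu: "frame_inner u f p = E p * (P - f p * Q)"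
      unfolding frame_inner_def du fold_frame P_def Q_def
      by (simp add: sum_distrib_left algebra_simps sum_subtractf)
    have fw: "frame_inner w S p = E p * (2 * f p * Q - f p * f p * R)"
      unfolding frame_inner_def dw fold_frame R_def Q_def
      by (simp add: sum_distrib_left algebra_simps sum_subtractf)
    have lS: "laplacian \<A> X S p = R - 1" using laplacian_height[of p] R by (simp add: S_def)
    have tp: "mdiff \<A> f p (tangential_part \<A> X W p) = Q"
      using mdiff_tangential_part[OF f1, of p W] by (simp add: Q_def frame_inner_def df_def s_def S_def)
    have H: "a * (a - 1) - a\<^sup>2 * (1 - R) + A2 \<le> 0"
      using curv[of p] mean_curvature_sq_height[of p] R by (simp add: S_def A2_def)
    have "0 \<le> (\<Sum>k\<in>UNIV. (df k - a * f p * s k)\<^sup>2)" by (intro sum_nonneg) auto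
    also have "\<dots> = P - 2 * a * f p * Q + a\<^sup>2 * (f p)\<^sup>2 * R"
      by (simp add: P_def Q_def R_def power2_eq_square algebra_simps sum.distrib sum_subtractf sum_distrib_left)
    finally have sq: "0 \<le> P - 2 * a * f p * Q + a\<^sup>2 * (f p)\<^sup>2 * R" .
    have "(a * (a - 1) - a\<^sup>2 * (1 - R) + A2) * (f p)\<^sup>2 \<le> 0" using H by (simp add: mult_nonpos_nonneg)
    \<comment> \<open>The terms \<open>a\<^sup>2 * R\<close> and \<open>a\<^sup>2\<close> cancel.
      This is where the coefficient \<open>a\<^sup>2\<close> of \<open>H^2\<close> in the curvature
      condition matters.\<close>
    with sq have "0 \<le> P - 2 * a * f p * Q + (a - A2) * (f p)\<^sup>2" by (simp add: algebra_simps power2_eq_square)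
    then have "0 \<le> E p * (P - 2 * a * f p * Q + (a - A2) * (f p)\<^sup>2)" by (simp add: E_def)
    \<comment> \<open>The term with the Laplacian of \<open>f\<close> cancels against that in
      \<open>green u f\<close>. In \<open>green w S\<close> the contribution of
      \<open>|grad S|^2\<close> from differentiating the weight cancels the one from
      \<open>Delta S = |grad S|^2 - 1\<close>, leaving \<open>- a f^2\<close>.\<close>
    also have "\<dots> = ?I p - (a * green w S p - green u f p)"
      unfolding green_def fu fw lS tp L_def[symmetric] A2_def[symmetric]
      unfolding w_def u_def S_def[symmetric] E_def[symmetric]
      by (simp add: E_def S_def algebra_simps power2_eq_square)
    finally show ?thesis by simp
  qed
  have "0 = (LINT p|?\<mu>. a * green w S p - green u f p)" using gu gw by simp
  also have "\<dots> \<le> (LINT p|?\<mu>. ?I p)"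
    by (rule integral_mono) (use gu gw True le in auto)
  finally show ?thesis .
qed

end

theorem theorem4:
  fixes \<A> :: "('n::finite, 'm::{t2_space, second_countable_topology}) patch set"
    and X :: "'m \<Rightarrow> real^'k"
    and W :: "real^'k"
    and a :: real
  assumes codim: "CARD('k) = CARD('n) + 1"
    and unit: "norm W = 1"
    and manifold: "smooth_atlas \<A>"
    and immersion: "smooth_immersion \<A> X"
    and proper: "proper_map euclidean euclidean X"
    and complete: "riemannian_complete \<A> X"
    and soliton: "translating_soliton \<A> X W"
    and a_pos: "a > 0"
    and curv: "\<And>p. a * (a - 1) - a\<^sup>2 * mean_curvature_sq \<A> X p + sff_norm_sq \<A> X p \<le> 0"
  shows "\<forall>f :: 'm \<Rightarrow> real. Ck_fun 2 \<A> f \<and> compactly_supported f \<longrightarrow>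
    0 \<le> (LINT p|riemannian_volume \<A> X.
           (- laplacian \<A> X f p + mdiff \<A> f p (tangential_part \<A> X W p) - sff_norm_sq \<A> X p * f p)
           * f p * exp (- (X p \<bullet> W)))"
proof -
  interpret soliton \<A> X W
    by unfold_locales (fact codim unit manifold immersion soliton)+
  show ?thesis using stability[OF curv] by blast
qed

end
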